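(* Let $G$ be a maximal outerplanar graph of order $n\ge 3$. Then $\beta(G)=2$ if and only if there is a representation $G^*$ of $G$ as a subgraph of the strong product $P_n\boxtimes P_n$ of two paths (that is, a subgraph $G^*$ of $P_n\boxtimes P_n$ isomorphic to $G$) such that, for some $d\ge 1$, the following four conditions hold: (1) $V(G^* )\subseteq A_d$, $V_d\cap A_d\subseteq V(G^* )$, and $E(G^* )$ contains the edges of the shortest path joining $(0,d)$ and $(d,0)$ (the path whose vertices are the points $(i,j)$ with $i+j=d$). (2) $V_{d+1}\cap A_d\subseteq V(G^* )$, and for each $(i,j)\in V_{d+1}\cap A_d$, $E(G^* )$ contains the edges $(i,j)(i-1,j)$ and $(i,j)(i,j-1)$. (3) For every pair of vertices $(i,j+1)$ and $(i+1,j)$ of $V_{d+1}$ with $i,j\ge 1$, either $(i,j+1)(i+1,j)\in E(G^* )$ or $\{(i,j+1)(i+1,j+1),\ (i+1,j)(i+1,j+1),\ (i,j)(i+1,j+1)\}\subseteq E(G^* )$. Moreover, if $(i,j+1)(i+1,j)\in E(G^* )$ belongs to two triangles of $G^*$, then $(i+1,j+1)\in V(G^* )$ and $\{(i,j+1)(i+1,j+1),\ (i+1,j)(i+1,j+1)\}\subseteq E(G^* )$. (4) Any other vertex or edge of $G^*$ (i.e. one not described in (1)-(3)) belongs to a vertical or horizontal MOP zigzag (contained in $G^*$) with base line the edge $(0,d)(1,d)$, or the edge $(d,0)(d,1)$, or any other edge of $G^*$ from those described in (1)-(3) with one endpoint in $V_{d+1}$ and the other in $V_{d+2}$, with the additional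 condition that two distinct maximal vertical or horizontal MOP zigzags do not share any edge.
   Context: Graphs are finite, simple and connected; $d(u,v)$ is the length of a shortest path between $u$ and $v$. A vertex $x$ resolves $u,v$ if $d(u,x)\ne d(v,x)$; a set $S\subseteq V(G)$ is a resolving set if every pair of distinct vertices is resolved by some vertex of $S$; the metric dimension $\beta(G)$ is the minimum cardinality of a resolving set. A graph is outerplanar if it can be drawn in the plane without crossings with all vertices on the unbounded face; a maximal outerplanar graph (MOP graph) is an outerplanar graph such that the addition of any edge produces a non-outerplanar graph. A MOP graph of order $n\ge 3$ is the same as a triangulation of a convex $n$-gon. The strong product $P_n\boxtimes P_n$ has vertex set $[0,n-1]\times[0,n-1]$ (integer pairs), and two different vertices $(i,j)$, $(i',j')$ are adjacent if and only if $|i'-i|\le 1$ and $|j'-j|\le 1$. For $d\ge1$, $A_d=\{(i,j)\in[0,n-1]\times[0,n-1] : i+j\ge d,\ |j-i|\le d\}$. For an integer $k\ge 1$, $V_k=\{(i,j): i+j=k\}$. A vertical MOP zigzag with base line a vertical edge $(i,j)(i,j+1)$ is a subgraph of the strong product induced by a vertex set $\{(i+k,j+k):0\le k\le r\}\cup\{(i+k,j+1+k):0\le k\le s\}$ for some $r\ge1$ and $s\in\{r-1,r\}$. A horizontal MOP zigzag with base line a horizontal edge $(i,j)(i+1,j)$ is a subgraph of the strong product induced by a vertex set $\{(i+k,j+k):0\le k\le r\}\cup\{(i+1+k,j+k):0\le k\le s\}$ for some $r\ge 1$ and $s\in\{r-1,r\}$. In condition (4), "maximal" is with respect to inclusion among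 the vertical or horizontal MOP zigzags of $G^*$ with the listed base lines. *)

theory Defs
  imports "HOL-Analysis.Analysis"
begin

section \<open>Finite simple connected graphs\<close>

text \<open>A graph is a pair of a vertex set and a set of edges, an edge being a two-element set of
  vertices.\<close>

type_synonym 'a ugraph = "'a set \<times> 'a set set"

abbreviation vertices :: "'a ugraph \<Rightarrow> 'a set" where
  "vertices G \<equiv> fst G"

abbreviation edges :: "'a ugraph \<Rightarrow> 'a set set" where
  "edges G \<equiv> snd G"

definition simple_graph :: "'a ugraph \<Rightarrow> bool" where
  "simple_graph G \<longleftrightarrow> finite (vertices G) \<and>
     edges G \<subseteq> {{u, v} | u v. u \<in> vertices G \<and> v \<in> vertices G \<and> u \<noteq> v}"

definition path_between :: "'a ugraph \<Rightarrow> 'a \<Rightarrow> 'a \<Rightarrow> 'a list \<Rightarrow> bool" where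
  "path_between G u v xs \<longleftrightarrow> xs \<noteq> [] \<and> hd xs = u \<and> last xs = v \<and> distinct xs \<and>
     set xs \<subseteq> vertices G \<and> successively (\<lambda>x y. {x, y} \<in> edges G) xs"

definition connected_graph :: "'a ugraph \<Rightarrow> bool" where
  "connected_graph G \<longleftrightarrow> (\<forall>u\<in>vertices G. \<forall>v\<in>vertices G. \<exists>xs. path_between G u v xs)"

definition subgraph :: "'a ugraph \<Rightarrow> 'a ugraph \<Rightarrow> bool" where
  "subgraph H G \<longleftrightarrow> vertices H \<subseteq> vertices G \<and> edges H \<subseteq> edges G \<and> (\<forall>e\<in>edges H. e \<subseteq> vertices H)"

definition induced_subgraph :: "'a ugraph \<Rightarrow> 'a set \<Rightarrow> 'a ugraph" where
  "induced_subgraph G W = (W, {e \<in> edges G. e \<subseteq> W})"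

definition isomorphic :: "'a ugraph \<Rightarrow> 'b ugraph \<Rightarrow> bool" where
  "isomorphic G H \<longleftrightarrow> (\<exists>f. bij_betw f (vertices G) (vertices H) \<and>
     (\<forall>u\<in>vertices G. \<forall>v\<in>vertices G. {u, v} \<in> edges G \<longleftrightarrow> {f u, f v} \<in> edges H))"


section \<open>Metric dimension\<close>

definition gdist :: "'a ugraph \<Rightarrow> 'a \<Rightarrow> 'a \<Rightarrow> nat" where
  "gdist G u v = (LEAST k. \<exists>xs. path_between G u v xs \<and> length xs = Suc k)"

definition resolves :: "'a ugraph \<Rightarrow> 'a \<Rightarrow> 'a \<Rightarrow> 'a \<Rightarrow> bool" where
  "resolves G x u v \<longleftrightarrow> gdist G u x \<noteq> gdist G v x"

definition resolving_set :: "'a ugraph \<Rightarrow> 'a set \<Rightarrow> bool" where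
  "resolving_set G S \<longleftrightarrow> S \<subseteq> vertices G \<and>
     (\<forall>u\<in>vertices G. \<forall>v\<in>vertices G. u \<noteq> v \<longrightarrow> (\<exists>x\<in>S. resolves G x u v))"

definition metric_dimension :: "'a ugraph \<Rightarrow> nat" where
  "metric_dimension G = (LEAST k. \<exists>S. resolving_set G S \<and> card S = k)"


section \<open>Maximal outerplanar graphs\<close>

text \<open>Drawings are topological: an edge is an arbitrary simple arc (\<^const>\<open>arc\<close>) joining the
  images of its ends.\<close>

definition drawing_in_plane ::
    "'a ugraph \<Rightarrow> ('a \<Rightarrow> complex) \<Rightarrow> ('a set \<Rightarrow> real \<Rightarrow> complex) \<Rightarrow> bool" where
  "drawing_in_plane G p \<gamma> \<longleftrightarrow> inj_on p (vertices G) \<and>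
     (\<forall>e\<in>edges G. arc (\<gamma> e) \<and> {pathstart (\<gamma> e), pathfinish (\<gamma> e)} = p ` e \<and>
        path_image (\<gamma> e) \<inter> p ` vertices G = p ` e) \<and>
     (\<forall>e\<in>edges G. \<forall>f\<in>edges G. e \<noteq> f \<longrightarrow>
        path_image (\<gamma> e) \<inter> path_image (\<gamma> f) \<subseteq> p ` (e \<inter> f))"

definition drawn_points ::
    "'a ugraph \<Rightarrow> ('a \<Rightarrow> complex) \<Rightarrow> ('a set \<Rightarrow> real \<Rightarrow> complex) \<Rightarrow> complex set" where
  "drawn_points G p \<gamma> = p ` vertices G \<union> (\<Union>e\<in>edges G. path_image (\<gamma> e))"

text \<open>The set of drawn points is compact, so its \<^const>\<open>outside\<close> is the unbounded face;
  a vertex is on that face if it lies on its boundary.\<close>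

definition outerplanar :: "'a ugraph \<Rightarrow> bool" where
  "outerplanar G \<longleftrightarrow> (\<exists>p \<gamma>. drawing_in_plane G p \<gamma> \<and>
     p ` vertices G \<subseteq> frontier (outside (drawn_points G p \<gamma>)))"

definition maximal_outerplanar :: "'a ugraph \<Rightarrow> bool" where
  "maximal_outerplanar G \<longleftrightarrow> simple_graph G \<and> connected_graph G \<and> outerplanar G \<and>
     (\<forall>u\<in>vertices G. \<forall>v\<in>vertices G. u \<noteq> v \<longrightarrow> {u, v} \<notin> edges G \<longrightarrow>
        \<not> outerplanar (vertices G, insert {u, v} (edges G)))"


section \<open>The strong product of two paths\<close>

text \<open>Points are pairs of integers, so that no coordinate difference is truncated.\<close>

type_synonym point = "int \<times> int"

definition strong_grid :: "nat \<Rightarrow> point ugraph" where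
  "strong_grid n = ({0..int n - 1} \<times> {0..int n - 1},
     {{(i, j), (i', j')} | i j i' j'.
        {i, j, i', j'} \<subseteq> {0..int n - 1} \<and> (i, j) \<noteq> (i', j') \<and>
        \<bar>i' - i\<bar> \<le> 1 \<and> \<bar>j' - j\<bar> \<le> 1})"

definition grid_region :: "nat \<Rightarrow> int \<Rightarrow> point set" where
  "grid_region n d = {(i, j). (i, j) \<in> vertices (strong_grid n) \<and> i + j \<ge> d \<and> \<bar>j - i\<bar> \<le> d}"

definition layer :: "int \<Rightarrow> point set" where
  "layer k = {(i, j). i + j = k}"


section \<open>MOP zigzags\<close>

definition vertical_zigzag :: "nat \<Rightarrow> point set \<Rightarrow> point ugraph \<Rightarrow> bool" where
  "vertical_zigzag n b Z \<longleftrightarrow> (\<exists>i j r s W. b = {(i, j), (i, j + 1)} \<and> r \<ge> 1 \<and> s \<in> {r - 1, r} \<and>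
     W = {(i + k, j + k) | k. 0 \<le> k \<and> k \<le> r} \<union> {(i + k, j + 1 + k) | k. 0 \<le> k \<and> k \<le> s} \<and>
     W \<subseteq> vertices (strong_grid n) \<and> Z = induced_subgraph (strong_grid n) W)"

definition horizontal_zigzag :: "nat \<Rightarrow> point set \<Rightarrow> point ugraph \<Rightarrow> bool" where
  "horizontal_zigzag n b Z \<longleftrightarrow> (\<exists>i j r s W. b = {(i, j), (i + 1, j)} \<and> r \<ge> 1 \<and> s \<in> {r - 1, r} \<and>
     W = {(i + k, j + k) | k. 0 \<le> k \<and> k \<le> r} \<union> {(i + 1 + k, j + k) | k. 0 \<le> k \<and> k \<le> s} \<and>
     W \<subseteq> vertices (strong_grid n) \<and> Z = induced_subgraph (strong_grid n) W)"


section \<open>The four conditions\<close>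

text \<open>The sets \<open>vertices1\<close>, \<open>edges1\<close> to \<open>vertices3\<close>, \<open>edges3\<close> collect the vertices and edges
  described by the respective conditions; the fourth condition concerns the remaining ones.\<close>

definition vertices1 :: "nat \<Rightarrow> int \<Rightarrow> point set" where
  "vertices1 n d = layer d \<inter> grid_region n d"

definition edges1 :: "int \<Rightarrow> point set set" where
  "edges1 d = {{(i, j), (i + 1, j - 1)} | i j. i + j = d \<and> 0 \<le> i \<and> i < d}"

definition condition1 :: "nat \<Rightarrow> point ugraph \<Rightarrow> int \<Rightarrow> bool" where
  "condition1 n H d \<longleftrightarrow> vertices H \<subseteq> grid_region n d \<and> vertices1 n d \<subseteq> vertices H \<and> edges1 d \<subseteq> edges H"

definition vertices2 :: "nat \<Rightarrow> int \<Rightarrow> point set" where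
  "vertices2 n d = layer (d + 1) \<inter> grid_region n d"

definition edges2 :: "nat \<Rightarrow> int \<Rightarrow> point set set" where
  "edges2 n d = (\<Union>(i, j) \<in> layer (d + 1) \<inter> grid_region n d. {{(i, j), (i - 1, j)}, {(i, j), (i, j - 1)}})"

definition condition2 :: "nat \<Rightarrow> point ugraph \<Rightarrow> int \<Rightarrow> bool" where
  "condition2 n H d \<longleftrightarrow> vertices2 n d \<subseteq> vertices H \<and> edges2 n d \<subseteq> edges H"

text \<open>The relevant edges of the unit square with lower left corner \<open>(i, j)\<close>.\<close>

definition antidiagonal :: "int \<Rightarrow> int \<Rightarrow> point set" where
  "antidiagonal i j = {(i, j + 1), (i + 1, j)}"

definition corner_edges :: "int \<Rightarrow> int \<Rightarrow> point set set" where
  "corner_edges i j = {{(i, j + 1), (i + 1, j + 1)}, {(i + 1, j), (i + 1, j + 1)}}"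

definition diagonal :: "int \<Rightarrow> int \<Rightarrow> point set" where
  "diagonal i j = {(i, j), (i + 1, j + 1)}"

definition triangles_at :: "'a ugraph \<Rightarrow> 'a set \<Rightarrow> 'a set set" where
  "triangles_at G e = {T. card T = 3 \<and> e \<subseteq> T \<and> T \<subseteq> vertices G \<and>
     (\<forall>u\<in>T. \<forall>v\<in>T. u \<noteq> v \<longrightarrow> {u, v} \<in> edges G)}"

definition in_two_triangles :: "'a ugraph \<Rightarrow> 'a set \<Rightarrow> bool" where
  "in_two_triangles G e \<longleftrightarrow> (\<exists>T\<in>triangles_at G e. \<exists>T'\<in>triangles_at G e. T \<noteq> T')"

definition condition3 :: "point ugraph \<Rightarrow> int \<Rightarrow> bool" where
  "condition3 H d \<longleftrightarrow> (\<forall>i j. i \<ge> 1 \<and> j \<ge> 1 \<and> {(i, j + 1), (i + 1, j)} \<subseteq> layer (d + 1) \<longrightarrow>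
     (antidiagonal i j \<in> edges H \<or> insert (diagonal i j) (corner_edges i j) \<subseteq> edges H) \<and>
     (antidiagonal i j \<in> edges H \<and> in_two_triangles H (antidiagonal i j) \<longrightarrow>
        (i + 1, j + 1) \<in> vertices H \<and> corner_edges i j \<subseteq> edges H))"

definition square_edges :: "point ugraph \<Rightarrow> int \<Rightarrow> int \<Rightarrow> point set set" where
  "square_edges H i j =
     (if antidiagonal i j \<in> edges H
      then insert (antidiagonal i j)
             (if in_two_triangles H (antidiagonal i j) then corner_edges i j else {})
      else insert (diagonal i j) (corner_edges i j))"

definition edges3 :: "point ugraph \<Rightarrow> int \<Rightarrow> point set set" where
  "edges3 H d =
     \<Union> {square_edges H i j | i j. i \<ge> 1 \<and> j \<ge> 1 \<and> {(i, j + 1), (i + 1, j)} \<subseteq> layer (d + 1)}"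

definition vertices3 :: "point ugraph \<Rightarrow> int \<Rightarrow> point set" where
  "vertices3 H d = \<Union> (edges3 H d)"

definition described_vertices :: "nat \<Rightarrow> point ugraph \<Rightarrow> int \<Rightarrow> point set" where
  "described_vertices n H d = vertices1 n d \<union> vertices2 n d \<union> vertices3 H d"

definition described_edges :: "nat \<Rightarrow> point ugraph \<Rightarrow> int \<Rightarrow> point set set" where
  "described_edges n H d = edges1 d \<union> edges2 n d \<union> edges3 H d"

definition base_lines :: "nat \<Rightarrow> point ugraph \<Rightarrow> int \<Rightarrow> point set set" where
  "base_lines n H d = {{(0, d), (1, d)}, {(d, 0), (d, 1)}} \<union>
     {{p, q} | p q. {p, q} \<in> described_edges n H d \<and> p \<in> layer (d + 1) \<and> q \<in> layer (d + 2)}"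

definition zigzags :: "nat \<Rightarrow> point ugraph \<Rightarrow> int \<Rightarrow> point ugraph set" where
  "zigzags n H d = {Z. subgraph Z H \<and>
     (\<exists>b\<in>base_lines n H d. vertical_zigzag n b Z \<or> horizontal_zigzag n b Z)}"

definition maximal_zigzags :: "nat \<Rightarrow> point ugraph \<Rightarrow> int \<Rightarrow> point ugraph set" where
  "maximal_zigzags n H d =
     {Z \<in> zigzags n H d. \<forall>Z'\<in>zigzags n H d. subgraph Z Z' \<longrightarrow> Z' = Z}"

definition condition4 :: "nat \<Rightarrow> point ugraph \<Rightarrow> int \<Rightarrow> bool" where
  "condition4 n H d \<longleftrightarrow>
     (\<forall>v\<in>vertices H - described_vertices n H d. \<exists>Z\<in>zigzags n H d. v \<in> vertices Z) \<and>
     (\<forall>e\<in>edges H - described_edges n H d. \<exists>Z\<in>zigzags n H d. e \<in> edges Z) \<and>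
     (\<forall>Z\<in>maximal_zigzags n H d. \<forall>Z'\<in>maximal_zigzags n H d. Z \<noteq> Z' \<longrightarrow> edges Z \<inter> edges Z' = {})"

end

(* Soundness of the representation: in G^* every vertex (i, j) with i > 0 has a neighbour with first
   coordinate i - 1, and edges change coordinates by at most 1, so i and j are the distances to
   (0, d) and (d, 0), which therefore resolve G; a triangle forces metric dimension at least 2.

   Conversely, map each vertex to its distances to a resolving pair a, b at distance d.  Combinatorics
   of G: in an outerplanar drawing no vertex lies inside a cycle, and the theta-curve theorem (obtained
   here from winding numbers) then excludes subdivisions of K_{2,3} and K_4, so G has a linear vertex
   order without crossing edges.  Conversely such an order gives a drawing with vertices on a
   parabola and straight edges.  A maximal G is therefore a triangulated polygon: every edge lies in one or
   two triangles, two triangles on an edge xy are separated by {x, y}, and links are connected.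

   Geometry of the image: a triangle xyt on the side of xy that contains neither a nor b has
   t = (min x_1 y_1 + 1, min x_2 y_2 + 1), because shortest paths from t to a and b leave through x or y.
   Since the unique shortest a-b path lies on one side of any edge missing it, growing triangles outwards from
   this path can only continue along the diagonal strips that are the zigzags, and a diagonal edge off the path
   lies in a single triangle, so zigzags in neighbouring strips share no edge. *)

theory Submission
  imports Defs "HOL-Complex_Analysis.Winding_Numbers"
begin

section \<open>Paths and theta curves\<close>

text \<open>Maximality says that every added edge destroys outerplanarity, so it can only be
  exploited by producing drawings: if a pair of vertices crosses no edge in the order, then
  \<open>G\<close> with that pair added can be drawn, and the pair must already be an edge.
  Therefore drawings and orders have to be exchanged in both directions. Afterwards no topology is
  left: planarity becomes a comparison of four values of the order, which may be rotated so that any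
  chosen vertex comes first.

  The induction over triangles, which moves across common edges, thus takes triangles meeting layer
  \<open>d\<close> as settled and shows of every other one that it is the upper half of a square cut
  by its antidiagonal or part of a zigzag. Zigzags are handled as strips: two neighbouring diagonals
  contain exactly one point of each layer \<open>x + y = k\<close>, so a zigzag is a strip with an
  interval of layers, and it grows by passing to the next layer.\<close>

fun path_edges :: "'a list \<Rightarrow> 'a set set" where
  "path_edges (x # y # xs) = insert {x, y} (path_edges (y # xs))"
| "path_edges _ = {}"

lemma path_edges_append: "path_edges (xs @ y # ys) = path_edges (xs @ [y]) \<union> path_edges (y # ys)"
  by (induction xs rule: path_edges.induct) auto

lemma path_edges_snoc2: "path_edges (xs @ [x, y]) = insert {x, y} (path_edges (xs @ [x]))"
  using path_edges_append[of xs x "[y]"] by simp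

lemma path_edges_rev: "path_edges (rev xs) = path_edges xs"
  by (induction xs rule: path_edges.induct) (auto simp: path_edges_snoc2 insert_commute)

lemma path_edges_subset: "e \<in> path_edges xs \<Longrightarrow> e \<subseteq> set xs"
  by (induction xs rule: path_edges.induct) auto

lemma Union_path_edges: "2 \<le> length xs \<Longrightarrow> \<Union> (path_edges xs) = set xs"
proof (induction xs rule: path_edges.induct)
  case (1 x y xs)
  then show ?case by (cases xs) auto
qed auto

text \<open>Each edge of a path with inner vertices meets one of them; hence internally disjoint
  paths with the same ends share no edge.\<close>

lemma path_edges_inner: "e \<in> path_edges (u # xs @ [v]) \<Longrightarrow> e \<inter> set xs \<noteq> {} \<or> xs = [] \<and> e = {u, v}"
proof (induction xs arbitrary: u)
  case (Cons x xs)
  then show ?case by (cases xs) auto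
qed auto

text \<open>The condition for a one-page book embedding: vertices sit on a line at the positions
  \<open>g\<close>, edges are arcs on one side of it.\<close>

definition noncrossing :: "('a \<Rightarrow> real) \<Rightarrow> 'a set set \<Rightarrow> bool" where
  "noncrossing g E \<longleftrightarrow>
    (\<forall>a b c d. g a < g b \<longrightarrow> g b < g c \<longrightarrow> g c < g d \<longrightarrow> {a, c} \<in> E \<longrightarrow> {b, d} \<notin> E)"

text \<open>One of three arcs from \<open>a\<close> to \<open>b\<close> runs between the other two,
  and \<open>p\<close>, \<open>q\<close> rule out \<open>c1\<close> and \<open>c2\<close>. Otherwise
  the region enclosed by \<open>c1\<close> and \<open>c2\<close> lies outside both curves formed
  with \<open>c3\<close>. At a point of it \<open>c1\<close> and \<open>c3\<close> have equal
  winding numbers, and so do \<open>c2\<close> and \<open>c3\<close>; yet those of \<open>c1\<close>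
  and \<open>c2\<close> differ by 1 or -1, as their loop encloses the point.\<close>

lemma theta_curve_meets_inside:
  fixes c1 c2 c3 :: "real \<Rightarrow> complex"
  assumes arcs: "arc c1" "arc c2" "arc c3"
    and ends: "pathstart c1 = a" "pathfinish c1 = b" "pathstart c2 = a" "pathfinish c2 = b"
      "pathstart c3 = a" "pathfinish c3 = b"
    and c12: "path_image c1 \<inter> path_image c2 = {a,b}"
    and c13: "path_image c1 \<inter> path_image c3 = {a,b}"
    and c23: "path_image c2 \<inter> path_image c3 = {a,b}"
    and p: "p \<in> path_image c1 - {a,b}" "p \<notin> inside (path_image c2 \<union> path_image c3)"
    and q: "q \<in> path_image c2 - {a,b}" "q \<notin> inside (path_image c1 \<union> path_image c3)"
  shows "path_image c3 \<inter> inside (path_image c1 \<union> path_image c2) \<noteq> {}"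
proof (rule notI)
  assume c3: "path_image c3 \<inter> inside (path_image c1 \<union> path_image c2) = {}"
  let ?I = "inside (path_image c1 \<union> path_image c2)"
  have loop: "simple_path (f +++ reversepath g)" "path_image (f +++ reversepath g) = path_image f \<union> path_image g"
      "pathfinish (f +++ reversepath g) = pathstart (f +++ reversepath g)"
    if "arc f" "arc g" "pathstart f = a" "pathfinish f = b" "pathstart g = a" "pathfinish g = b"
      "path_image f \<inter> path_image g = {a,b}" for f g :: "real \<Rightarrow> complex"
    using that by (auto intro!: simple_path_join_loop simp: arc_reversepath path_image_join)
  note J12 = loop[OF arcs(1,2) ends(1,2,3,4) c12]
    and J13 = loop[OF arcs(1,3) ends(1,2,5,6) c13]
    and J23 = loop[OF arcs(2,3) ends(3,4,5,6) c23]
  note I = Jordan_inside_outside[OF J12(1,3), unfolded J12(2)]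
  obtain z where z: "z \<in> ?I" using I by blast
  \<comment> \<open>\<open>?I\<close> is connected and avoids the second curve, so it lies on one
    side of it. This is not the inner side: \<open>x\<close> is a limit of \<open>?I\<close> and
    would be inside that curve or on it.\<close>
  have sub: "?I \<subseteq> outside (path_image c \<union> path_image c3)"
    if c: "path_image c \<subseteq> path_image c1 \<union> path_image c2"
      and J: "simple_path (c +++ reversepath c3)" "path_image (c +++ reversepath c3) = path_image c \<union> path_image c3"
        "pathfinish (c +++ reversepath c3) = pathstart (c +++ reversepath c3)"
      and x: "x \<in> path_image c1 \<union> path_image c2" "x \<notin> path_image c \<union> path_image c3"
        "x \<notin> inside (path_image c \<union> path_image c3)" for c x
  proof -
    let ?J = "path_image c \<union> path_image c3"
    note K = Jordan_inside_outside[OF J(1,3), unfolded J(2)]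
    have dis: "?I \<inter> ?J = {}" using c c3 inside_no_overlap[of "path_image c1 \<union> path_image c2"] by blast
    have un: "inside ?J \<union> outside ?J = - ?J" by (rule inside_Un_outside)
    have "\<not> ?I \<subseteq> inside ?J"
    proof
      assume "?I \<subseteq> inside ?J"
      then have "closure ?I \<subseteq> closure (inside ?J)" by (rule closure_mono)
      moreover have "x \<in> closure ?I" using x(1) I by (metis UnCI closure_Un_frontier)
      ultimately have "x \<in> inside ?J \<union> ?J" using K closure_Un_frontier[of "inside ?J"] by auto
      then show False using x by blast
    qed
    moreover have "?I \<inter> inside ?J = {} \<or> ?I \<inter> outside ?J = {}"
    proof -
      have "connected ?I" "open (inside ?J)" "open (outside ?J)" using I K by simp_all
      moreover have "?I \<subseteq> inside ?J \<union> outside ?J" using dis un by blast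
      ultimately show ?thesis using inside_Int_outside[of ?J] connectedD[of ?I "inside ?J" "outside ?J"]
        by (metis inf_commute inf_bot_right)
    qed
    ultimately show ?thesis using dis un by blast
  qed
  have q13: "q \<notin> path_image c1 \<union> path_image c3" and p23: "p \<notin> path_image c2 \<union> path_image c3"
    using p q c12 c13 c23 by blast+
  have o13: "z \<in> outside (path_image c1 \<union> path_image c3)"
    using sub[OF _ J13 _ q13 q(2)] q z by auto
  have o23: "z \<in> outside (path_image c2 \<union> path_image c3)"
    using sub[OF _ J23 _ p23 p(2)] p z by auto
  have notin: "z \<notin> path_image c1" "z \<notin> path_image c2" "z \<notin> path_image c3"
    using z c3 inside_no_overlap[of "path_image c1 \<union> path_image c2"] by blast+
  \<comment> \<open>Single arcs need not have integral winding numbers; only differences, which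
    belong to closed curves, are evaluated.\<close>
  have w: "winding_number (f +++ reversepath g) z = winding_number f z - winding_number g z"
    if "arc f" "arc g" "z \<notin> path_image f" "z \<notin> path_image g" "pathfinish f = b" "pathfinish g = b"
    for f g using that
    by (simp add: winding_number_join winding_number_reversepath arc_imp_path)
  have "winding_number c1 z - winding_number c3 z = 0"
    using winding_number_zero_in_outside[of "c1 +++ reversepath c3" z] w[of c1 c3] J13 o13 arcs notin ends
    by (simp add: simple_path_imp_path)
  moreover have "winding_number c2 z - winding_number c3 z = 0"
    using winding_number_zero_in_outside[of "c2 +++ reversepath c3" z] w[of c2 c3] J23 o23 arcs notin ends
    by (simp add: simple_path_imp_path)
  moreover have "winding_number c1 z - winding_number c2 z \<in> {-1, 1}"
    using simple_closed_path_winding_number_inside[OF J12(1)] w[of c1 c2] J12 z arcs notin ends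
    by (metis insertCI)
  ultimately show False by auto
qed

text \<open>Without its ends the arc is connected and avoids \<open>J\<close>, so a single point
  inside \<open>J\<close> forces the rest inside.\<close>

lemma arc_within_inside:
  fixes c :: "real \<Rightarrow> complex"
  assumes "arc c" "closed J" "path_image c \<inter> J = {pathstart c, pathfinish c}"
    and "path_image c \<inter> inside J \<noteq> {}"
  shows "path_image c - {pathstart c, pathfinish c} \<subseteq> inside J"
proof -
  let ?c = "path_image c - {pathstart c, pathfinish c}"
  have con: "connected ?c" by (rule connected_simple_path_endless[OF arc_imp_simple_path[OF assms(1)]])
  have op: "open (inside J)" "open (outside J)"
    using assms(2) by (auto intro: open_inside open_outside)
  have sub: "?c \<subseteq> inside J \<union> outside J" using assms(3) inside_Un_outside[of J] by blast
  have "inside J \<inter> ?c \<noteq> {}" using assms(3,4) inside_no_overlap[of J] by blast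
  then have "outside J \<inter> ?c = {}"
    using connectedD[OF con op _ sub] inside_Int_outside[of J] by blast
  then show ?thesis using sub by blast
qed

text \<open>The chord \<open>e\<close> cuts the inside of the closed curve into two regions, one
  along \<open>c1\<close> and one along \<open>c2\<close>. The open arc \<open>f\<close> is
  connected and avoids \<open>e\<close>, so it stays in one of them. Its end on the other arc is a
  limit of this region but not on its boundary, hence inside the whole curve, although it lies on
  the curve.\<close>

lemma not_both_chords_inside:
  fixes c1 c2 e f :: "real \<Rightarrow> complex"
  assumes arcs: "arc c1" "arc c2" "arc e" "arc f"
    and ends: "pathstart c1 = a" "pathfinish c1 = b" "pathstart c2 = a" "pathfinish c2 = b"
      "pathstart e = a" "pathfinish e = b" "pathstart f = p" "pathfinish f = q"
    and c12: "path_image c1 \<inter> path_image c2 = {a,b}"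
    and c1e: "path_image c1 \<inter> path_image e = {a,b}"
    and c2e: "path_image c2 \<inter> path_image e = {a,b}"
    and fc: "path_image f \<inter> (path_image c1 \<union> path_image c2) = {p, q}"
    and fe: "path_image f \<inter> path_image e = {}"
    and p: "p \<in> path_image c1 - {a,b}" and q: "q \<in> path_image c2 - {a,b}"
    and e: "path_image e \<inter> inside (path_image c1 \<union> path_image c2) \<noteq> {}"
    and f: "path_image f \<inter> inside (path_image c1 \<union> path_image c2) \<noteq> {}"
  shows False
proof -
  let ?J = "path_image c1 \<union> path_image c2"
  let ?I1 = "inside (path_image c1 \<union> path_image e)" and ?I2 = "inside (path_image c2 \<union> path_image e)"
  let ?f = "path_image f - {p, q}"
  have ab: "a \<noteq> b" using arcs ends arc_distinct_ends by blast
  have disj: "?I1 \<inter> ?I2 = {}" and un: "?I1 \<union> ?I2 \<union> (path_image e - {a,b}) = inside ?J"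
    using split_inside_simple_closed_curve[of c1 a b c2 e] arcs ends ab c12 c1e c2e e
    by (metis arc_imp_simple_path)+
  have closed: "closed (path_image c1)" "closed (path_image c2)" "closed (path_image e)"
    using arcs by (auto simp: closed_arc_image)
  have con: "connected ?f" using connected_simple_path_endless[OF arc_imp_simple_path[OF arcs(4)]] ends by simp
  have op: "open ?I1" "open ?I2"
    using closed by (auto intro: open_inside)
  have "?f \<subseteq> inside ?J"
    using arc_within_inside[of f ?J] arcs closed ends fc f by (simp add: closed_Un)
  then have "?f \<subseteq> ?I1 \<union> ?I2" using un fe by blast
  then have or: "?f \<subseteq> ?I1 \<or> ?f \<subseteq> ?I2"
    using connectedD[OF con op] disj by blast
  have cl: "p \<in> closure ?f \<and> q \<in> closure ?f"
  proof -
    have "f ` closure {0<..<1} \<subseteq> closure (f ` {0<..<1})"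
      using arcs by (intro image_closure_subset) (auto simp: arc_def path_def closure_subset)
    moreover have "?f = f ` {0<..<1}"
      using simple_path_endless[OF arc_imp_simple_path[OF arcs(4)]] ends by simp
    ultimately show ?thesis using ends by (auto simp: pathstart_def pathfinish_def)
  qed
  have key: "x \<in> inside (path_image c \<union> path_image e)"
    if "?f \<subseteq> inside (path_image c \<union> path_image e)" "x \<in> closure ?f" "x \<notin> path_image c" "x \<notin> path_image e"
      "closed (path_image c)" for c x
  proof -
    have "x \<in> closure (inside (path_image c \<union> path_image e))" using that closure_mono by blast
    moreover have "frontier (inside (path_image c \<union> path_image e)) \<subseteq> path_image c \<union> path_image e"
      using that closed by (intro frontier_inside_subset) auto
    ultimately show ?thesis using that by (auto simp: closure_Un_frontier)
  qed
  from or show False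
  proof
    assume "?f \<subseteq> ?I1"
    then have "q \<in> ?I1" using key[of c1 q] cl closed q c12 c2e by blast
    then show False using un q inside_no_overlap[of ?J] by blast
  next
    assume "?f \<subseteq> ?I2"
    then have "p \<in> ?I2" using key[of c2 p] cl closed p c12 c1e by blast
    then show False using un p inside_no_overlap[of ?J] by blast
  qed
qed

text \<open>\<open>outside T\<close> is contained in \<open>outside S\<close>, and the open set
  \<open>inside S\<close> misses the closure of the latter. With \<open>T\<close> the whole drawing
  this says that no vertex is enclosed by drawn edges.\<close>

lemma frontier_outside_not_inside:
  fixes S T :: "complex set"
  assumes "p \<in> frontier (outside T)" "S \<subseteq> T" "closed S"
  shows "p \<notin> inside S"
proof
  assume "p \<in> inside S"
  moreover have "p \<in> closure (outside S)"
    using assms closure_mono[OF outside_mono[OF assms(2)]] by (auto simp: frontier_def)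
  ultimately show False
    using open_Int_closure_eq_empty[OF open_inside[OF assms(3)], of "outside S"] by auto
qed

section \<open>Drawings with every vertex on the unbounded face\<close>

locale frontier_drawing =
  fixes G :: "'a ugraph" and p :: "'a \<Rightarrow> complex" and \<gamma> :: "'a set \<Rightarrow> real \<Rightarrow> complex"
  assumes drawing: "drawing_in_plane G p \<gamma>"
    and frontier: "p ` vertices G \<subseteq> frontier (outside (drawn_points G p \<gamma>))"
begin

definition drawn_edges :: "'a set set \<Rightarrow> complex set" where
  "drawn_edges F = (\<Union>e\<in>F. path_image (\<gamma> e))"

lemma edge_arc: "e \<in> edges G \<Longrightarrow> arc (\<gamma> e)"
  and edge_ends: "e \<in> edges G \<Longrightarrow> {pathstart (\<gamma> e), pathfinish (\<gamma> e)} = p ` e"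
  and edge_vertices: "e \<in> edges G \<Longrightarrow> path_image (\<gamma> e) \<inter> p ` vertices G = p ` e"
  and edge_disjoint: "e \<in> edges G \<Longrightarrow> f \<in> edges G \<Longrightarrow> e \<noteq> f \<Longrightarrow>
    path_image (\<gamma> e) \<inter> path_image (\<gamma> f) \<subseteq> p ` (e \<inter> f)"
  and inj_p: "inj_on p (vertices G)"
  using drawing unfolding drawing_in_plane_def by blast+

lemma drawn_edges_Int:
  assumes "F \<subseteq> edges G" "F' \<subseteq> edges G" "F \<inter> F' = {}"
  shows "drawn_edges F \<inter> drawn_edges F' \<subseteq> p ` (\<Union>F \<inter> \<Union>F')"
proof
  fix z assume "z \<in> drawn_edges F \<inter> drawn_edges F'"
  then obtain e f where "e \<in> F" "f \<in> F'" "z \<in> path_image (\<gamma> e) \<inter> path_image (\<gamma> f)"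
    unfolding drawn_edges_def by blast
  with assms edge_disjoint[of e f] show "z \<in> p ` (\<Union>F \<inter> \<Union>F')" by blast
qed

lemma vertex_in_drawn_edges:
  assumes "F \<subseteq> edges G" "v \<in> vertices G" "\<Union>F \<subseteq> vertices G"
  shows "p v \<in> drawn_edges F \<longleftrightarrow> v \<in> \<Union>F"
proof
  assume "p v \<in> drawn_edges F"
  then obtain e where e: "e \<in> F" "p v \<in> path_image (\<gamma> e)" unfolding drawn_edges_def by blast
  then have "p v \<in> p ` e" using edge_vertices[of e] assms by blast
  moreover have "e \<subseteq> vertices G" using assms(3) e(1) by blast
  ultimately have "v \<in> e" using inj_p assms(2) by (metis inj_on_image_mem_iff)
  then show "v \<in> \<Union>F" using e(1) by blast
next
  assume "v \<in> \<Union>F"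
  then obtain e where e: "e \<in> F" "v \<in> e" by blast
  then have "p v \<in> path_image (\<gamma> e)" using edge_vertices[of e] assms(1) by blast
  then show "p v \<in> drawn_edges F" using e unfolding drawn_edges_def by blast
qed

definition drawn_along :: "(real \<Rightarrow> complex) \<Rightarrow> 'a list \<Rightarrow> bool" where
  "drawn_along c xs \<longleftrightarrow> arc c \<and> pathstart c = p (hd xs) \<and> pathfinish c = p (last xs) \<and>
    path_image c = drawn_edges (path_edges xs)"

lemma arc_along_path:
  assumes "2 \<le> length xs" "distinct xs" "set xs \<subseteq> vertices G" "path_edges xs \<subseteq> edges G"
  obtains c where "drawn_along c xs"
proof -
  have "\<exists>c. arc c \<and> pathstart c = p (hd xs) \<and> pathfinish c = p (last xs) \<and>
    path_image c = drawn_edges (path_edges xs)"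
  using assms
proof (induction xs rule: path_edges.induct)
  case (1 x y xs)
  have e: "{x, y} \<in> edges G" using 1 by simp
  have xy: "p x \<noteq> p y" using 1 inj_p by (auto simp: inj_on_def)
  \<comment> \<open>A drawing leaves the direction of an edge open, so its arc may have to be
    reversed.\<close>
  obtain c0 where c0: "arc c0" "pathstart c0 = p x" "pathfinish c0 = p y" "path_image c0 = path_image (\<gamma> {x,y})"
  proof (cases "pathstart (\<gamma> {x,y}) = p x")
    case True
    then have "pathfinish (\<gamma> {x,y}) = p y" using edge_ends[OF e] xy by (auto simp: doubleton_eq_iff)
    then show ?thesis using that[of "\<gamma> {x,y}"] edge_arc[OF e] True by auto
  next
    case False
    then have "pathfinish (\<gamma> {x,y}) = p x" "pathstart (\<gamma> {x,y}) = p y"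
      using edge_ends[OF e] xy by (auto simp: doubleton_eq_iff)
    then show ?thesis using that[of "reversepath (\<gamma> {x,y})"] edge_arc[OF e] by (auto simp: arc_reversepath)
  qed
  show ?case
  proof (cases "xs = []")
    case True
    then show ?thesis using c0 by (auto simp: drawn_edges_def)
  next
    case False
    then obtain c where c: "arc c" "pathstart c = p y" "pathfinish c = p (last (y # xs))"
      "path_image c = drawn_edges (path_edges (y # xs))" using 1 by (cases xs) auto
    have "path_image c0 = drawn_edges {{x,y}}" using c0 by (simp add: drawn_edges_def)
    moreover have "{{x,y}} \<inter> path_edges (y # xs) = {}"
      using path_edges_subset[of "{x,y}" "y # xs"] 1 by auto
    ultimately have "path_image c0 \<inter> path_image c \<subseteq> p ` (\<Union>{{x,y}} \<inter> \<Union>(path_edges (y # xs)))"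
      using drawn_edges_Int[of "{{x,y}}" "path_edges (y # xs)"] 1 c by simp
    also have "\<dots> \<subseteq> {p y}" using path_edges_subset[of _ "y # xs"] 1 by auto
    finally have "arc (c0 +++ c)" using arc_join c c0 by metis
    moreover have "path_image (c0 +++ c) = drawn_edges (path_edges (x # y # xs))"
      using c c0 by (auto simp: path_image_join drawn_edges_def)
    ultimately show ?thesis using c c0 False by (intro exI[of _ "c0 +++ c"]) auto
  qed
qed auto
  then show thesis using that unfolding drawn_along_def by blast
qed

lemma not_inside_drawn:
  assumes "F \<subseteq> edges G" "v \<in> vertices G" "closed (drawn_edges F)"
  shows "p v \<notin> inside (drawn_edges F)"
  using assms frontier
  by (intro frontier_outside_not_inside[where T="drawn_points G p \<gamma>"]) (auto simp: drawn_edges_def drawn_points_def)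

text \<open>\<open>theta_curve_meets_inside\<close> applies with the points of \<open>hd xs\<close>
  and \<open>hd ys\<close>, since vertices are never enclosed. \<open>zs\<close> may be empty, so
  that the third path is a single chord.\<close>

lemma third_path_inside:
  assumes "xs \<noteq> []" "ys \<noteq> []" and dist: "distinct (u # v # xs @ ys @ zs)"
    and V: "set (u # v # xs @ ys @ zs) \<subseteq> vertices G"
    and E: "path_edges (u # xs @ [v]) \<subseteq> edges G" "path_edges (u # ys @ [v]) \<subseteq> edges G"
      "path_edges (u # zs @ [v]) \<subseteq> edges G"
  obtains c1 c2 c3 where "drawn_along c1 (u # xs @ [v])" "drawn_along c2 (u # ys @ [v])" "drawn_along c3 (u # zs @ [v])"
    "path_image c1 \<inter> path_image c2 = {p u, p v}" "path_image c1 \<inter> path_image c3 = {p u, p v}"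
    "path_image c2 \<inter> path_image c3 = {p u, p v}"
    "path_image c3 - {p u, p v} \<subseteq> inside (path_image c1 \<union> path_image c2)"
proof -
  let ?F = "\<lambda>ws. path_edges (u # ws @ [v])"
  obtain c1 where dc1: "drawn_along c1 (u # xs @ [v])" using arc_along_path[of "u # xs @ [v]"] assms by auto
  obtain c2 where dc2: "drawn_along c2 (u # ys @ [v])" using arc_along_path[of "u # ys @ [v]"] assms by auto
  obtain c3 where dc3: "drawn_along c3 (u # zs @ [v])" using arc_along_path[of "u # zs @ [v]"] assms by auto
  have ends: "arc c \<and> pathstart c = p u \<and> pathfinish c = p v \<and> path_image c = drawn_edges (?F ws)"
    if "drawn_along c (u # ws @ [v])" for c ws using that unfolding drawn_along_def by simp
  have c1: "arc c1" "pathstart c1 = p u" "pathfinish c1 = p v" "path_image c1 = drawn_edges (?F xs)"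
    and c2: "arc c2" "pathstart c2 = p u" "pathfinish c2 = p v" "path_image c2 = drawn_edges (?F ys)"
    and c3: "arc c3" "pathstart c3 = p u" "pathfinish c3 = p v" "path_image c3 = drawn_edges (?F zs)"
    using ends[OF dc1] ends[OF dc2] ends[OF dc3] by auto
  have un: "\<Union>(?F ws) = insert u (insert v (set ws))" for ws
    using Union_path_edges[of "u # ws @ [v]"] by auto
  have mem: "p x \<in> drawn_edges (?F ws) \<longleftrightarrow> x \<in> {u, v} \<union> set ws"
    if "?F ws \<subseteq> edges G" "set ws \<subseteq> vertices G" "x \<in> vertices G" for x ws
    using vertex_in_drawn_edges[of "?F ws" x, unfolded un] that V by simp
  have Int: "drawn_edges (?F ws) \<inter> drawn_edges (?F ws') = {p u, p v}"
    if "?F ws \<subseteq> edges G" "?F ws' \<subseteq> edges G" "set ws \<inter> set ws' = {}" "ws \<noteq> []"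
      "{u,v} \<inter> (set ws \<union> set ws') = {}" "set ws \<union> set ws' \<subseteq> vertices G" for ws ws'
  proof
    have "?F ws \<inter> ?F ws' = {}"
    proof -
      have "e \<noteq> e'" if "e \<in> ?F ws" "e' \<in> ?F ws'" for e e'
        using path_edges_inner[OF that(1)] path_edges_subset[OF that(2)] \<open>ws \<noteq> []\<close>
          \<open>set ws \<inter> set ws' = {}\<close> \<open>{u,v} \<inter> (set ws \<union> set ws') = {}\<close> by auto
      then show ?thesis by blast
    qed
    then have "drawn_edges (?F ws) \<inter> drawn_edges (?F ws') \<subseteq> p ` (\<Union>(?F ws) \<inter> \<Union>(?F ws'))"
      by (rule drawn_edges_Int[OF that(1,2)])
    also have "\<dots> \<subseteq> {p u, p v}" unfolding un using that by auto
    finally show "drawn_edges (?F ws) \<inter> drawn_edges (?F ws') \<subseteq> {p u, p v}" .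
    show "{p u, p v} \<subseteq> drawn_edges (?F ws) \<inter> drawn_edges (?F ws')"
      using mem[of ws] mem[of ws'] that V by simp
  qed
  have i12: "path_image c1 \<inter> path_image c2 = {p u, p v}" unfolding c1 c2 using assms by (intro Int) auto
  have i13: "path_image c1 \<inter> path_image c3 = {p u, p v}" unfolding c1 c3 using assms by (intro Int) auto
  have i23: "path_image c2 \<inter> path_image c3 = {p u, p v}" unfolding c2 c3 using assms by (intro Int) auto
  have closed: "closed (path_image c1)" "closed (path_image c2)" "closed (path_image c3)"
    by (rule closed_arc_image[OF c1(1)] closed_arc_image[OF c2(1)] closed_arc_image[OF c3(1)])+
  have dun: "drawn_edges F \<union> drawn_edges F' = drawn_edges (F \<union> F')" for F F'
    unfolding drawn_edges_def by auto
  have inner: "p x \<in> drawn_edges (?F ws) - {p u, p v}"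
    if "x \<in> set ws" "?F ws \<subseteq> edges G" "set ws \<subseteq> vertices G" "{u,v} \<inter> set ws = {}" for x ws
  proof -
    have "p x \<noteq> p u" "p x \<noteq> p v" using that V inj_p unfolding inj_on_def by auto
    moreover have "p x \<in> drawn_edges (?F ws)" using mem[of ws x] that by auto
    ultimately show ?thesis by simp
  qed
  have ni: "p x \<notin> inside (path_image c \<union> path_image c')"
    if "x \<in> vertices G" "path_image c = drawn_edges F" "path_image c' = drawn_edges F'" "F \<subseteq> edges G"
      "F' \<subseteq> edges G" "closed (path_image c)" "closed (path_image c')" for x c c' F F'
    using not_inside_drawn[of "F \<union> F'" x] that by (metis Un_least closed_Un dun)
  have "hd xs \<in> set xs" "hd ys \<in> set ys" using assms by auto
  have "path_image c3 \<inter> inside (path_image c1 \<union> path_image c2) \<noteq> {}"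
  proof (rule theta_curve_meets_inside[OF c1(1) c2(1) c3(1) c1(2,3) c2(2,3) c3(2,3) i12 i13 i23])
    show "p (hd xs) \<in> path_image c1 - {p u, p v}" unfolding c1(4)
      using inner[of "hd xs" xs] assms by auto
    show "p (hd xs) \<notin> inside (path_image c2 \<union> path_image c3)"
      by (rule ni[OF _ c2(4) c3(4) E(2,3) closed(2,3)]) (use V assms in auto)
    show "p (hd ys) \<in> path_image c2 - {p u, p v}" unfolding c2(4)
      using inner[of "hd ys" ys] assms by auto
    show "p (hd ys) \<notin> inside (path_image c1 \<union> path_image c3)"
      by (rule ni[OF _ c1(4) c3(4) E(1,3) closed(1,3)]) (use V assms in auto)
  qed
  moreover have "path_image c3 \<inter> (path_image c1 \<union> path_image c2) = {pathstart c3, pathfinish c3}"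
    unfolding c3(2,3) using i13 i23 by blast
  ultimately have "path_image c3 - {p u, p v} \<subseteq> inside (path_image c1 \<union> path_image c2)"
    using arc_within_inside[OF c3(1) closed_Un[OF closed(1,2)]] unfolding c3(2,3) by blast
  then show thesis by (rule that[OF dc1 dc2 dc3 i12 i13 i23])
qed

text \<open>If the third path has an inner vertex as well, the other two paths enclose it.\<close>

lemma no_long_theta:
  assumes "xs \<noteq> []" "ys \<noteq> []" "zs \<noteq> []" and dist: "distinct (u # v # xs @ ys @ zs)"
    and V: "set (u # v # xs @ ys @ zs) \<subseteq> vertices G"
    and E: "path_edges (u # xs @ [v]) \<subseteq> edges G" "path_edges (u # ys @ [v]) \<subseteq> edges G"
      "path_edges (u # zs @ [v]) \<subseteq> edges G"
  shows False
proof -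
  obtain c1 c2 c3 where "drawn_along c1 (u # xs @ [v])" "drawn_along c2 (u # ys @ [v])" "drawn_along c3 (u # zs @ [v])"
    and inside: "path_image c3 - {p u, p v} \<subseteq> inside (path_image c1 \<union> path_image c2)"
    by (rule third_path_inside[OF assms(1,2) dist V E]) blast
  then have c: "arc c1" "arc c2"
    "path_image c1 = drawn_edges (path_edges (u # xs @ [v]))"
    "path_image c2 = drawn_edges (path_edges (u # ys @ [v]))"
    "path_image c3 = drawn_edges (path_edges (u # zs @ [v]))"
    unfolding drawn_along_def by simp_all
  have hz: "hd zs \<in> set zs" using assms by simp
  then have "p (hd zs) \<in> path_image c3"
    unfolding c using vertex_in_drawn_edges[of "path_edges (u # zs @ [v])" "hd zs"] V E
      Union_path_edges[of "u # zs @ [v]"] by auto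
  moreover have "p (hd zs) \<notin> {p u, p v}" using hz dist V inj_p by (auto simp: inj_on_def)
  ultimately have "p (hd zs) \<in> inside (path_image c1 \<union> path_image c2)" using inside by blast
  moreover have "path_image c1 \<union> path_image c2 = drawn_edges (path_edges (u # xs @ [v]) \<union> path_edges (u # ys @ [v]))"
    unfolding c drawn_edges_def by auto
  moreover have "closed (path_image c1 \<union> path_image c2)"
    using closed_arc_image[OF c(1)] closed_arc_image[OF c(2)] by (rule closed_Un)
  ultimately show False
    using not_inside_drawn[of "path_edges (u # xs @ [v]) \<union> path_edges (u # ys @ [v])" "hd zs"] V E hz by auto
qed

text \<open>The ends of either chord split the cycle into two paths with inner vertices, so both
  chords run inside the same closed curve, on which their ends alternate.\<close>

lemma no_crossing_chords:
  assumes dist: "distinct (a # xs @ b # ys @ c # zs @ d # ws)"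
    and V: "set (a # xs @ b # ys @ c # zs @ d # ws) \<subseteq> vertices G"
    and E: "path_edges (a # xs @ b # ys @ c # zs @ d # ws @ [a]) \<subseteq> edges G"
    and chords: "{a, c} \<in> edges G" "{b, d} \<in> edges G"
  shows False
proof -
  let ?C = "path_edges (a # xs @ b # ys @ c # zs @ d # ws @ [a])"
  \<comment> \<open>The cycle is split at \<open>a\<close>, \<open>c\<close> and also at
    \<open>b\<close>, \<open>d\<close>. Both splittings have the same edges and so draw the same
    curve.\<close>
  have C1: "?C = path_edges (a # (xs @ b # ys) @ [c]) \<union> path_edges (a # rev (zs @ d # ws) @ [c])"
    using path_edges_append[of "a # xs @ b # ys" c "zs @ d # ws @ [a]"]
      path_edges_rev[of "a # rev (zs @ d # ws) @ [c]"] by simp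
  have C2: "?C = path_edges (b # (ys @ c # zs) @ [d]) \<union> path_edges (b # rev (ws @ a # xs) @ [d])"
    using path_edges_append[of "a # xs" b "ys @ c # zs @ d # ws @ [a]"]
      path_edges_append[of "b # ys @ c # zs" d "ws @ [a]"] path_edges_append[of "d # ws" a "xs @ [b]"]
      path_edges_rev[of "b # rev (ws @ a # xs) @ [d]"] by auto
  have sub: "path_edges (a # (xs @ b # ys) @ [c]) \<subseteq> edges G" "path_edges (a # rev (zs @ d # ws) @ [c]) \<subseteq> edges G"
    "path_edges (b # (ys @ c # zs) @ [d]) \<subseteq> edges G" "path_edges (b # rev (ws @ a # xs) @ [d]) \<subseteq> edges G"
    using E C1 C2 by auto
  obtain c1 c2 e where dr: "drawn_along c1 (a # (xs @ b # ys) @ [c])" "drawn_along c2 (a # rev (zs @ d # ws) @ [c])"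
      "drawn_along e (a # [] @ [c])"
    and e: "path_image c1 \<inter> path_image c2 = {p a, p c}" "path_image c1 \<inter> path_image e = {p a, p c}"
    "path_image c2 \<inter> path_image e = {p a, p c}"
    "path_image e - {p a, p c} \<subseteq> inside (path_image c1 \<union> path_image c2)"
    by (rule third_path_inside[of "xs @ b # ys" "rev (zs @ d # ws)" a c "[]", OF _ _ _ _ sub(1,2)])
      (use dist V chords in auto)
  obtain c3 c4 f where dr': "drawn_along c3 (b # (ys @ c # zs) @ [d])" "drawn_along c4 (b # rev (ws @ a # xs) @ [d])"
      "drawn_along f (b # [] @ [d])"
    and f: "path_image c3 \<inter> path_image c4 = {p b, p d}" "path_image c3 \<inter> path_image f = {p b, p d}"
    "path_image c4 \<inter> path_image f = {p b, p d}"
    "path_image f - {p b, p d} \<subseteq> inside (path_image c3 \<union> path_image c4)"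
    by (rule third_path_inside[of "ys @ c # zs" "rev (ws @ a # xs)" b d "[]", OF _ _ _ _ sub(3,4)])
      (use dist V chords in auto)
  have ce: "arc c1" "arc c2" "arc e" "pathstart c1 = p a" "pathfinish c1 = p c" "pathstart c2 = p a" "pathfinish c2 = p c"
    "pathstart e = p a" "pathfinish e = p c" and e3: "path_image e = drawn_edges {{a, c}}"
    and e12: "path_image c1 = drawn_edges (path_edges (a # (xs @ b # ys) @ [c]))"
      "path_image c2 = drawn_edges (path_edges (a # rev (zs @ d # ws) @ [c]))"
    using dr unfolding drawn_along_def by simp_all
  have cf: "arc f" "pathstart f = p b" "pathfinish f = p d" and f3: "path_image f = drawn_edges {{b, d}}"
    and f12: "path_image c3 = drawn_edges (path_edges (b # (ys @ c # zs) @ [d]))"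
      "path_image c4 = drawn_edges (path_edges (b # rev (ws @ a # xs) @ [d]))"
    using dr' unfolding drawn_along_def by simp_all
  have J: "path_image c1 \<union> path_image c2 = drawn_edges ?C" "path_image c3 \<union> path_image c4 = drawn_edges ?C"
    unfolding e12 f12 by (simp add: C1 drawn_edges_def Un_ac) (simp add: C2 drawn_edges_def Un_ac)
  have ne: "path_image g \<inter> I \<noteq> {}" if "arc g" "path_image g - {pathstart g, pathfinish g} \<subseteq> I" for g :: "real \<Rightarrow> complex" and I
    using nonempty_simple_path_endless[OF arc_imp_simple_path[OF that(1)]] that(2) by blast
  have un1: "\<Union>(path_edges (a # (xs @ b # ys) @ [c])) = set (a # (xs @ b # ys) @ [c])"
    and un2: "\<Union>(path_edges (a # rev (zs @ d # ws) @ [c])) = set (a # rev (zs @ d # ws) @ [c])"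
    by (rule Union_path_edges; simp)+
  show False
  proof (rule not_both_chords_inside[OF ce(1-3) cf(1) ce(4-9) cf(2,3) e(1-3)])
    show "path_image f \<inter> (path_image c1 \<union> path_image c2) = {p b, p d}"
    proof -
      have "path_image f \<inter> (path_image c3 \<union> path_image c4) = {p b, p d}" using f(2,3) by blast
      then show ?thesis using J by simp
    qed
    have "drawn_edges {{b,d}} \<inter> drawn_edges {{a,c}} \<subseteq> p ` (\<Union>{{b,d}} \<inter> \<Union>{{a,c}})"
      using chords dist by (intro drawn_edges_Int) (auto simp: doubleton_eq_iff)
    then show "path_image f \<inter> path_image e = {}" unfolding e3 f3 using dist by auto
    show "p b \<in> path_image c1 - {p a, p c}"
      unfolding e12 using vertex_in_drawn_edges[of "path_edges (a # (xs @ b # ys) @ [c])" b] un1 E C1 V dist inj_p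
      by (auto simp: inj_on_def)
    show "p d \<in> path_image c2 - {p a, p c}"
      unfolding e12 using vertex_in_drawn_edges[of "path_edges (a # rev (zs @ d # ws) @ [c])" d] un2 E C1 V dist inj_p
      by (auto simp: inj_on_def)
    show "path_image e \<inter> inside (path_image c1 \<union> path_image c2) \<noteq> {}" using ne[OF ce(3)] e(4) ce(8,9) by metis
    show "path_image f \<inter> inside (path_image c1 \<union> path_image c2) \<noteq> {}" using ne[OF cf(1)] f(4) cf(2,3) J by metis
  qed
qed

end

section \<open>Drawings from vertex orders without crossings\<close>

text \<open>A strictly convex curve: segments between its points meet away from common ends only if
  their ends alternate.\<close>

definition parabola :: "real \<Rightarrow> complex" where
  "parabola x = Complex x (x\<^sup>2)"

lemma parabola_sel [simp]: "Re (parabola x) = x" "Im (parabola x) = x\<^sup>2"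
  by (simp_all add: parabola_def)

text \<open>The height of a chord above the parabola at abscissa \<open>r\<close> is
  \<open>(r - x) * (y - r)\<close>; intersections of chords become equations between such
  products.\<close>

lemma parabola_chord:
  assumes "z \<in> closed_segment (parabola x) (parabola y)"
  shows "Im z = (Re z)\<^sup>2 + (Re z - x) * (y - Re z)" "0 \<le> (Re z - x) * (y - Re z)"
proof -
  obtain t where t: "0 \<le> t" "t \<le> 1" and z: "z = (1 - t) *\<^sub>R parabola x + t *\<^sub>R parabola y"
    using assms by (auto simp: closed_segment_def)
  have re: "Re z = (1 - t) * x + t * y" and im: "Im z = (1 - t) * x\<^sup>2 + t * y\<^sup>2"
    using z by simp_all
  show "Im z = (Re z)\<^sup>2 + (Re z - x) * (y - Re z)"
    unfolding re im by (simp add: power2_eq_square algebra_simps)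
  have "(Re z - x) * (y - Re z) = (t * (1 - t)) * (y - x)\<^sup>2"
    unfolding re by (simp add: power2_eq_square algebra_simps)
  then show "0 \<le> (Re z - x) * (y - Re z)" using t by simp
qed

text \<open>Overlapping intervals that do not alternate are nested, and at inner points the larger
  interval has the strictly larger product. Equal heights leave only common ends.\<close>

lemma noncrossing_chords_meet:
  fixes a b c d r :: real
  assumes "a < c" "b < d" "(a, c) \<noteq> (b, d)" "\<not> (a < b \<and> b < c \<and> c < d)" "\<not> (b < a \<and> a < d \<and> d < c)"
    and eq: "(r - a) * (c - r) = (r - b) * (d - r)" and nn: "0 \<le> (r - a) * (c - r)"
  shows "r \<in> {a, c} \<inter> {b, d}"
proof (cases "(r - a) * (c - r) = 0")
  case True
  then show ?thesis using eq by auto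
next
  case False
  then have "0 < (r - a) * (c - r)" "0 < (r - b) * (d - r)" using nn eq by linarith+
  then have r: "a < r" "r < c" "b < r" "r < d"
    using assms(1,2) by (auto simp: zero_less_mult_iff)
  have gt: "(r - q) * (s - r) < (r - p) * (t - r)"
    if "p \<le> q" "s \<le> t" "(p, t) \<noteq> (q, s)" "q < r" "r < s" for p q s t
  proof (cases "p = q")
    case True
    then show ?thesis using that by (auto intro!: mult_strict_left_mono)
  next
    case False
    then have "(r - q) * (s - r) < (r - p) * (s - r)" using that by (intro mult_strict_right_mono) auto
    also have "\<dots> \<le> (r - p) * (t - r)" using that by (intro mult_left_mono) auto
    finally show ?thesis .
  qed
  have "a \<le> b \<and> d \<le> c \<or> b \<le> a \<and> c \<le> d" using assms(4,5) r by linarith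
  then show ?thesis using gt[of a b d c] gt[of b a c d] assms(3) r eq by auto
qed

text \<open>All drawn points lie on or above the parabola, so a point below it escapes along a
  vertical ray. Vertices are limits of such points, hence on the unbounded face.\<close>

lemma noncrossing_imp_outerplanar:
  assumes G: "simple_graph G" and inj: "inj_on g (vertices G)" and nc: "noncrossing g (edges G)"
  shows "outerplanar G"
proof -
  define p where "p v = parabola (g v)" for v
  define \<gamma> where "\<gamma> e = (let u = SOME u. u \<in> e in linepath (p u) (p (SOME v. v \<in> e - {u})))" for e
  have edge: "\<exists>u v. e = {u, v} \<and> u \<in> vertices G \<and> v \<in> vertices G \<and> g u < g v \<and>
      path_image (\<gamma> e) = closed_segment (p u) (p v) \<and> arc (\<gamma> e) \<and>
      {pathstart (\<gamma> e), pathfinish (\<gamma> e)} = p ` e" if "e \<in> edges G" for e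
  proof -
    have "e \<in> {{u, v} | u v. u \<in> vertices G \<and> v \<in> vertices G \<and> u \<noteq> v}"
      using G that unfolding simple_graph_def by blast
    then obtain u v where uv: "e = {u, v}" "u \<noteq> v" "u \<in> vertices G" "v \<in> vertices G"
      unfolding mem_Collect_eq by metis
    define a where "a = (SOME u. u \<in> e)"
    define b where "b = (SOME v. v \<in> e - {a})"
    have a: "a \<in> e" unfolding a_def some_in_eq using uv by simp
    have "b \<in> e - {a}" unfolding b_def some_in_eq using uv by auto
    then have b: "b \<noteq> a" and e: "e = {a, b}" using a uv by auto
    have V: "a \<in> vertices G" "b \<in> vertices G" using uv e by (auto simp: doubleton_eq_iff)
    then have ne: "g a \<noteq> g b" using inj b by (auto simp: inj_on_def)
    have ge: "\<gamma> e = linepath (p a) (p b)" unfolding \<gamma>_def a_def b_def Let_def by simp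
    have "p a \<noteq> p b" using ne by (auto simp: p_def parabola_def)
    then have "arc (\<gamma> e)" "{pathstart (\<gamma> e), pathfinish (\<gamma> e)} = p ` e"
      "path_image (\<gamma> e) = closed_segment (p a) (p b)"
      using ge e by auto
    then show ?thesis
      using e V ne closed_segment_commute[of "p a" "p b"] insert_commute[of a b]
      by (metis linorder_neq_iff)
  qed
  have vert: "path_image (\<gamma> e) \<inter> p ` vertices G = p ` e" if e0: "e \<in> edges G" for e
  proof
    obtain u v where e: "e = {u, v}" "u \<in> vertices G" "v \<in> vertices G"
      "path_image (\<gamma> e) = closed_segment (p u) (p v)" using edge[OF e0] by blast
    show "p ` e \<subseteq> path_image (\<gamma> e) \<inter> p ` vertices G" using e by auto
    show "path_image (\<gamma> e) \<inter> p ` vertices G \<subseteq> p ` e"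
    proof
      fix z assume "z \<in> path_image (\<gamma> e) \<inter> p ` vertices G"
      then obtain w where w: "z = p w" "w \<in> vertices G" "p w \<in> closed_segment (p u) (p v)" using e by auto
      have "(g w - g u) * (g v - g w) = 0"
        using parabola_chord(1)[of "p w" "g u" "g v"] w unfolding p_def by simp
      then have "g w = g u \<or> g w = g v" by auto
      then have "w \<in> e" using inj w e by (auto simp: inj_on_def)
      then show "z \<in> p ` e" using w by blast
    qed
  qed
  have disj: "path_image (\<gamma> e) \<inter> path_image (\<gamma> f) \<subseteq> p ` (e \<inter> f)"
    if ef: "e \<in> edges G" "f \<in> edges G" "e \<noteq> f" for e f
  proof
    fix z assume z: "z \<in> path_image (\<gamma> e) \<inter> path_image (\<gamma> f)"
    obtain a c where e: "e = {a, c}" "a \<in> vertices G" "c \<in> vertices G" "g a < g c"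
      "path_image (\<gamma> e) = closed_segment (p a) (p c)" using edge[OF ef(1)] by blast
    obtain b d where f: "f = {b, d}" "b \<in> vertices G" "d \<in> vertices G" "g b < g d"
      "path_image (\<gamma> f) = closed_segment (p b) (p d)" using edge[OF ef(2)] by blast
    have 1: "Im z = (Re z)\<^sup>2 + (Re z - g a) * (g c - Re z)" "0 \<le> (Re z - g a) * (g c - Re z)"
      using parabola_chord[of z "g a" "g c"] z e unfolding p_def by auto
    have 2: "Im z = (Re z)\<^sup>2 + (Re z - g b) * (g d - Re z)" "0 \<le> (Re z - g b) * (g d - Re z)"
      using parabola_chord[of z "g b" "g d"] z f unfolding p_def by auto
    have ne: "(g a, g c) \<noteq> (g b, g d)" using ef(3) e f inj by (auto simp: inj_on_def)
    have r: "Re z \<in> {g a, g c} \<inter> {g b, g d}"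
    proof (rule noncrossing_chords_meet[OF e(4) f(4) ne])
      show "\<not> (g a < g b \<and> g b < g c \<and> g c < g d)" "\<not> (g b < g a \<and> g a < g d \<and> g d < g c)"
        using nc ef e(1) f(1) unfolding noncrossing_def by metis+
    qed (use 1 2 in auto)
    then obtain x y where xy: "x \<in> {a, c}" "y \<in> {b, d}" "Re z = g x" "Re z = g y"
      by (metis (no_types, lifting) IntD1 IntD2 insertE insertI1 insertI2 singletonD)
    then have "x = y" using inj e f by (auto simp: inj_on_def)
    moreover have "(Re z - g a) * (g c - Re z) = 0" using r by auto
    then have "z = p x" unfolding p_def using 1 xy by (simp add: complex_eq_iff)
    ultimately show "z \<in> p ` (e \<inter> f)" using xy e f by auto
  qed
  have "drawing_in_plane G p \<gamma>"
    unfolding drawing_in_plane_def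
  proof (intro conjI ballI impI)
    show "inj_on p (vertices G)" using inj by (auto simp: inj_on_def p_def parabola_def)
  qed (use edge vert disj in blast)+
  moreover have "p ` vertices G \<subseteq> frontier (outside (drawn_points G p \<gamma>))"
  proof
    let ?D = "drawn_points G p \<gamma>"
    have D: "(Re z)\<^sup>2 \<le> Im z" if "z \<in> ?D" for z
    proof (cases "z \<in> p ` vertices G")
      case True
      then show ?thesis by (auto simp: p_def)
    next
      case False
      then obtain e where e: "e \<in> edges G" "z \<in> path_image (\<gamma> e)" using \<open>z \<in> ?D\<close> by (auto simp: drawn_points_def)
      then obtain u v where "z \<in> closed_segment (p u) (p v)" using edge[OF e(1)] by auto
      then show ?thesis using parabola_chord[of z "g u" "g v"] unfolding p_def by simp
    qed
    have out: "w \<in> outside ?D" if "Im w < (Re w)\<^sup>2" for w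
    proof -
      define R where "R = {z. Re z = Re w \<and> Im z \<le> Im w}"
      have "convex R" unfolding R_def convex_def
        by (auto simp: convex_bound_le simp flip: distrib_right)
      moreover have "R \<subseteq> - ?D" using D that unfolding R_def by force
      ultimately have "R \<subseteq> connected_component_set (- ?D) w"
        by (intro connected_component_maximal) (auto simp: R_def convex_connected)
      moreover have "\<not> bounded R"
      proof
        assume "bounded R"
        then obtain B where B: "norm z \<le> B" if "z \<in> R" for z unfolding bounded_iff by blast
        have "Complex (Re w) (- \<bar>Im w\<bar> - \<bar>B\<bar> - 1) \<in> R" by (auto simp: R_def)
        from B[OF this] have "\<bar>- \<bar>Im w\<bar> - \<bar>B\<bar> - 1\<bar> \<le> B"
          using abs_Im_le_cmod[of "Complex (Re w) (- \<bar>Im w\<bar> - \<bar>B\<bar> - 1)"] by simp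
        then show False by linarith
      qed
      ultimately show ?thesis unfolding outside using bounded_subset by blast
    qed
    fix z assume "z \<in> p ` vertices G"
    then have z: "z \<in> ?D" "(Re z)\<^sup>2 = Im z" by (auto simp: drawn_points_def p_def)
    have "z \<in> closure (outside ?D)"
      unfolding closure_approachable
    proof (intro allI impI)
      fix e :: real assume "e > 0"
      have "z - Complex 0 (e/2) \<in> outside ?D" using z \<open>e > 0\<close> by (intro out) simp
      moreover have "dist (z - Complex 0 (e/2)) z < e" using \<open>e > 0\<close> by (simp add: dist_norm cmod_def)
      ultimately show "\<exists>y\<in>outside ?D. dist y z < e" by blast
    qed
    moreover have "z \<notin> outside ?D" using z outside_no_overlap[of ?D] by blast
    ultimately show "z \<in> frontier (outside ?D)"
      unfolding frontier_def using interior_subset by blast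
  qed
  ultimately show ?thesis unfolding outerplanar_def by blast
qed

section \<open>Vertex orders from excluded subdivisions\<close>

text \<open>No subdivision of \<open>K\<^sub>2\<^sub>,\<^sub>3\<close> and, since crossing chords on a cycle form a subdivision of
  \<open>K\<^sub>4\<close>, none of \<open>K\<^sub>4\<close>.\<close>

definition theta_free :: "'a set \<Rightarrow> 'a set set \<Rightarrow> bool" where
  "theta_free V E \<longleftrightarrow> (\<forall>u v xs ys zs. xs \<noteq> [] \<longrightarrow> ys \<noteq> [] \<longrightarrow> zs \<noteq> [] \<longrightarrow>
    distinct (u # v # xs @ ys @ zs) \<longrightarrow> set (u # v # xs @ ys @ zs) \<subseteq> V \<longrightarrow>
    \<not> path_edges (u # xs @ [v]) \<union> path_edges (u # ys @ [v]) \<union> path_edges (u # zs @ [v]) \<subseteq> E)"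

definition cross_free :: "'a set \<Rightarrow> 'a set set \<Rightarrow> bool" where
  "cross_free V E \<longleftrightarrow> (\<forall>a b c d xs ys zs ws. distinct (a # xs @ b # ys @ c # zs @ d # ws) \<longrightarrow>
    set (a # xs @ b # ys @ c # zs @ d # ws) \<subseteq> V \<longrightarrow>
    path_edges (a # xs @ b # ys @ c # zs @ d # ws @ [a]) \<subseteq> E \<longrightarrow> {a, c} \<in> E \<longrightarrow> {b, d} \<notin> E)"

lemma theta_free_mono:
  assumes "theta_free V E" "V' \<subseteq> V" "E' \<subseteq> E"
  shows "theta_free V' E'"
  unfolding theta_free_def
proof (intro allI impI notI)
  fix u v xs ys zs
  note * = assms(1)[unfolded theta_free_def, rule_format, of xs ys zs u v]
  assume "xs \<noteq> []" "ys \<noteq> []" "zs \<noteq> []" "distinct (u # v # xs @ ys @ zs)" "set (u # v # xs @ ys @ zs) \<subseteq> V'"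
    "path_edges (u # xs @ [v]) \<union> path_edges (u # ys @ [v]) \<union> path_edges (u # zs @ [v]) \<subseteq> E'"
  then show False using * assms(2,3) by (meson order_trans)
qed

lemma cross_free_mono:
  assumes "cross_free V E" "V' \<subseteq> V" "E' \<subseteq> E"
  shows "cross_free V' E'"
  unfolding cross_free_def
proof (intro allI impI)
  fix a b c d xs ys zs ws
  note * = assms(1)[unfolded cross_free_def, rule_format, of a xs b ys c zs d ws]
  assume "distinct (a # xs @ b # ys @ c # zs @ d # ws)" "set (a # xs @ b # ys @ c # zs @ d # ws) \<subseteq> V'"
    "path_edges (a # xs @ b # ys @ c # zs @ d # ws @ [a]) \<subseteq> E'" "{a, c} \<in> E'"
  then show "{b, d} \<notin> E'" using * assms(2,3) by (meson order_trans subsetD)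
qed

text \<open>Absence of crossings depends only on the cyclic order: moving the values below
  \<open>g c\<close> above all others makes \<open>c\<close> the least vertex.\<close>

lemma noncrossing_rotate:
  assumes nc: "noncrossing g E" and inj: "inj_on g V" and fin: "finite V" and c: "c \<in> V"
    and E: "\<And>e. e \<in> E \<Longrightarrow> e \<subseteq> V"
  obtains h where "noncrossing h E" "inj_on h V" "\<And>v. v \<in> V \<Longrightarrow> v \<noteq> c \<Longrightarrow> h c < h v"
proof -
  \<comment> \<open>Exceeds every difference of two values, so a shift by \<open>M\<close> moves a
    vertex past all of \<open>V\<close>.\<close>
  define M where "M = 2 * Max ((\<lambda>v. \<bar>g v\<bar>) ` V) + 1"
  have M: "g u < g v + M" if "u \<in> V" "v \<in> V" for u v
  proof -
    have "\<bar>g u\<bar> \<le> Max ((\<lambda>v. \<bar>g v\<bar>) ` V)" "\<bar>g v\<bar> \<le> Max ((\<lambda>v. \<bar>g v\<bar>) ` V)"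
      using that fin by auto
    then show ?thesis unfolding M_def by linarith
  qed
  define h where "h v = (if g v < g c then g v + M else g v)" for v
  have "noncrossing h E"
    unfolding noncrossing_def
  proof (intro allI impI notI)
    fix a b d e assume h: "h a < h b" "h b < h d" "h d < h e" and ed: "{a, d} \<in> E" "{b, e} \<in> E"
    then have V: "a \<in> V" "b \<in> V" "d \<in> V" "e \<in> V" using E by blast+
    have cyc: "g x < g y \<and> (g x < g c \<longleftrightarrow> g y < g c) \<or> g y < g x \<and> g y < g c \<and> \<not> g x < g c"
      if "h x < h y" "x \<in> V" "y \<in> V" for x y
      using that(1) M[OF that(2,3)] M[OF that(3,2)] unfolding h_def by (auto split: if_splits)
    \<comment> \<open>The four rotations of an alternating quadruple; the crossing in
      \<open>h\<close> comes from one of them in \<open>g\<close>.\<close>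
    have no: "\<not> (g a < g b \<and> g b < g d \<and> g d < g e)" "\<not> (g b < g d \<and> g d < g e \<and> g e < g a)"
      "\<not> (g d < g e \<and> g e < g a \<and> g a < g b)" "\<not> (g e < g a \<and> g a < g b \<and> g b < g d)"
      using nc[unfolded noncrossing_def, rule_format, of a b d e] nc[unfolded noncrossing_def, rule_format, of b d e a]
        nc[unfolded noncrossing_def, rule_format, of d e a b] nc[unfolded noncrossing_def, rule_format, of e a b d] ed
      by (auto simp: insert_commute)
    show False
      using cyc[OF h(1) V(1,2)] cyc[OF h(2) V(2,3)] cyc[OF h(3) V(3,4)] no by argo
  qed
  moreover have "inj_on h V"
  proof (rule inj_onI)
    fix x y assume xy: "x \<in> V" "y \<in> V" "h x = h y"
    then have "g x = g y" using M[OF xy(1,2)] M[OF xy(2,1)] unfolding h_def by (auto split: if_splits)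
    then show "x = y" using inj xy by (auto simp: inj_on_def)
  qed
  moreover have "h c < h v" if "v \<in> V" "v \<noteq> c" for v
    using M[OF c that(1)] that inj c unfolding h_def by (auto simp: inj_on_def not_less less_le)
  ultimately show thesis by (rule that)
qed

lemma noncrossing_reverse: "noncrossing g E \<Longrightarrow> noncrossing (\<lambda>v. - g v) E"
  unfolding noncrossing_def
proof (intro allI impI)
  fix a b c d
  assume "\<forall>a b c d. g a < g b \<longrightarrow> g b < g c \<longrightarrow> g c < g d \<longrightarrow> {a, c} \<in> E \<longrightarrow> {b, d} \<notin> E"
  from this[rule_format, of d c b a]
  show "- g a < - g b \<Longrightarrow> - g b < - g c \<Longrightarrow> - g c < - g d \<Longrightarrow> {a, c} \<in> E \<Longrightarrow> {b, d} \<notin> E"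
    by (auto simp: insert_commute)
qed

text \<open>At a cut vertex \<open>c\<close> the order of one side is made to end in
  \<open>c\<close> and that of the other to begin with it. With \<open>c\<close> shifted to 0 the
  sides occupy opposite half-lines, so edges of different sides cannot alternate.\<close>

lemma noncrossing_glue:
  assumes fin: "finite V" and V: "V = insert c (A \<union> B)" "A \<inter> B = {}" "c \<notin> A" "c \<notin> B"
    and E: "\<And>e. e \<in> E \<Longrightarrow> e \<subseteq> insert c A \<or> e \<subseteq> insert c B"
    and gA: "inj_on g1 (insert c A)" "noncrossing g1 {e \<in> E. e \<subseteq> insert c A}"
    and gB: "inj_on g2 (insert c B)" "noncrossing g2 {e \<in> E. e \<subseteq> insert c B}"
  shows "\<exists>g. inj_on g V \<and> noncrossing g E"
proof -
  have fin': "finite (insert c A)" "finite (insert c B)" using fin V by auto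
  obtain h1' where h1': "noncrossing h1' {e \<in> E. e \<subseteq> insert c A}" "inj_on h1' (insert c A)"
    "\<And>v. v \<in> insert c A \<Longrightarrow> v \<noteq> c \<Longrightarrow> h1' c < h1' v"
  proof (rule noncrossing_rotate[of "\<lambda>v. - g1 v" _ "insert c A" c])
    show "noncrossing (\<lambda>v. - g1 v) {e \<in> E. e \<subseteq> insert c A}" using gA by (intro noncrossing_reverse)
    show "inj_on (\<lambda>v. - g1 v) (insert c A)" using gA by (auto simp: inj_on_def)
  qed (use fin' in auto)
  obtain h2 where h2: "noncrossing h2 {e \<in> E. e \<subseteq> insert c B}" "inj_on h2 (insert c B)"
    "\<And>v. v \<in> insert c B \<Longrightarrow> v \<noteq> c \<Longrightarrow> h2 c < h2 v"
    by (rule noncrossing_rotate[OF gB(2,1) fin'(2), of c]) auto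
  \<comment> \<open>Rotation only makes \<open>c\<close> the least vertex; negation then makes it
    the greatest.\<close>
  define h1 where "h1 v = - h1' v" for v
  have h1: "noncrossing h1 {e \<in> E. e \<subseteq> insert c A}" "inj_on h1 (insert c A)"
    "\<And>v. v \<in> A \<Longrightarrow> h1 v < h1 c"
    using h1' V noncrossing_reverse[of h1'] unfolding h1_def by (auto simp: inj_on_def)
  define g where "g v = (if v \<in> A then h1 v - h1 c else h2 v - h2 c)" for v
  have gA: "g v = h1 v - h1 c" if "v \<in> insert c A" for v using that V by (auto simp: g_def)
  have gB: "g v = h2 v - h2 c" if "v \<in> insert c B" for v using that V by (auto simp: g_def)
  have neg: "v \<in> A \<Longrightarrow> g v < 0" and pos: "v \<in> B \<Longrightarrow> 0 < g v" for v
    using h1(3)[of v] h2(3)[of v] gA[of v] gB[of v] V by auto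
  have g0: "g c = 0" using gA[of c] by simp
  have inj: "inj_on g V"
  proof (rule inj_onI)
    fix x y assume xy: "x \<in> V" "y \<in> V" "g x = g y"
    then consider "x \<in> insert c A" "y \<in> insert c A" | "x \<in> insert c B" "y \<in> insert c B"
      using V neg pos by (metis UnE insertE insertCI less_asym)
    then show "x = y"
    proof cases
      case 1
      then show ?thesis using xy(3) gA inj_onD[OF h1(2)] by simp
    next
      case 2
      then show ?thesis using xy(3) gB inj_onD[OF h2(2)] by simp
    qed
  qed
  have "noncrossing g E"
    unfolding noncrossing_def
  proof (intro allI impI notI)
    fix a b d e assume g: "g a < g b" "g b < g d" "g d < g e" and ed: "{a, d} \<in> E" "{b, e} \<in> E"
    consider "{a,d} \<subseteq> insert c A" "{b,e} \<subseteq> insert c A" | "{a,d} \<subseteq> insert c B" "{b,e} \<subseteq> insert c B"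
      | "{a,d} \<subseteq> insert c A" "{b,e} \<subseteq> insert c B" | "{a,d} \<subseteq> insert c B" "{b,e} \<subseteq> insert c A"
      using E[OF ed(1)] E[OF ed(2)] by blast
    then show False
    proof cases
      case 1
      then show False
        using h1(1)[unfolded noncrossing_def, rule_format, of a b d e] ed g gA by simp
    next
      case 2
      then show False
        using h2(1)[unfolded noncrossing_def, rule_format, of a b d e] ed g gB by simp
    next
      case 3
      then have "g d \<le> 0" "0 \<le> g b" using neg pos g0 less_imp_le by (metis insertE insert_subset order_refl)+
      then show False using g by simp
    next
      case 4
      then have "g e \<le> 0" "0 \<le> g a" using neg pos g0 less_imp_le by (metis insertE insert_subset order_refl)+
      then show False using g by simp
    qed
  qed
  with inj show ?thesis by blast
qed

text \<open>A repeated vertex is avoided by cutting the path back to its earlier visit. The relation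
  restricts only second components, hence the assumption \<open>x \<in> K\<close>.\<close>

lemma distinct_path_of_rtrancl:
  assumes "(x, y) \<in> {(u, v). {u, v} \<in> E \<and> v \<in> K}\<^sup>*" "x \<in> K"
  shows "\<exists>xs. xs \<noteq> [] \<and> hd xs = x \<and> last xs = y \<and> distinct xs \<and> set xs \<subseteq> K \<and> path_edges xs \<subseteq> E"
  using assms(1)
proof induction
  case base
  then show ?case using assms(2) by (intro exI[of _ "[x]"]) auto
next
  case (step y z)
  then obtain xs where xs: "xs \<noteq> []" "hd xs = x" "last xs = y" "distinct xs" "set xs \<subseteq> K" "path_edges xs \<subseteq> E" by blast
  show ?case
  proof (cases "z \<in> set xs")
    case True
    then obtain as bs where s: "xs = as @ z # bs" by (meson split_list)
    then show ?thesis using xs path_edges_append[of as z bs]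
      by (intro exI[of _ "as @ [z]"]) (auto simp: hd_append split: if_splits)
  next
    case False
    have s: "xs = butlast xs @ [y]" using xs by (metis append_butlast_last_id)
    have "path_edges (xs @ [z]) = insert {y, z} (path_edges xs)"
      using path_edges_snoc2[of "butlast xs" y z] s by (metis append.assoc append_Cons append_Nil)
    then show ?thesis using xs False step by (intro exI[of _ "xs @ [z]"]) auto
  qed
qed

text \<open>Absence of a cut vertex, phrased by partitions so that its negation directly supplies
  the two sides for \<open>noncrossing_glue\<close>.\<close>

definition nonseparable :: "'a set \<Rightarrow> 'a set set \<Rightarrow> bool" where
  "nonseparable V E \<longleftrightarrow> (\<forall>c A B. V = insert c (A \<union> B) \<longrightarrow> A \<noteq> {} \<longrightarrow> B \<noteq> {} \<longrightarrow> A \<inter> B = {} \<longrightarrow>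
    c \<notin> A \<union> B \<longrightarrow> (\<exists>u\<in>A. \<exists>v\<in>B. {u, v} \<in> E))"

text \<open>A component \<open>K\<close> of the complement of \<open>C\<close> is attached to
  \<open>C\<close> at two vertices at least, since a single one would be a cut vertex. A path
  through the complement joins them.\<close>

lemma ear_of_set:
  assumes fin: "finite V" and E: "E \<subseteq> {{u, v} | u v. u \<in> V \<and> v \<in> V \<and> u \<noteq> v}"
    and nonsep: "nonseparable V E"
    and C: "C \<subseteq> V" "C \<noteq> V" "x \<in> C" "y \<in> C" "x \<noteq> y"
  obtains u v qs where "u \<in> C" "v \<in> C" "u \<noteq> v" "qs \<noteq> []" "distinct qs" "set qs \<subseteq> V - C"
    "path_edges (u # qs @ [v]) \<subseteq> E"
proof -
  obtain w where w: "w \<in> V - C" using C by blast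
  define R where "R = {(u, v). {u, v} \<in> E \<and> v \<in> V - C}"
  define K where "K = {k. (w, k) \<in> R\<^sup>*}"
  have KV: "K \<subseteq> V - C"
  proof
    fix k assume "k \<in> K"
    then have "(w, k) \<in> R\<^sup>*" unfolding K_def by simp
    then show "k \<in> V - C" by (induction) (use w in \<open>auto simp: R_def\<close>)
  qed
  have wK: "w \<in> K" unfolding K_def by simp
  have Kcl: "v \<in> K" if "u \<in> K" "{u, v} \<in> E" "v \<in> V - C" for u v
    using that unfolding K_def R_def by (auto intro: rtrancl_into_rtrancl)
  have att: "\<exists>z\<in>C - {c}. \<exists>k\<in>K. {k, z} \<in> E" if "c \<in> C" for c
  proof -
    have "\<exists>u\<in>K. \<exists>v\<in>V - insert c K. {u, v} \<in> E"
    proof (rule nonsep[unfolded nonseparable_def, rule_format, of c])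
      show "V - insert c K \<noteq> {}" using C KV by blast
    qed (use KV wK that C in auto)
    then show ?thesis using Kcl by blast
  qed
  \<comment> \<open>\<open>att\<close> is applied first at \<open>x\<close> and then at the vertex
    \<open>v\<close> found, which gives two different attachments.\<close>
  obtain v kv where v: "v \<in> C" "kv \<in> K" "{kv, v} \<in> E" using att[OF C(3)] by blast
  obtain u ku where u: "u \<in> C" "u \<noteq> v" "ku \<in> K" "{ku, u} \<in> E" using att[OF v(1)] by blast
  have reach: "(ku, w) \<in> R\<^sup>*"
  proof -
    have "(w, k) \<in> R\<^sup>* \<Longrightarrow> (k, w) \<in> R\<^sup>*" for k
    proof (induction rule: rtrancl_induct)
      case (step y z)
      have "y \<in> V - C" using step KV unfolding K_def by blast
      then have "(z, y) \<in> R" using step unfolding R_def by (auto simp: insert_commute)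
      then show ?case using step by (meson converse_rtrancl_into_rtrancl)
    qed simp
    then show ?thesis using u unfolding K_def by blast
  qed
  then have "(ku, kv) \<in> R\<^sup>*" using v unfolding K_def by (auto intro: rtrancl_trans)
  then obtain qs where qs: "qs \<noteq> []" "hd qs = ku" "last qs = kv" "distinct qs" "set qs \<subseteq> V - C" "path_edges qs \<subseteq> E"
    using distinct_path_of_rtrancl[of ku kv E "V - C"] u KV unfolding R_def by blast
  have "path_edges (u # qs @ [v]) \<subseteq> E"
  proof -
    have 1: "qs = butlast qs @ [kv]" using qs by (metis append_butlast_last_id)
    have "path_edges (qs @ [v]) \<subseteq> E"
      using path_edges_snoc2[of "butlast qs" kv v] 1 qs v by (metis append.assoc append_Cons append_Nil insert_subset)
    then show ?thesis using qs u by (cases qs) (auto simp: insert_commute)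
  qed
  then show thesis using that[of u v qs] u v qs by blast
qed

text \<open>A single edge counts as a cycle of length two here.\<close>

definition cycle_list :: "'a set set \<Rightarrow> 'a list \<Rightarrow> bool" where
  "cycle_list E cs \<longleftrightarrow> 2 \<le> length cs \<and> distinct cs \<and> path_edges (cs @ [hd cs]) \<subseteq> E"

lemma cycle_list_rotate:
  assumes "cycle_list E (xs @ ys)"
  shows "cycle_list E (ys @ xs)"
proof (cases "xs = [] \<or> ys = []")
  case False
  then obtain x xs' y ys' where s: "xs = x # xs'" "ys = y # ys'" by (meson neq_Nil_conv)
  have "path_edges (ys @ xs @ [y]) = path_edges (xs @ ys @ [x])"
    using path_edges_append[of "y # ys'" x "xs' @ [y]"] path_edges_append[of "x # xs'" y "ys' @ [x]"] s by auto
  then show ?thesis using assms s unfolding cycle_list_def by auto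
qed (use assms in auto)

text \<open>An ear at a longest cycle divides the cycle into two paths. If one has no inner vertex,
  replacing it by the ear gives a longer cycle; otherwise the two paths and the ear form a forbidden
  theta.\<close>

lemma hamiltonian_of_nonseparable:
  assumes fin: "finite V" and E: "E \<subseteq> {{u, v} | u v. u \<in> V \<and> v \<in> V \<and> u \<noteq> v}"
    and nonsep: "nonseparable V E"
    and card: "3 \<le> card V" and tf: "theta_free V E"
  obtains cs where "cycle_list E cs" "set cs = V"
proof -
  have sub: "set cs \<subseteq> V" if "cycle_list E cs" for cs
  proof -
    have "2 \<le> length (cs @ [hd cs])" using that unfolding cycle_list_def by simp
    then have "set (cs @ [hd cs]) = \<Union>(path_edges (cs @ [hd cs]))" by (simp add: Union_path_edges)
    also have "\<dots> \<subseteq> V" using that E unfolding cycle_list_def by blast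
    finally show ?thesis by simp
  qed
  have len: "length cs < Suc (card V)" if "cycle_list E cs" for cs
    using sub[OF that] that fin card_mono[of V "set cs"] unfolding cycle_list_def
    by (simp add: distinct_card)
  have "\<exists>cs. cycle_list E cs"
  proof -
    obtain c where c: "c \<in> V" using card by fastforce
    have "2 \<le> card (V - {c})" using card c by (simp add: fin)
    then obtain x y where xy: "x \<in> V - {c}" "y \<in> V - {c}" "x \<noteq> y"
      by (metis card_2_iff' card_le_Suc0_iff_eq fin finite_Diff not_less_eq_eq numeral_2_eq_2)
    \<comment> \<open>An edge is enough as a starting point, being a cycle of length two; it leaves
      \<open>x\<close> when \<open>c\<close> is the removed vertex.\<close>
    have "\<exists>u\<in>{x}. \<exists>v\<in>V - {c, x}. {u, v} \<in> E" using xy c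
      by (intro nonsep[unfolded nonseparable_def, rule_format, of c]) auto
    then obtain v where "v \<noteq> x" "{x, v} \<in> E" by blast
    then have "cycle_list E [x, v]" unfolding cycle_list_def by (auto simp: insert_commute)
    then show ?thesis by blast
  qed
  then obtain cs where cs: "cycle_list E cs" "\<And>ds. cycle_list E ds \<Longrightarrow> length ds \<le> length cs"
    using ex_has_greatest_nat[of "cycle_list E" _ length "Suc (card V)"] len by blast
  have "set cs = V"
  proof (rule ccontr)
    assume ne: "set cs \<noteq> V"
    obtain x y where xy: "x \<in> set cs" "y \<in> set cs" "x \<noteq> y"
      using cs(1) unfolding cycle_list_def
      by (metis distinct_card card_2_iff' card_le_Suc0_iff_eq finite_set not_less_eq_eq numeral_2_eq_2)
    obtain u v qs where q: "u \<in> set cs" "v \<in> set cs" "u \<noteq> v" "qs \<noteq> []" "distinct qs" "set qs \<subseteq> V - set cs"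
      "path_edges (u # qs @ [v]) \<subseteq> E"
      by (rule ear_of_set[OF fin E nonsep sub[OF cs(1)] ne xy])
    obtain l r where "cs = l @ u # r" using q(1) by (meson split_list)
    then have cs': "cycle_list E (u # r @ l)" "length cs = length (u # r @ l)" "set cs = set (u # r @ l)"
      using cycle_list_rotate[of E l "u # r"] cs(1) by auto
    then have "v \<in> set (r @ l)" using q by auto
    then obtain as bs where ab: "r @ l = as @ v # bs" by (meson split_list)
    have D: "distinct (u # as @ v # bs)" and pe: "path_edges (u # as @ v # bs @ [u]) \<subseteq> E"
      using cs'(1) unfolding cycle_list_def ab by auto
    have sets: "set cs = set (u # as @ v # bs)" using cs' ab by auto
    have pe1: "path_edges (u # as @ [v]) \<subseteq> E" and pe2: "path_edges (v # bs @ [u]) \<subseteq> E"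
      using path_edges_append[of "u # as" v "bs @ [u]"] pe by auto
    have q': "path_edges (v # rev qs @ [u]) \<subseteq> E" using path_edges_rev[of "u # qs @ [v]"] q by simp
    have pe3: "path_edges (u # rev bs @ [v]) \<subseteq> E" using path_edges_rev[of "v # bs @ [u]"] pe2 by simp
    have qd: "set qs \<inter> set (u # as @ v # bs) = {}" using q sets by auto
    have lcs: "length cs = length as + length bs + 2" using cs'(2) ab by (metis length_append length_Cons add_Suc_right add_2_eq_Suc')
    consider "as = []" | "bs = []" | "as \<noteq> []" "bs \<noteq> []" by blast
    then show False
    proof cases
      case 1
      have "path_edges (u # qs @ v # bs @ [u]) \<subseteq> E"
        using path_edges_append[of "u # qs" v "bs @ [u]"] q(7) pe2 by simp
      then have "cycle_list E (u # qs @ v # bs)"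
        unfolding cycle_list_def using D q(5) qd by auto
      from cs(2)[OF this] show False using lcs 1 q(4) by (cases qs) auto
    next
      case 2
      have "path_edges (u # as @ v # rev qs @ [u]) \<subseteq> E"
        using path_edges_append[of "u # as" v "rev qs @ [u]"] q' pe1 by simp
      then have "cycle_list E (u # as @ v # rev qs)"
        unfolding cycle_list_def using D q(5) qd by auto
      from cs(2)[OF this] show False using lcs 2 q(4) by (cases qs) auto
    next
      case 3
      have "distinct (u # v # as @ rev bs @ qs)" using D q(5) qd by auto
      moreover have "set (u # v # as @ rev bs @ qs) \<subseteq> V" using sub[OF cs(1)] sets q(6) by auto
      moreover have "path_edges (u # as @ [v]) \<union> path_edges (u # rev bs @ [v]) \<union> path_edges (u # qs @ [v]) \<subseteq> E"
        using pe1 pe3 q(7) by blast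
      ultimately show False using tf 3 q(4) unfolding theta_free_def by (metis rev_is_Nil_conv)
    qed
  qed
  then show thesis using that cs(1) by blast
qed

text \<open>With the vertices numbered along the cycle, alternating edges are crossing chords of
  it.\<close>

lemma noncrossing_of_hamiltonian:
  assumes cs: "cycle_list E cs" "set cs = V" and cf: "cross_free V E" and E: "\<And>e. e \<in> E \<Longrightarrow> e \<subseteq> V"
  shows "\<exists>g. inj_on g V \<and> noncrossing g E"
proof -
  define g where "g v = real (THE i. i < length cs \<and> cs ! i = v)" for v
  have dist: "distinct cs" using cs unfolding cycle_list_def by simp
  have g: "g (cs ! i) = real i" if "i < length cs" for i
  proof -
    have "(THE j. j < length cs \<and> cs ! j = cs ! i) = i"
      using that dist by (intro the_equality) (auto simp: nth_eq_iff_index_eq)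
    then show ?thesis unfolding g_def by simp
  qed
  have "inj_on g V" using g cs(2) by (intro inj_onI) (metis in_set_conv_nth of_nat_eq_iff)
  moreover have "noncrossing g E"
    unfolding noncrossing_def
  proof (intro allI impI notI)
    fix a b c d assume lt: "g a < g b" "g b < g c" "g c < g d" and ed: "{a, c} \<in> E" "{b, d} \<in> E"
    then have V: "a \<in> set cs" "b \<in> set cs" "c \<in> set cs" "d \<in> set cs" using E cs(2) by blast+
    obtain i j k l where ix: "i < length cs" "j < length cs" "k < length cs" "l < length cs"
      "a = cs ! i" "b = cs ! j" "c = cs ! k" "d = cs ! l" using V by (metis in_set_conv_nth)
    then have o: "i < j" "j < k" "k < l" using lt g by auto
    define xs where "xs = take (j - Suc i) (drop (Suc i) cs)"
    define ys where "ys = take (k - Suc j) (drop (Suc j) cs)"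
    define zs where "zs = take (l - Suc k) (drop (Suc k) cs)"
    have st: "drop m cs = cs ! m # take (n - Suc m) (drop (Suc m) cs) @ drop n cs"
      if "m < n" "n < length cs" for m n
    proof -
      have "drop m cs = cs ! m # drop (Suc m) cs" using that by (simp add: Cons_nth_drop_Suc)
      also have "drop (Suc m) cs = take (n - Suc m) (drop (Suc m) cs) @ drop n cs"
        using that by (metis Suc_leI append_take_drop_id drop_drop le_add_diff_inverse2)
      finally show ?thesis .
    qed
    have "drop i cs = a # xs @ b # ys @ c # zs @ d # drop (Suc l) cs"
      using st[of i j] st[of j k] st[of k l] ix o unfolding xs_def ys_def zs_def
      by (simp add: Cons_nth_drop_Suc)
    then have full: "cs = take i cs @ a # xs @ b # ys @ c # zs @ d # drop (Suc l) cs"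
      by (metis append_take_drop_id)
    \<comment> \<open>The stretch from \<open>d\<close> back to \<open>a\<close> wraps around the
      end of the list.\<close>
    define ws where "ws = drop (Suc l) cs @ take i cs"
    have cyc: "cycle_list E (a # xs @ b # ys @ c # zs @ d # ws)"
      using cycle_list_rotate[of E "take i cs" "a # xs @ b # ys @ c # zs @ d # drop (Suc l) cs"] cs(1) full
      unfolding ws_def by simp
    moreover have "set (a # xs @ b # ys @ c # zs @ d # ws) = set cs"
      unfolding ws_def by (subst (2) full) auto
    ultimately show False
      using cf ed cs(2) unfolding cross_free_def cycle_list_def
      by (metis (no_types, lifting) append_Cons append_assoc list.sel(1) order_refl)
  qed
  ultimately show ?thesis by blast
qed

text \<open>Three vertices admit no crossing. At a cut vertex the orders of the two sides, given by
  induction, are glued; without one there is a Hamiltonian cycle to number along.\<close>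

theorem theta_cross_free_imp_noncrossing:
  assumes "finite V" "E \<subseteq> {{u, v} | u v. u \<in> V \<and> v \<in> V \<and> u \<noteq> v}" "theta_free V E" "cross_free V E"
  shows "\<exists>g. inj_on g V \<and> noncrossing g E"
  using assms
proof (induction "card V" arbitrary: V E rule: less_induct)
  case less
  have EV: "e \<subseteq> V" if "e \<in> E" for e using less.prems(2) that by blast
  show ?case
  proof (cases "card V \<le> 3")
    case True
    obtain f :: "'a \<Rightarrow> nat" where f: "inj_on f V" using finite_imp_inj_to_nat_seg less.prems(1) by metis
    have "noncrossing (\<lambda>v. real (f v)) E"
      unfolding noncrossing_def
    proof (intro allI impI notI)
      fix a b c d assume "real (f a) < real (f b)" "real (f b) < real (f c)" "real (f c) < real (f d)"
        and ed: "{a, c} \<in> E" "{b, d} \<in> E"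
      then have "distinct [a, b, c, d]" by auto
      then have "card {a, b, c, d} = 4" using distinct_card[of "[a, b, c, d]"] by simp
      moreover have "{a, b, c, d} \<subseteq> V" using EV ed by blast
      ultimately show False using card_mono[OF less.prems(1), of "{a, b, c, d}"] True by linarith
    qed
    moreover have "inj_on (\<lambda>v. real (f v)) V" using f by (auto simp: inj_on_def)
    ultimately show ?thesis by blast
  next
    case big: False
    show ?thesis
    proof (cases "nonseparable V E")
      case False
      then obtain c A B where s: "V = insert c (A \<union> B)" "A \<noteq> {}" "B \<noteq> {}" "A \<inter> B = {}" "c \<notin> A" "c \<notin> B"
        "\<And>u v. u \<in> A \<Longrightarrow> v \<in> B \<Longrightarrow> {u, v} \<notin> E"
        unfolding nonseparable_def by (metis (no_types, opaque_lifting) UnI1 UnI2)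
      have IH: "\<exists>g. inj_on g X \<and> noncrossing g {e \<in> E. e \<subseteq> X}" if "X \<subset> V" for X
      proof (rule less.hyps)
        show "card X < card V" using that less.prems(1) psubset_card_mono by blast
        show "finite X" using that less.prems(1) finite_subset by blast
        show "theta_free X {e \<in> E. e \<subseteq> X}" using that by (intro theta_free_mono[OF less.prems(3)]) auto
        show "cross_free X {e \<in> E. e \<subseteq> X}" using that by (intro cross_free_mono[OF less.prems(4)]) auto
        show "{e \<in> E. e \<subseteq> X} \<subseteq> {{u, v} |u v. u \<in> X \<and> v \<in> X \<and> u \<noteq> v}"
        proof
          fix e assume e: "e \<in> {e \<in> E. e \<subseteq> X}"
          then have "e \<in> {{u, v} | u v. u \<in> V \<and> v \<in> V \<and> u \<noteq> v}" using less.prems(2) by auto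
          then obtain u v where "e = {u, v}" "u \<noteq> v" unfolding mem_Collect_eq by metis
          then show "e \<in> {{u, v} |u v. u \<in> X \<and> v \<in> X \<and> u \<noteq> v}" using e by auto
        qed
      qed
      obtain x y where xy: "x \<in> A" "y \<in> B" using s(2,3) by blast
      have "insert c A \<subseteq> V" "insert c B \<subseteq> V" "x \<in> V" "y \<in> V" using xy unfolding s(1) by auto
      moreover have "x \<notin> insert c B" "y \<notin> insert c A" using xy s(4,5,6) by auto
      ultimately have "insert c A \<subset> V" "insert c B \<subset> V" by auto
      then obtain g1 g2 where g: "inj_on g1 (insert c A)" "noncrossing g1 {e \<in> E. e \<subseteq> insert c A}"
        "inj_on g2 (insert c B)" "noncrossing g2 {e \<in> E. e \<subseteq> insert c B}"
        using IH[of "insert c A"] IH[of "insert c B"] by auto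
      have Ecov: "e \<subseteq> insert c A \<or> e \<subseteq> insert c B" if e: "e \<in> E" for e
      proof -
        have "e \<in> {{u, v} | u v. u \<in> V \<and> v \<in> V \<and> u \<noteq> v}" using less.prems(2) e by (rule subsetD)
        then obtain u v where "e = {u, v}" "u \<in> V" "v \<in> V" unfolding mem_Collect_eq by metis
        then show ?thesis using s(1) s(7)[of u v] s(7)[of v u] e by (auto simp: insert_commute)
      qed
      show ?thesis by (rule noncrossing_glue[OF less.prems(1) s(1,4,5,6) Ecov g])
    next
      case True
      obtain cs where "cycle_list E cs" "set cs = V"
        using hamiltonian_of_nonseparable[OF less.prems(1,2) True _ less.prems(3)] big by (metis nat_le_linear)
      then show ?thesis using noncrossing_of_hamiltonian less.prems(4) EV by metis
    qed
  qed
qed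

section \<open>Triangulated polygons\<close>

lemma finite_has_least_value:
  fixes f :: "'a \<Rightarrow> real"
  assumes "finite D" "D \<noteq> {}"
  obtains x where "x \<in> D" "\<And>y. y \<in> D \<Longrightarrow> f x \<le> f y"
proof -
  have "Min (f ` D) \<in> f ` D" using assms by (intro Min_in) auto
  then obtain x where "x \<in> D" "f x = Min (f ` D)" by auto
  then show thesis using that[of x] assms by auto
qed

definition one_page :: "'a set \<Rightarrow> 'a set set \<Rightarrow> bool" where
  "one_page V E \<longleftrightarrow> (\<exists>g. inj_on g V \<and> noncrossing g E)"

text \<open>Combinatorial counterpart of a maximal outerplanar graph. Maximality is used by
  exhibiting an order in which a new pair causes no crossing.\<close>

locale maximal_one_page =
  fixes V :: "'a set" and E :: "'a set set"
  assumes fin: "finite V" and card: "3 \<le> card V"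
    and edge_subset: "e \<in> E \<Longrightarrow> e \<subseteq> V"
    and no_loop: "{u, u} \<notin> E"
    and one_page: "one_page V E"
    and maximal: "u \<in> V \<Longrightarrow> v \<in> V \<Longrightarrow> u \<noteq> v \<Longrightarrow> {u, v} \<notin> E \<Longrightarrow> \<not> one_page V (insert {u, v} E)"
begin

text \<open>The given order stays free of crossings when \<open>u\<close> and \<open>v\<close> are
  joined, so maximality makes the pair an edge.\<close>

lemma uncrossed_is_edge:
  assumes g: "inj_on g V" "noncrossing g E" and uv: "u \<in> V" "v \<in> V" "g u < g v"
    and unc: "\<And>x y. {x, y} \<in> E \<Longrightarrow> g u < g x \<Longrightarrow> g x < g v \<Longrightarrow> g u \<le> g y \<and> g y \<le> g v"
  shows "{u, v} \<in> E"
proof (rule ccontr)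
  assume "{u, v} \<notin> E"
  then have "\<not> one_page V (insert {u, v} E)" using maximal uv by auto
  moreover have "noncrossing g (insert {u, v} E)"
    unfolding noncrossing_def
  proof (intro allI impI notI)
    fix a b c d assume o: "g a < g b" "g b < g c" "g c < g d"
      and ac: "{a, c} \<in> insert {u, v} E" and bd: "{b, d} \<in> insert {u, v} E"
    have "a = u \<and> c = v" if "{a, c} = {u, v}" using that o uv by (auto simp: doubleton_eq_iff)
    moreover have "b = u \<and> d = v" if "{b, d} = {u, v}" using that o uv by (auto simp: doubleton_eq_iff)
    moreover have "\<not> ({a, c} \<in> E \<and> {b, d} \<in> E)"
      using g(2)[unfolded noncrossing_def, rule_format, OF o] by blast
    ultimately consider "a = u" "c = v" "{b, d} \<in> E" | "b = u" "d = v" "{c, a} \<in> E" | "a = u" "b = u"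
      using ac bd insert_commute[of a c "{}"] by fastforce
    then show False
      using o unc[of b d] unc[of c a] by cases auto
  qed
  ultimately show False using g(1) unfolding one_page_def by blast
qed

lemma rotated_order:
  assumes "c \<in> V"
  obtains h where "inj_on h V" "noncrossing h E" "\<And>v. v \<in> V \<Longrightarrow> v \<noteq> c \<Longrightarrow> h c < h v"
proof -
  obtain g where g: "inj_on g V" "noncrossing g E" using one_page unfolding one_page_def by blast
  show thesis
    by (rule noncrossing_rotate[OF g(2,1) fin assms edge_subset]) (auto intro: that)
qed

lemma edge_vertices: "{u, v} \<in> E \<Longrightarrow> u \<in> V \<and> v \<in> V \<and> u \<noteq> v"
  using edge_subset[of "{u, v}"] no_loop[of u] by auto

text \<open>With \<open>c\<close> first in the order, its neighbours on the polygon are the next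
  vertex and the last one; no edge crosses these pairs.\<close>

lemma two_neighbours:
  assumes c: "c \<in> V"
  obtains y z where "{c, y} \<in> E" "{c, z} \<in> E" "y \<noteq> z"
proof -
  obtain h where h: "inj_on h V" "noncrossing h E" "\<And>v. v \<in> V \<Longrightarrow> v \<noteq> c \<Longrightarrow> h c < h v"
    using rotated_order[OF c] by blast
  let ?W = "V - {c}"
  have W: "finite ?W" "2 \<le> card ?W" using fin card c by auto
  then have ne: "?W \<noteq> {}" by (metis card.empty not_numeral_le_zero)
  obtain y where y: "y \<in> ?W" "\<And>v. v \<in> ?W \<Longrightarrow> h y \<le> h v" using finite_has_least_value[OF W(1) ne] by metis
  obtain z where z: "z \<in> ?W" "\<And>v. v \<in> ?W \<Longrightarrow> - h z \<le> - h v"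
    using finite_has_least_value[OF W(1) ne, of "\<lambda>v. - h v"] by metis
  have "{c, y} \<in> E"
  proof (rule uncrossed_is_edge[OF h(1,2) c])
    fix a b assume "{a, b} \<in> E" "h c < h a" "h a < h y"
    then show "h c \<le> h b \<and> h b \<le> h y" using y(2)[of a] edge_vertices[of a b] by force
  qed (use y h in auto)
  moreover have "{c, z} \<in> E"
  proof (rule uncrossed_is_edge[OF h(1,2) c])
    fix a b assume "{a, b} \<in> E" "h c < h a" "h a < h z"
    then show "h c \<le> h b \<and> h b \<le> h z"
      using z(2)[of b] h(3)[of b] h(3)[of z] z(1) edge_vertices[of a b] by (cases "b = c") auto
  qed (use z h in auto)
  moreover have "y \<noteq> z"
  proof
    assume "y = z"
    then have "v = y" if "v \<in> ?W" for v
      using y z that h(1) by (metis DiffD1 inj_onD neg_le_iff_le order_antisym)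
    then have "?W \<subseteq> {y}" by blast
    then have "card ?W \<le> 1" using card_mono[of "{y}" ?W] by simp
    then show False using W by simp
  qed
  ultimately show thesis using that by blast
qed

text \<open>Take two neighbours of \<open>c\<close>, one in \<open>X\<close> and one not, as close
  as possible in an order starting at \<open>c\<close>. No neighbour of \<open>c\<close> lies
  between them, and an edge leaving the interval between them would cross one of their edges to
  \<open>c\<close>. So they are adjacent, against the closure of \<open>X\<close>.\<close>

lemma link_connected:
  assumes X: "X \<subseteq> {y. {c, y} \<in> E}" "X \<noteq> {}"
    and closed: "\<And>x y. x \<in> X \<Longrightarrow> {c, y} \<in> E \<Longrightarrow> {x, y} \<in> E \<Longrightarrow> y \<in> X"
    and y: "{c, y} \<in> E"
  shows "y \<in> X"
proof (rule ccontr)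
  assume nX: "y \<notin> X"
  have c: "c \<in> V" using edge_vertices[OF y] by simp
  obtain h where h: "inj_on h V" "noncrossing h E" "\<And>v. v \<in> V \<Longrightarrow> v \<noteq> c \<Longrightarrow> h c < h v"
    using rotated_order[OF c] by blast
  let ?D = "X \<times> ({y. {c, y} \<in> E} - X)"
  have "{y. {c, y} \<in> E} \<subseteq> V" using edge_vertices by blast
  then have "finite ?D" using fin X by (meson finite_Diff finite_SigmaI finite_subset)
  moreover have "?D \<noteq> {}" using X y nX by blast
  ultimately obtain xy where xy: "xy \<in> ?D" "\<And>p. p \<in> ?D \<Longrightarrow> \<bar>h (fst xy) - h (snd xy)\<bar> \<le> \<bar>h (fst p) - h (snd p)\<bar>"
    using finite_has_least_value[of ?D "\<lambda>p. \<bar>h (fst p) - h (snd p)\<bar>"] by metis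
  obtain x w where xw: "x \<in> X" "{c, w} \<in> E" "w \<notin> X" "xy = (x, w)" using xy(1) by blast
  have min: "\<bar>h x - h w\<bar> \<le> \<bar>h x' - h w'\<bar>" if "x' \<in> X" "{c, w'} \<in> E" "w' \<notin> X" for x' w'
    using xy(2)[of "(x', w')"] that xw by auto
  have cx: "{c, x} \<in> E" using X xw by blast
  have gap: "{c, v} \<notin> E" if "h x < h v \<and> h v < h w \<or> h w < h v \<and> h v < h x" for v
  proof
    assume "{c, v} \<in> E"
    then show False using min[of v w] min[of x v] xw that by (cases "v \<in> X") auto
  qed
  have edge: "{u, v} \<in> E" if uv: "{c, u} \<in> E" "{c, v} \<in> E" "h u < h v"
    and g: "\<And>q. h u < h q \<Longrightarrow> h q < h v \<Longrightarrow> {c, q} \<notin> E" for u v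
  proof (rule uncrossed_is_edge[OF h(1,2)])
    show "u \<in> V" "v \<in> V" "h u < h v" using uv edge_vertices by blast+
    fix a b assume ab: "{a, b} \<in> E" "h u < h a" "h a < h v"
    have "b \<noteq> c" using g[of a] ab by (auto simp: insert_commute)
    then have cb: "h c < h b" using h(3) edge_vertices[OF ab(1)] by blast
    have "h c < h a" using h(3)[of u] edge_vertices[OF uv(1)] ab by auto
    then show "h u \<le> h b \<and> h b \<le> h v"
      using h(2)[unfolded noncrossing_def, rule_format, of c b u a]
        h(2)[unfolded noncrossing_def, rule_format, of c a v b] uv ab cb
      by (force simp: insert_commute)
  qed
  have "x \<noteq> w" "x \<in> V" "w \<in> V" using xw cx edge_vertices by blast+
  then have "h x \<noteq> h w" using h(1) by (auto simp: inj_on_def)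
  then have "{x, w} \<in> E" using edge[OF cx xw(2)] edge[OF xw(2) cx] gap
    by (metis insert_commute linorder_neqE_linordered_idom)
  then show False using closed xw by blast
qed

text \<open>If \<open>y\<close> shared no triangle with \<open>x\<close>, it would be isolated in
  the connected link of \<open>x\<close>, hence the only neighbour of \<open>x\<close>.\<close>

lemma edge_in_triangle:
  assumes "{x, y} \<in> E"
  obtains z where "{x, z} \<in> E" "{y, z} \<in> E"
proof -
  obtain u v where uv: "{x, u} \<in> E" "{x, v} \<in> E" "u \<noteq> v" using two_neighbours[of x] edge_vertices[OF assms] by blast
  have "\<exists>z. {x, z} \<in> E \<and> {y, z} \<in> E"
  proof (rule ccontr)
    assume no: "\<nexists>z. {x, z} \<in> E \<and> {y, z} \<in> E"
    have "w = y" if "{x, w} \<in> E" for w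
    proof -
      have "w \<in> {y}" by (rule link_connected[of "{y}" x w]) (use assms no that in auto)
      then show ?thesis by simp
    qed
    then have "u = y" "v = y" using uv by auto
    then show False using uv(3) by simp
  qed
  then show thesis using that by blast
qed

text \<open>\<open>S\<close> is one side of the chord: the vertices between \<open>x\<close> and
  \<open>y\<close> in an order starting at \<open>x\<close>. Two common neighbours on the same side
  would have crossing edges to \<open>x\<close> and \<open>y\<close>.\<close>

lemma common_neighbours_sides:
  assumes xy: "{x, y} \<in> E"
  obtains S where "x \<notin> S" "y \<notin> S"
    "\<And>u v. {u, v} \<in> E \<Longrightarrow> u \<in> S \<Longrightarrow> v \<in> insert x (insert y S)"
    "\<And>z t. {x, z} \<in> E \<Longrightarrow> {y, z} \<in> E \<Longrightarrow> {x, t} \<in> E \<Longrightarrow> {y, t} \<in> E \<Longrightarrow> z \<in> S \<longleftrightarrow> t \<in> S \<Longrightarrow> z = t"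
proof -
  have V: "x \<in> V" "y \<in> V" "x \<noteq> y" using edge_vertices[OF xy] by auto
  obtain h where h: "inj_on h V" "noncrossing h E" "\<And>v. v \<in> V \<Longrightarrow> v \<noteq> x \<Longrightarrow> h x < h v"
    using rotated_order[OF V(1)] by blast
  define S where "S = {s \<in> V. s \<noteq> x \<and> h s < h y}"
  note nc = h(2)[unfolded noncrossing_def, rule_format]
  show thesis
  proof (rule that[of S])
    fix u v assume uv: "{u, v} \<in> E" "u \<in> S"
    show "v \<in> insert x (insert y S)"
    proof (rule ccontr)
      assume "v \<notin> insert x (insert y S)"
      then have "h y < h v" using edge_vertices[OF uv(1)] V h(1) unfolding S_def
        by (metis (mono_tags, lifting) inj_onD insertCI linorder_neqE_linordered_idom mem_Collect_eq)
      moreover have "h x < h u" "h u < h y" using uv h(3) unfolding S_def by auto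
      ultimately show False using nc[of x u y v] xy uv by blast
    qed
  next
    have key: "\<not> h z < h t" if e: "{x, z} \<in> E" "{y, z} \<in> E" "{x, t} \<in> E" "{y, t} \<in> E" "z \<in> S \<longleftrightarrow> t \<in> S" for z t
    proof
      assume lt: "h z < h t"
      have Vzt: "z \<in> V" "z \<noteq> x" "z \<noteq> y" "t \<in> V" "t \<noteq> x" "t \<noteq> y" using e edge_vertices by blast+
      then have g: "h x < h z" "h x < h t" "h z \<noteq> h y" "h t \<noteq> h y" using h V by (auto simp: inj_on_def)
      show False
      proof (cases "z \<in> S")
        case True
        then have "h t < h y" using e(5) unfolding S_def by simp
        then show False using nc[of x z t y] g lt e by (auto simp: insert_commute)
      next
        case False
        then have "h y < h z" using g Vzt unfolding S_def by auto
        then show False using nc[of x y z t] g lt e h(3)[of y] V by (auto simp: insert_commute)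
      qed
    qed
    fix z t assume e: "{x, z} \<in> E" "{y, z} \<in> E" "{x, t} \<in> E" "{y, t} \<in> E" "z \<in> S \<longleftrightarrow> t \<in> S"
    have "h z = h t" using key[OF e] key[OF e(3,4,1,2)] e(5) by (meson linorder_neqE_linordered_idom)
    then show "z = t" using h(1) edge_vertices[OF e(1)] edge_vertices[OF e(3)] by (auto simp: inj_on_def)
  qed (auto simp: S_def)
qed

lemma at_most_two_triangles:
  assumes "{x, y} \<in> E" "{x, z} \<in> E" "{y, z} \<in> E" "{x, t} \<in> E" "{y, t} \<in> E" "{x, w} \<in> E" "{y, w} \<in> E"
  shows "z = t \<or> z = w \<or> t = w"
  using common_neighbours_sides[OF assms(1)] assms by metis

lemma triangles_separated:
  assumes xy: "{x, y} \<in> E" and z: "{x, z} \<in> E" "{y, z} \<in> E" and t: "{x, t} \<in> E" "{y, t} \<in> E" and "z \<noteq> t"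
  obtains S where "t \<in> S" "z \<notin> S" "x \<notin> S" "y \<notin> S"
    "\<And>u v. {u, v} \<in> E \<Longrightarrow> u \<in> S \<Longrightarrow> v \<in> insert x (insert y S)"
proof -
  obtain S where S: "x \<notin> S" "y \<notin> S" "\<And>u v. {u, v} \<in> E \<Longrightarrow> u \<in> S \<Longrightarrow> v \<in> insert x (insert y S)"
    "\<And>z t. {x, z} \<in> E \<Longrightarrow> {y, z} \<in> E \<Longrightarrow> {x, t} \<in> E \<Longrightarrow> {y, t} \<in> E \<Longrightarrow> z \<in> S \<longleftrightarrow> t \<in> S \<Longrightarrow> z = t"
    using common_neighbours_sides[OF xy] by metis
  then have ne: "(z \<in> S) \<noteq> (t \<in> S)" using z t \<open>z \<noteq> t\<close> by blast
  show thesis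
  proof (cases "t \<in> S")
    case True
    then show thesis using that[of S] S(1,2,3) ne by blast
  next
    case False
    show thesis
    proof (rule that[of "- insert x (insert y S)"])
      show "t \<in> - insert x (insert y S)" using False edge_vertices[OF t(1)] edge_vertices[OF t(2)] by auto
      show "z \<notin> - insert x (insert y S)" using False ne by auto
      fix u v assume uv: "{u, v} \<in> E" "u \<in> - insert x (insert y S)"
      then show "v \<in> insert x (insert y (- insert x (insert y S)))"
        using S(3)[of v u] by (auto simp: insert_commute)
    qed auto
  qed
qed

text \<open>In an order starting at \<open>x\<close>, the first vertex outside \<open>X\<close> is
  adjacent to its predecessor, which is in \<open>X\<close>.\<close>

lemma connected_set:
  assumes X: "X \<subseteq> V" "x \<in> X" and closed: "\<And>u v. u \<in> X \<Longrightarrow> {u, v} \<in> E \<Longrightarrow> v \<in> X"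
  shows "X = V"
proof (rule ccontr)
  assume "X \<noteq> V"
  obtain h where h: "inj_on h V" "noncrossing h E" "\<And>v. v \<in> V \<Longrightarrow> v \<noteq> x \<Longrightarrow> h x < h v"
    using rotated_order[of x] X by blast
  have VX: "finite (V - X)" "V - X \<noteq> {}" using fin X \<open>X \<noteq> V\<close> by auto
  then obtain y where y: "y \<in> V - X" "\<And>v. v \<in> V - X \<Longrightarrow> h y \<le> h v"
    using finite_has_least_value[OF VX, of h] by metis
  let ?L = "{v \<in> V. h v < h y}"
  have "x \<in> ?L" using y X h(3)[of y] by auto
  then have L: "finite ?L" "?L \<noteq> {}" using fin by auto
  then obtain z where z: "z \<in> ?L" "\<And>v. v \<in> ?L \<Longrightarrow> - h z \<le> - h v"
    using finite_has_least_value[OF L, of "\<lambda>v. - h v"] by metis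
  have "{z, y} \<in> E"
  proof (rule uncrossed_is_edge[OF h(1,2)])
    fix a b assume "{a, b} \<in> E" "h z < h a" "h a < h y"
    then show "h z \<le> h b \<and> h b \<le> h y" using z(2)[of a] edge_vertices[of a b] by auto
  qed (use z y in auto)
  moreover have "z \<in> X" using z(1) y(2)[of z] by auto
  ultimately show False using closed y(1) by blast
qed

text \<open>Induction over the dual tree without constructing it: \<open>Q\<close> spreads around a
  vertex because its link is connected, and passes to a neighbouring vertex through a common
  triangle.\<close>

lemma dual_connected:
  assumes step: "\<And>x y z t. {x, y} \<in> E \<Longrightarrow> {x, z} \<in> E \<Longrightarrow> {y, z} \<in> E \<Longrightarrow> {x, t} \<in> E \<Longrightarrow> {y, t} \<in> E \<Longrightarrow>
      z \<noteq> t \<Longrightarrow> Q {x, y, z} \<Longrightarrow> Q {x, y, t}"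
    and init: "{a, b} \<in> E" "{a, c} \<in> E" "{b, c} \<in> E" "Q {a, b, c}"
    and uvw: "{u, v} \<in> E" "{u, w} \<in> E" "{v, w} \<in> E"
  shows "Q {u, v, w}"
proof -
  have star: "Q {p, x, y}" if pq: "{p, q} \<in> E" "{p, r} \<in> E" "{q, r} \<in> E" "Q {p, q, r}"
    and xy: "{p, x} \<in> E" "{p, y} \<in> E" "{x, y} \<in> E" for p q r x y
  proof -
    let ?X = "{x. {p, x} \<in> E \<and> (\<forall>y. {p, y} \<in> E \<longrightarrow> {x, y} \<in> E \<longrightarrow> Q {p, x, y})}"
    have "x \<in> ?X"
    proof (rule link_connected[of ?X p])
      have "Q {p, q, y}" if "{p, y} \<in> E" "{q, y} \<in> E" for y
        using step[of p q r y] pq that by (cases "y = r") auto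
      then show "?X \<noteq> {}" using pq by blast
      fix s t assume st: "s \<in> ?X" "{p, t} \<in> E" "{s, t} \<in> E"
      then have Q: "Q {p, t, s}" by (auto simp: insert_commute)
      have "Q {p, t, y}" if "{p, y} \<in> E" "{t, y} \<in> E" for y
        using step[of p t s y] st that Q by (cases "y = s") (auto simp: insert_commute)
      then show "t \<in> ?X" using st by blast
    qed (use xy in auto)
    then show ?thesis using xy by blast
  qed
  let ?Y = "{p \<in> V. \<forall>x y. {p, x} \<in> E \<longrightarrow> {p, y} \<in> E \<longrightarrow> {x, y} \<in> E \<longrightarrow> Q {p, x, y}}"
  have "?Y = V"
  proof (rule connected_set[of ?Y a])
    show "a \<in> ?Y" using star[OF init] edge_vertices[OF init(1)] by blast
    fix p q assume p: "p \<in> ?Y" and pq: "{p, q} \<in> E"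
    obtain r where r: "{p, r} \<in> E" "{q, r} \<in> E" using edge_in_triangle[OF pq] by blast
    have "Q {p, q, r}" using p pq r by blast
    then have Q: "Q {q, p, r}" by (metis insert_commute)
    have qp: "{q, p} \<in> E" using pq by (metis insert_commute)
    show "q \<in> ?Y" using star[OF qp r(2,1) Q] edge_vertices[OF pq] by blast
  qed auto
  then show ?thesis using uvw edge_vertices by blast
qed

end

section \<open>Zigzags as diagonal strips\<close>

text \<open>Two neighbouring diagonals cut off by layers. By parity each layer
  \<open>x + y = k\<close> contains exactly one of their points, so the layers list a zigzag in its
  natural order.\<close>

definition strip :: "int \<Rightarrow> int \<Rightarrow> int \<Rightarrow> point set" where
  "strip \<delta> s t = {(x, y). (y - x = \<delta> \<or> y - x = \<delta> + 1) \<and> s \<le> x + y \<and> x + y \<le> t}"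

lemma in_strip [simp]: "(x, y) \<in> strip \<delta> s t \<longleftrightarrow> (y - x = \<delta> \<or> y - x = \<delta> + 1) \<and> s \<le> x + y \<and> x + y \<le> t"
  by (simp add: strip_def)

lemma strip_pair:
  assumes "a = 0 \<or> a = 1"
  shows "strip (j - i - a) (i + j) (i + j+1) = {(i, j), (i+a, j+1 - a)}"
proof (rule set_eqI, clarify)
  fix x y
  show "(x, y) \<in> strip (j - i - a) (i + j) (i + j+1) \<longleftrightarrow> (x, y) \<in> {(i, j), (i+a, j+1 - a)}"
    unfolding in_strip insert_iff empty_iff prod.inject using assms by presburger
qed

text \<open>\<open>a\<close> is 0 for a vertical and 1 for a horizontal base line. The last layer
  has the same form for both values of \<open>s\<close>, since
  \<open>max (2 * r) (2 * s + 1) = r + s + 1\<close>.\<close>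

lemma zigzag_set:
  fixes a r s :: int
  assumes "a = 0 \<or> a = 1" "1 \<le> r" "s = r - 1 \<or> s = r"
  shows "{(i + k, j + k) | k. 0 \<le> k \<and> k \<le> r} \<union> {(i+a + k, j+1 - a + k) | k. 0 \<le> k \<and> k \<le> s} =
    strip (j - i - a) (i + j) (i + j + r + s + 1)" (is "?L = ?R")
proof (rule set_eqI, clarify)
  fix x y
  have "(x, y) \<in> ?L \<longleftrightarrow> (y - x = j - i \<and> i \<le> x \<and> x \<le> i + r) \<or>
      (y - x = j+1 - i-2 * a \<and> i+a \<le> x \<and> x \<le> i+a + s)"
    by (auto intro: exI[of _ "x - i"] exI[of _ "x - i - a"])
  also have "\<dots> \<longleftrightarrow> (x, y) \<in> ?R" using assms by auto
  finally show "(x, y) \<in> ?L \<longleftrightarrow> (x, y) \<in> ?R" .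
qed

text \<open>The parity of \<open>s - \<delta>\<close> decides whether the first two points form a
  vertical or a horizontal edge; \<open>s + 2 \<le> t\<close> expresses
  \<open>r \<ge> 1\<close>.\<close>

lemma zigzag_iff_strip:
  "vertical_zigzag n b Z \<or> horizontal_zigzag n b Z \<longleftrightarrow>
    (\<exists>\<delta> s t. b = strip \<delta> s (s + 1) \<and> s + 2 \<le> t \<and> strip \<delta> s t \<subseteq> vertices (strong_grid n) \<and>
      Z = induced_subgraph (strong_grid n) (strip \<delta> s t))" (is "?L \<longleftrightarrow> ?R")
proof
  have R: ?R if a: "a = 0 \<or> a = 1" and rs: "1 \<le> r" "s = r - 1 \<or> s = r" and "b = {(i, j), (i+a, j+1 - a)}"
    "W = {(i + k, j + k) | k. 0 \<le> k \<and> k \<le> r} \<union> {(i+a + k, j+1 - a + k) | k. 0 \<le> k \<and> k \<le> s}"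
    "W \<subseteq> vertices (strong_grid n)" "Z = induced_subgraph (strong_grid n) W" for a i j r s W
  proof -
    have "b = strip (j - i - a) (i + j) (i + j+1) \<and> i + j+2 \<le> i + j + r + s + 1 \<and>
        strip (j - i - a) (i + j) (i + j + r + s + 1) \<subseteq> vertices (strong_grid n) \<and>
        Z = induced_subgraph (strong_grid n) (strip (j - i - a) (i + j) (i + j + r + s + 1))"
      using that strip_pair[OF a] zigzag_set[OF a rs] by auto
    then show ?thesis by blast
  qed
  assume ?L
  then show ?R
  proof
    assume "vertical_zigzag n b Z"
    then show ?R unfolding vertical_zigzag_def
      by (elim exE conjE) (rule R[of 0], simp_all)
  next
    assume "horizontal_zigzag n b Z"
    then show ?R unfolding horizontal_zigzag_def
      by (elim exE conjE) (rule R[of 1], simp_all)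
  qed
next
  assume ?R
  then obtain \<delta> s t where *: "b = strip \<delta> s (s + 1)" "s + 2 \<le> t" "strip \<delta> s t \<subseteq> vertices (strong_grid n)"
    "Z = induced_subgraph (strong_grid n) (strip \<delta> s t)" by blast
  define r where "r = (t - s) div 2"
  have r: "1 \<le> r" "t - s - 1 - r = r - 1 \<or> t - s - 1 - r = r" using *(2) unfolding r_def by presburger+
  define a where "a = (s - \<delta>) mod 2"
  define i j where "i = (s - \<delta> - a) div 2" and "j = (s + \<delta> + a) div 2"
  have a: "a = 0 \<or> a = 1" unfolding a_def by presburger
  have ij: "j - i - a = \<delta>" "i + j = s" unfolding i_def j_def a_def by presburger+
  have b: "b = {(i, j), (i+a, j+1 - a)}" using *(1) ij strip_pair[OF a, of j i] by simp
  have W: "strip \<delta> s t = {(i + k, j + k) |k. 0 \<le> k \<and> k \<le> r} \<union>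
      {(i+a + k, j+1 - a + k) |k. 0 \<le> k \<and> k \<le> t - s - 1 - r}"
    unfolding zigzag_set[OF a r] using ij by (simp add: add.commute)
  have rs: "t - s - 1 - r \<in> {r - 1, r}" using r by auto
  from a show ?L
  proof
    assume "a = 0"
    then have "vertical_zigzag n b Z" unfolding vertical_zigzag_def
      using b W r(1) rs *(3,4)
      by (intro exI[of _ i] exI[of _ j] exI[of _ r] exI[of _ "t - s - 1 - r"] exI[of _ "strip \<delta> s t"]) simp
    then show ?thesis ..
  next
    assume "a = 1"
    then have "horizontal_zigzag n b Z" unfolding horizontal_zigzag_def
      using b W r(1) rs *(3,4)
      by (intro exI[of _ i] exI[of _ j] exI[of _ r] exI[of _ "t - s - 1 - r"] exI[of _ "strip \<delta> s t"]) simp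
    then show ?thesis ..
  qed
qed

section \<open>Triangulated polygons inside the grid\<close>

lemma strong_grid_edge:
  "{(x, y), (x', y')} \<in> edges (strong_grid n) \<longleftrightarrow>
    {x, y, x', y'} \<subseteq> {0..int n - 1} \<and> (x, y) \<noteq> (x', y') \<and> \<bar>x' - x\<bar> \<le> 1 \<and> \<bar>y' - y\<bar> \<le> 1" (is "?L \<longleftrightarrow> ?R")
proof
  assume ?L
  then obtain i j i' j' where *: "{(x, y), (x', y')} = {(i, j), (i', j')}" "{i, j, i', j'} \<subseteq> {0..int n - 1}"
    "(i, j) \<noteq> (i', j')" "\<bar>i' - i\<bar> \<le> 1" "\<bar>j' - j\<bar> \<le> 1" unfolding strong_grid_def snd_conv mem_Collect_eq by metis
  then show ?R by (auto simp: doubleton_eq_iff)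
qed (auto simp: strong_grid_def)

text \<open>Abstracts the image of a graph under the distances to a resolving pair, whose vertices
  go to the two corners. Of distances only three facts are kept: steps of at most one along edges,
  the triangle inequalities in \<open>region\<close>, and a neighbour one step nearer.\<close>

locale grid_triangulation = maximal_one_page V E for V :: "point set" and E :: "point set set" +
  fixes d :: int and n :: nat
  assumes d_pos: "1 \<le> d"
    and V_grid: "V \<subseteq> vertices (strong_grid n)" and E_grid: "E \<subseteq> edges (strong_grid n)"
    and corners: "(0, d) \<in> V" "(d, 0) \<in> V"
    and region: "(x, y) \<in> V \<Longrightarrow> d \<le> x + y \<and> \<bar>y - x\<bar> \<le> d"
    and descend_fst: "(x, y) \<in> V \<Longrightarrow> 0 < x \<Longrightarrow> \<exists>y'. {(x, y), (x-1, y')} \<in> E"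
    and descend_snd: "(x, y) \<in> V \<Longrightarrow> 0 < y \<Longrightarrow> \<exists>x'. {(x, y), (x', y-1)} \<in> E"
begin

lemma sym: "{u, v} \<in> E \<Longrightarrow> {v, u} \<in> E"
  by (simp add: insert_commute)

lemma edge_step:
  assumes "{(x, y), (x', y')} \<in> E"
  shows "\<bar>x' - x\<bar> \<le> 1" "\<bar>y' - y\<bar> \<le> 1" "(x, y) \<noteq> (x', y')"
    "d \<le> x + y" "\<bar>y - x\<bar> \<le> d" "d \<le> x' + y'" "\<bar>y' - x'\<bar> \<le> d"
proof -
  have "{(x, y), (x', y')} \<in> edges (strong_grid n)" using assms E_grid by blast
  then show "\<bar>x' - x\<bar> \<le> 1" "\<bar>y' - y\<bar> \<le> 1" "(x, y) \<noteq> (x', y')" unfolding strong_grid_edge by blast+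
  have "(x, y) \<in> V" "(x', y') \<in> V" using edge_vertices[OF assms] by auto
  then show "d \<le> x + y" "\<bar>y - x\<bar> \<le> d" "d \<le> x' + y'" "\<bar>y' - x'\<bar> \<le> d" using region by blast+
qed

text \<open>From a point of layer \<open>d\<close>, a step that lowers the first coordinate must
  raise the second to stay in the region. So the descent from \<open>(d, 0)\<close> is forced along
  the layer.\<close>

lemma base_path:
  assumes "x + y = d" "0 \<le> x" "0 \<le> y"
  shows "(x, y) \<in> V" and "0 < x \<Longrightarrow> {(x-1, y+1), (x, y)} \<in> E"
proof -
  have step: "{(x-1, y+1), (x, y)} \<in> E" if xy: "(x, y) \<in> V" "x + y = d" "0 < x" for x y
  proof -
    obtain y' where y': "{(x, y), (x-1, y')} \<in> E" using descend_fst[OF xy(1,3)] by blast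
    then have "y' = y+1" using edge_step[OF y'] xy by linarith
    then show ?thesis using y' by (simp add: insert_commute)
  qed
  have "\<forall>x y. x + y = d \<longrightarrow> 0 \<le> x \<longrightarrow> y = int k \<longrightarrow> (x, y) \<in> V" for k
  proof (induction k)
    case 0
    then show ?case using corners by auto
  next
    case (Suc k)
    show ?case
    proof (intro allI impI)
      fix x y :: int assume xy: "x + y = d" "0 \<le> x" "y = int (Suc k)"
      then have "(x+1, y-1) \<in> V" using Suc by auto
      then have "{(x, y), (x+1, y-1)} \<in> E" using step[of "x+1" "y-1"] xy by (simp add: add.commute)
      then show "(x, y) \<in> V" using edge_vertices by blast
    qed
  qed
  from this[of "nat y"] show V: "(x, y) \<in> V" using assms by auto
  show "{(x-1, y+1), (x, y)} \<in> E" if "0 < x" using step V assms that by blast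
qed

text \<open>The edge lies in some triangle, and the other common grid neighbour of its ends is in
  layer \<open>d - 1\<close>, outside the region.\<close>

lemma base_triangle:
  assumes "x + y = d" "0 \<le> x" "1 \<le> y"
  shows "{(x, y), (x+1, y-1)} \<in> E" "{(x, y), (x+1, y)} \<in> E" "{(x+1, y-1), (x+1, y)} \<in> E"
proof -
  show e: "{(x, y), (x+1, y-1)} \<in> E" using base_path(2)[of "x+1" "y-1"] assms by auto
  obtain z where z: "{(x, y), z} \<in> E" "{(x+1, y-1), z} \<in> E" using edge_in_triangle[OF e] by blast
  obtain z1 z2 where zz: "z = (z1, z2)" by (cases z)
  have "z1 = x+1 \<and> z2 = y"
    using edge_step[OF z(1)[unfolded zz]] edge_step[OF z(2)[unfolded zz]] assms by auto
  then show "{(x, y), (x+1, y)} \<in> E" "{(x+1, y-1), (x+1, y)} \<in> E" using z zz by auto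
qed

lemma square_sides:
  assumes "i + j = d" "1 \<le> i" "1 \<le> j"
  shows "{(i, j), (i, j+1)} \<in> E" "{(i, j), (i+1, j)} \<in> E"
    "{(i-1, j+1), (i, j)} \<in> E" "{(i-1, j+1), (i, j+1)} \<in> E"
    "{(i, j), (i+1, j-1)} \<in> E" "{(i+1, j-1), (i+1, j)} \<in> E"
proof -
  have *: "i-1 + (j+1) = d" "0 \<le> i-1" "1 \<le> j+1" "0 \<le> i" using assms by auto
  show "{(i, j), (i, j+1)} \<in> E" "{(i-1, j+1), (i, j)} \<in> E" "{(i-1, j+1), (i, j+1)} \<in> E"
    using base_triangle[OF *(1-3)] by simp_all
  show "{(i, j), (i+1, j)} \<in> E" "{(i, j), (i+1, j-1)} \<in> E" "{(i+1, j-1), (i+1, j)} \<in> E"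
    using base_triangle[OF assms(1) *(4) assms(3)] by simp_all
qed

lemma layer_neighbours:
  assumes "i + j = d" "{(i, j), w} \<in> E"
  shows "w \<in> {(i-1, j+1), (i, j+1), (i+1, j+1), (i+1, j), (i+1, j-1)}"
proof -
  obtain w1 w2 where w: "w = (w1, w2)" by (cases w)
  have "w1 \<le> i+1" "i \<le> w1 + 1" "w2 \<le> j+1" "j \<le> w2 + 1" "i + j \<le> w1 + w2" "\<not> (w1 = i \<and> w2 = j)"
    using edge_step[OF assms(2)[unfolded w]] assms(1) by auto
  then show ?thesis unfolding w insert_iff empty_iff prod.inject by presburger
qed

text \<open>The link of \<open>(i, j)\<close> is connected and contains \<open>(i-1, j+1)\<close>,
  \<open>(i, j+1)\<close> and \<open>(i+1, j)\<close>. Without the antidiagonal only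
  \<open>(i+1, j+1)\<close> can connect the first two to the third.\<close>

lemma square_filled:
  assumes ij: "i + j = d" "1 \<le> i" "1 \<le> j" and no: "{(i, j+1), (i+1, j)} \<notin> E"
  shows "{(i, j), (i+1, j+1)} \<in> E" "{(i, j+1), (i+1, j+1)} \<in> E" "{(i+1, j), (i+1, j+1)} \<in> E"
proof -
  let ?c = "(i, j)" and ?p = "(i, j+1)" and ?q = "(i+1, j)" and ?r = "(i+1, j+1)" and ?a = "(i-1, j+1)"
  note s = square_sides[OF ij]
  have "{?c, ?r} \<in> E \<and> {?p, ?r} \<in> E \<and> {?q, ?r} \<in> E"
  proof (rule ccontr)
    assume contra: "\<not> ({?c, ?r} \<in> E \<and> {?p, ?r} \<in> E \<and> {?q, ?r} \<in> E)"
    let ?X = "{?a, ?p} \<union> (if {?c, ?r} \<in> E \<and> {?p, ?r} \<in> E then {?r} else {})"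
    have "?q \<in> ?X"
    proof (rule link_connected[of ?X ?c])
      show "?X \<subseteq> {y. {?c, y} \<in> E}" using s sym by auto
      fix x y assume x: "x \<in> ?X" and y: "{?c, y} \<in> E" "{x, y} \<in> E"
      have yc: "y \<in> {?a, ?p, ?r, ?q, (i+1, j-1)}" using layer_neighbours[OF ij(1) y(1)] by blast
      obtain y1 y2 where yy: "y = (y1, y2)" by (cases y)
      consider "x = ?a" | "x = ?p" | "x = ?r" "{?c, ?r} \<in> E" "{?p, ?r} \<in> E" using x by (auto split: if_splits)
      then show "y \<in> ?X"
      proof cases
        case 1
        then have "y = ?p" using yc edge_step[of "i-1" "j+1" y1 y2] y(2) yy by auto
        then show ?thesis by simp
      next
        case 2
        then have "y = ?a \<or> y = ?r \<or> y = ?q" using yc edge_step[of i "j+1" y1 y2] y(2) yy by auto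
        moreover have "y \<noteq> ?q" using no y(2) 2 by auto
        ultimately show ?thesis using y 2 by auto
      next
        case 3
        then have "y = ?p \<or> y = ?q" using yc edge_step[of "i+1" "j+1" y1 y2] y(2) yy by auto
        moreover have "y \<noteq> ?q" using contra y(2) 3 sym by blast
        ultimately show ?thesis by auto
      qed
    qed (use s in auto)
    then show False by (auto split: if_splits)
  qed
  then show "{?c, ?r} \<in> E" "{?p, ?r} \<in> E" "{?q, ?r} \<in> E" by auto
qed

text \<open>Otherwise the edge from \<open>(i, j)\<close> up or to the right would lie in three
  triangles, one of them already at layer \<open>d\<close>.\<close>

lemma no_both_diagonals:
  assumes ij: "i + j = d" "1 \<le> i" "1 \<le> j" and cr: "{(i, j), (i+1, j+1)} \<in> E"
    and side: "{(i, j+1), (i+1, j+1)} \<in> E \<or> {(i+1, j), (i+1, j+1)} \<in> E"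
  shows "{(i, j+1), (i+1, j)} \<notin> E"
proof
  let ?r = "(i+1, j+1)" and ?p = "(i, j+1)" and ?q = "(i+1, j)"
  assume pq: "{?p, ?q} \<in> E"
  note s = square_sides[OF ij]
  from side show False
  proof
    assume "{?p, ?r} \<in> E"
    then show False
      using at_most_two_triangles[OF s(1) _ _ s(2) pq cr, of "(i-1, j+1)"] s sym by auto
  next
    assume "{?q, ?r} \<in> E"
    then show False
      using at_most_two_triangles[OF s(2) _ _ s(1) sym[OF pq] cr, of "(i+1, j-1)"] s sym by auto
  qed
qed

text \<open>The place of a third vertex beyond the edge as seen from both corners: in each
  coordinate one step farther than the nearer end.\<close>

definition outward :: "point \<Rightarrow> point \<Rightarrow> point" where
  "outward x y = (min (fst x) (fst y) + 1, min (snd x) (snd y) + 1)"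

text \<open>A shortest path from \<open>t\<close> to either corner must leave \<open>S\<close> through \<open>x\<close> or \<open>y\<close>.\<close>

lemma separated_third_vertex:
  assumes S: "t \<in> S" "\<And>u v. {u, v} \<in> E \<Longrightarrow> u \<in> S \<Longrightarrow> v \<in> insert x (insert y S)"
    and corner: "(0, d) \<notin> S" "(d, 0) \<notin> S" and t: "{x, t} \<in> E" "{y, t} \<in> E"
  shows "t = outward x y"
proof -
  \<comment> \<open>Stated for an arbitrary \<open>\<pi>\<close> to serve both coordinates.
    Descending from a vertex of \<open>S\<close> must end in \<open>x\<close> or \<open>y\<close>,
    because a coordinate vanishes only at a corner, outside \<open>S\<close>.\<close>
  have far: "min (\<pi> x) (\<pi> y) + 1 \<le> \<pi> v"
    if "v \<in> S" "v \<in> V" "0 \<le> \<pi> v" and zero: "\<And>v. v \<in> V \<Longrightarrow> \<pi> v = 0 \<Longrightarrow> v \<notin> S"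
      and descend: "\<And>v. v \<in> V \<Longrightarrow> 0 < \<pi> v \<Longrightarrow> \<exists>w. {v, w} \<in> E \<and> \<pi> w = \<pi> v - 1"
    for v and \<pi> :: "point \<Rightarrow> int"
    using that(1-3)
  proof (induction "nat (\<pi> v)" arbitrary: v)
    case 0
    then show ?case using zero[of v] by simp
  next
    case (Suc k)
    then have "0 < \<pi> v" by simp
    then obtain w where w: "{v, w} \<in> E" "\<pi> w = \<pi> v - 1" using descend[OF Suc.prems(2)] by blast
    then have "w \<in> insert x (insert y S)" "w \<in> V" using S(2) Suc.prems edge_vertices by blast+
    moreover have "min (\<pi> x) (\<pi> y) + 1 \<le> \<pi> w" if "w \<in> S"
      using Suc.hyps(1)[of w] Suc.hyps(2) that \<open>w \<in> V\<close> w(2) by simp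
    ultimately show ?case using w(2) by fastforce
  qed
  have zero: "v \<notin> S" if "v \<in> V" "fst v = 0 \<or> snd v = 0" for v
  proof -
    have "v = (0, d) \<or> v = (d, 0)" using region[of "fst v" "snd v"] that by (auto simp: prod_eq_iff)
    then show ?thesis using corner by auto
  qed
  obtain t1 t2 x1 x2 y1 y2 where c: "t = (t1, t2)" "x = (x1, x2)" "y = (y1, y2)" by (metis surj_pair)
  have tV: "t \<in> V" using t edge_vertices by blast
  then have nn: "0 \<le> t1" "0 \<le> t2" using region[of t1 t2] c by auto
  have "min (fst x) (fst y) + 1 \<le> fst t"
  proof (rule far[OF S(1) tV])
    show "\<exists>w. {v, w} \<in> E \<and> fst w = fst v - 1" if "v \<in> V" "0 < fst v" for v
      using descend_fst[of "fst v" "snd v"] that by auto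
  qed (use zero nn c in auto)
  moreover have "min (snd x) (snd y) + 1 \<le> snd t"
  proof (rule far[OF S(1) tV])
    show "\<exists>w. {v, w} \<in> E \<and> snd w = snd v - 1" if "v \<in> V" "0 < snd v" for v
      using descend_snd[of "fst v" "snd v"] that by auto
  qed (use zero nn c in auto)
  \<comment> \<open>The upper bounds hold because \<open>t\<close> is within one grid step of both
    ends.\<close>
  ultimately have "t1 = min x1 y1 + 1" "t2 = min x2 y2 + 1"
    using edge_step(1,2)[OF t(1)[unfolded c]] edge_step(1,2)[OF t(2)[unfolded c]] c by simp_all
  then show ?thesis using c unfolding outward_def by simp
qed

text \<open>The path along layer \<open>d\<close> avoids \<open>x\<close> and \<open>y\<close>, so
  it lies on one side of the edge; the triangle on the other side is separated from both
  corners.\<close>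

lemma one_triangle_outward:
  assumes xy: "{x, y} \<in> E" and z: "{x, z} \<in> E" "{y, z} \<in> E" and t: "{x, t} \<in> E" "{y, t} \<in> E" and "z \<noteq> t"
    and far: "x \<notin> layer d" "y \<notin> layer d"
  shows "z = outward x y \<or> t = outward x y"
proof -
  obtain S where S: "t \<in> S" "z \<notin> S" "x \<notin> S" "y \<notin> S"
    "\<And>u v. {u, v} \<in> E \<Longrightarrow> u \<in> S \<Longrightarrow> v \<in> insert x (insert y S)"
    using triangles_separated[OF xy z t \<open>z \<noteq> t\<close>] by blast
  have one: "(0, d) \<in> S \<longleftrightarrow> (int k, d - int k) \<in> S" if "int k \<le> d" for k
    using that
  proof (induction k)
    case (Suc k)
    have e: "{(int k, d - int k), (int (Suc k), d - int (Suc k))} \<in> E"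
      using base_path(2)[of "int (Suc k)" "d - int (Suc k)"] Suc.prems by auto
    have "(int k, d - int k) \<notin> {x, y}" "(int (Suc k), d - int (Suc k)) \<notin> {x, y}"
      using far by (auto simp: layer_def)
    then show ?case using S(5)[OF e] S(5)[OF sym[OF e]] Suc by auto
  qed simp
  have same: "(0, d) \<in> S \<longleftrightarrow> (d, 0) \<in> S" using one[of "nat d"] d_pos by auto
  show ?thesis
  proof (cases "(0, d) \<in> S")
    case False
    have "t = outward x y"
      by (rule separated_third_vertex[of t S]) (use False same t S in auto)
    then show ?thesis by blast
  next
    case True
    let ?S = "- insert x (insert y S)"
    have "z = outward x y"
    proof (rule separated_third_vertex[of z ?S])
      show "z \<in> ?S" using S(2) edge_vertices[OF z(1)] edge_vertices[OF z(2)] by auto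
      show "v \<in> insert x (insert y ?S)" if "{u, v} \<in> E" "u \<in> ?S" for u v
        using S(5)[OF sym[OF that(1)]] that(2) by auto
    qed (use True same z in auto)
    then show ?thesis by blast
  qed
qed

end

lemma third_vertex_of_triangle:
  assumes "T \<in> triangles_at H {p, q}" "p \<noteq> q"
  obtains z where "T = {p, q, z}" "{p, z} \<in> edges H" "{q, z} \<in> edges H" "z \<noteq> p" "z \<noteq> q"
proof -
  have T: "card T = 3" "{p, q} \<subseteq> T" "\<And>u v. u \<in> T \<Longrightarrow> v \<in> T \<Longrightarrow> u \<noteq> v \<Longrightarrow> {u, v} \<in> edges H"
    using assms(1) unfolding triangles_at_def by auto
  have "card (T - {p, q}) = 1" using T assms(2) by (subst card_Diff_subset) auto
  then obtain z where z: "T - {p, q} = {z}" by (rule card_1_singletonE)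
  then have "T = {p, q, z}" using T(2) by blast
  moreover have "z \<noteq> p" "z \<noteq> q" using z by auto
  ultimately show thesis using that T(3)[of p z] T(3)[of q z] by auto
qed

section \<open>Verification of the first three conditions\<close>

context grid_triangulation
begin

abbreviation described :: "point set set" where
  "described \<equiv> described_edges n (V, E) d"

abbreviation bases :: "point set set" where
  "bases \<equiv> base_lines n (V, E) d"

lemma triangle_in_triangles_at:
  assumes "{x, y} \<in> E" "{x, z} \<in> E" "{y, z} \<in> E"
  shows "{x, y, z} \<in> triangles_at (V, E) {x, y}"
proof -
  have "x \<noteq> y" "x \<noteq> z" "y \<noteq> z" "{x, y, z} \<subseteq> V" using assms edge_vertices by blast+
  then show ?thesis using assms unfolding triangles_at_def by (auto simp: insert_commute)
qed

lemma V_grid_region: "V \<subseteq> grid_region n d"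
proof
  fix v assume v: "v \<in> V"
  obtain x y where "v = (x, y)" by (cases v)
  then show "v \<in> grid_region n d" unfolding grid_region_def using v V_grid region[of x y] by blast
qed

lemma holds_condition1: "condition1 n (V, E) d"
  unfolding condition1_def
proof (intro conjI)
  show "vertices (V, E) \<subseteq> grid_region n d" using V_grid_region by simp
  show "vertices1 n d \<subseteq> vertices (V, E)"
    unfolding vertices1_def layer_def grid_region_def strong_grid_def using base_path(1) by auto
  show "edges1 d \<subseteq> edges (V, E)"
    unfolding edges1_def using base_triangle(1) by auto
qed

lemma second_layer:
  assumes "(i, j) \<in> layer (d + 1) \<inter> grid_region n d"
  shows "(i, j) \<in> V" "{(i, j), (i-1, j)} \<in> E" "{(i, j), (i, j-1)} \<in> E"
proof -
  have "i + j = d + 1" "\<bar>j - i\<bar> \<le> d" using assms unfolding layer_def grid_region_def by auto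
  then have *: "i-1 + j = d" "0 \<le> i-1" "1 \<le> j" by linarith+
  show "{(i, j), (i-1, j)} \<in> E" "{(i, j), (i, j-1)} \<in> E"
    using base_triangle(2,3)[OF *] by (auto simp: insert_commute)
  then show "(i, j) \<in> V" using edge_vertices by blast
qed

lemma holds_condition2: "condition2 n (V, E) d"
  unfolding condition2_def
proof (intro conjI)
  show "vertices2 n d \<subseteq> vertices (V, E)" unfolding vertices2_def using second_layer(1) by auto
  show "edges2 n d \<subseteq> edges (V, E)" unfolding edges2_def using second_layer(2,3) by auto
qed

lemma antidiagonal_third:
  assumes "i + j = d" "{(i, j+1), z} \<in> E" "{(i+1, j), z} \<in> E"
  shows "z = (i, j) \<or> z = (i+1, j+1)"
proof -
  obtain z1 z2 where z: "z = (z1, z2)" by (cases z)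
  show ?thesis using edge_step[OF assms(2)[unfolded z]] edge_step[OF assms(3)[unfolded z]] assms(1) z by auto
qed

text \<open>The triangle with \<open>(i, j)\<close> is always present, and \<open>(i+1, j+1)\<close>
  is the only other candidate for a third vertex.\<close>

lemma antidiagonal_two_triangles:
  assumes ij: "i + j = d" "1 \<le> i" "1 \<le> j" and pq: "{(i, j+1), (i+1, j)} \<in> E"
  shows "in_two_triangles (V, E) (antidiagonal i j) \<longleftrightarrow>
    {(i, j+1), (i+1, j+1)} \<in> E \<and> {(i+1, j), (i+1, j+1)} \<in> E"
proof
  assume "in_two_triangles (V, E) (antidiagonal i j)"
  then obtain T T' where T: "T \<in> triangles_at (V, E) {(i, j+1), (i+1, j)}"
    "T' \<in> triangles_at (V, E) {(i, j+1), (i+1, j)}" "T \<noteq> T'"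
    unfolding in_two_triangles_def antidiagonal_def by blast
  have pq': "(i, j+1) \<noteq> (i+1, j)" by simp
  obtain z where z: "T = {(i, j+1), (i+1, j), z}" "{(i, j+1), z} \<in> E" "{(i+1, j), z} \<in> E"
    using third_vertex_of_triangle[OF T(1) pq'] unfolding snd_conv by metis
  obtain z' where z': "T' = {(i, j+1), (i+1, j), z'}" "{(i, j+1), z'} \<in> E" "{(i+1, j), z'} \<in> E"
    using third_vertex_of_triangle[OF T(2) pq'] unfolding snd_conv by metis
  have "z \<noteq> z'" using T(3) z z' by auto
  then have "z = (i+1, j+1) \<or> z' = (i+1, j+1)"
    using antidiagonal_third[OF ij(1) z(2,3)] antidiagonal_third[OF ij(1) z'(2,3)] by auto
  then show "{(i, j+1), (i+1, j+1)} \<in> E \<and> {(i+1, j), (i+1, j+1)} \<in> E" using z z' by auto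
next
  let ?p = "(i, j+1)" and ?q = "(i+1, j)"
  assume *: "{?p, (i+1, j+1)} \<in> E \<and> {?q, (i+1, j+1)} \<in> E"
  have c: "{?p, ?q, (i, j)} \<in> triangles_at (V, E) {?p, ?q}"
    using square_sides(1,2)[OF ij] sym pq by (intro triangle_in_triangles_at) auto
  have r: "{?p, ?q, (i+1, j+1)} \<in> triangles_at (V, E) {?p, ?q}"
    using * pq by (intro triangle_in_triangles_at) auto
  have "(i, j) \<in> {?p, ?q, (i, j)}" "(i, j) \<notin> {?p, ?q, (i+1, j+1)}" by auto
  then have "{?p, ?q, (i, j)} \<noteq> {?p, ?q, (i+1, j+1)}" by metis
  then show "in_two_triangles (V, E) (antidiagonal i j)"
    unfolding in_two_triangles_def antidiagonal_def using c r by (metis (no_types, lifting))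
qed

lemma holds_condition3: "condition3 (V, E) d"
  unfolding condition3_def
proof (intro allI impI)
  fix i j assume "1 \<le> i \<and> 1 \<le> j \<and> {(i, j+1), (i+1, j)} \<subseteq> layer (d + 1)"
  then have ij: "i + j = d" "1 \<le> i" "1 \<le> j" by (auto simp: layer_def)
  show "(antidiagonal i j \<in> edges (V, E) \<or> insert (diagonal i j) (corner_edges i j) \<subseteq> edges (V, E)) \<and>
     (antidiagonal i j \<in> edges (V, E) \<and> in_two_triangles (V, E) (antidiagonal i j) \<longrightarrow>
        (i+1, j+1) \<in> vertices (V, E) \<and> corner_edges i j \<subseteq> edges (V, E))"
  proof (intro conjI impI)
    show "antidiagonal i j \<in> edges (V, E) \<or> insert (diagonal i j) (corner_edges i j) \<subseteq> edges (V, E)"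
      using square_filled[OF ij] unfolding antidiagonal_def diagonal_def corner_edges_def by auto
    assume "antidiagonal i j \<in> edges (V, E) \<and> in_two_triangles (V, E) (antidiagonal i j)"
    then have "{(i, j+1), (i+1, j+1)} \<in> E \<and> {(i+1, j), (i+1, j+1)} \<in> E"
      using antidiagonal_two_triangles[OF ij] by (auto simp: antidiagonal_def)
    then show "(i+1, j+1) \<in> vertices (V, E)" "corner_edges i j \<subseteq> edges (V, E)"
      using edge_vertices unfolding corner_edges_def by auto
  qed
qed

lemma square_described:
  assumes ij: "i + j = d" "1 \<le> i" "1 \<le> j"
  shows "square_edges (V, E) i j \<subseteq> described"
proof -
  have "{(i, j+1), (i+1, j)} \<subseteq> layer (d + 1)" using ij by (auto simp: layer_def)
  then have "square_edges (V, E) i j \<subseteq> edges3 (V, E) d" unfolding edges3_def using ij by blast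
  then show ?thesis unfolding described_edges_def by blast
qed

lemma antidiagonal_described:
  assumes ij: "i + j = d" "1 \<le> i" "1 \<le> j" and "{(i, j+1), (i+1, j)} \<in> E"
  shows "{(i, j+1), (i+1, j)} \<in> described"
proof -
  have "{(i, j+1), (i+1, j)} \<in> square_edges (V, E) i j"
    unfolding square_edges_def antidiagonal_def using assms(4) by simp
  then show ?thesis using square_described[OF ij] by (rule rev_subsetD)
qed

text \<open>What \<open>square_edges\<close> lists depends on the antidiagonal;
  \<open>no_both_diagonals\<close> settles the squares in which the diagonal is present too.\<close>

lemma corner_described:
  assumes ij: "i + j = d" "1 \<le> i" "1 \<le> j"
    and "{(i, j), (i+1, j+1)} \<in> E \<and> ({(i, j+1), (i+1, j+1)} \<in> E \<or> {(i+1, j), (i+1, j+1)} \<in> E) \<or>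
      {(i, j+1), (i+1, j)} \<in> E \<and> {(i, j+1), (i+1, j+1)} \<in> E \<and> {(i+1, j), (i+1, j+1)} \<in> E"
  shows "{(i, j+1), (i+1, j+1)} \<in> described"
    "{(i+1, j), (i+1, j+1)} \<in> described"
    "{(i, j), (i+1, j+1)} \<in> E \<Longrightarrow> {(i, j), (i+1, j+1)} \<in> described"
proof -
  let ?r = "(i+1, j+1)" and ?p = "(i, j+1)" and ?q = "(i+1, j)" and ?c = "(i, j)"
  have "{{?p, ?r}, {?q, ?r}} \<subseteq> square_edges (V, E) i j \<and>
    ({?c, ?r} \<in> E \<longrightarrow> {?c, ?r} \<in> square_edges (V, E) i j)"
  proof (cases "{?p, ?q} \<in> E")
    case True
    then have e: "{?p, ?r} \<in> E" "{?q, ?r} \<in> E"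
      and no: "{?c, ?r} \<notin> E"
      using assms(4) no_both_diagonals[OF ij] by blast+
    then show ?thesis
      using antidiagonal_two_triangles[OF ij True] True
      unfolding square_edges_def corner_edges_def by (simp add: antidiagonal_def)
  next
    case False
    then show ?thesis unfolding square_edges_def corner_edges_def diagonal_def antidiagonal_def by simp
  qed
  then show "{?p, ?r} \<in> described"
    "{?q, ?r} \<in> described"
    "{?c, ?r} \<in> E \<Longrightarrow> {?c, ?r} \<in> described"
    using square_described[OF ij] by auto
qed

lemma base_triangle_described:
  assumes "x + y = d" "0 \<le> x" "1 \<le> y"
  shows "{(x, y), (x+1, y-1)} \<in> described"
    "{(x, y), (x+1, y)} \<in> described"
    "{(x+1, y-1), (x+1, y)} \<in> described"
proof -
  have "{(x, y), (x+1, y-1)} \<in> edges1 d"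
    unfolding edges1_def mem_Collect_eq by (rule exI[of _ x], rule exI[of _ y]) (use assms in auto)
  then show "{(x, y), (x+1, y-1)} \<in> described"
    unfolding described_edges_def by blast
  have "(x+1, y) \<in> layer (d + 1) \<inter> grid_region n d"
    using base_triangle(2)[OF assms] edge_vertices V_grid_region assms by (auto simp: layer_def)
  then have "{{(x+1, y), (x+1 - 1, y)}, {(x+1, y), (x+1, y-1)}} \<subseteq> edges2 n d"
    unfolding edges2_def by blast
  then show "{(x, y), (x+1, y)} \<in> described"
    "{(x+1, y-1), (x+1, y)} \<in> described"
    unfolding described_edges_def by (auto simp: insert_commute)
qed

lemma described_base_line:
  assumes "{p, q} \<in> described" "p \<in> layer (d + 1)" "q \<in> layer (d + 2)"
  shows "{p, q} \<in> bases"
  unfolding base_lines_def Un_iff mem_Collect_eq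
  by (rule disjI2, rule exI[of _ p], rule exI[of _ q]) (use assms in simp)

text \<open>Of the described edges only the corner edges of squares join layers \<open>d + 1\<close>
  and \<open>d + 2\<close>: antidiagonals stay in layer \<open>d + 1\<close>, and diagonals start in
  layer \<open>d\<close>.\<close>

lemma base_line_cases:
  assumes "b \<in> bases"
  obtains "b = {(0, d), (1, d)}" | "b = {(d, 0), (d, 1)}"
  | i j where "i + j = d" "1 \<le> i" "1 \<le> j" "{(i, j+1), (i+1, j+1)} \<in> E" "{(i+1, j), (i+1, j+1)} \<in> E"
      "{(i, j+1), (i+1, j)} \<in> E \<or> {(i, j), (i+1, j+1)} \<in> E"
      "b = {(i, j+1), (i+1, j+1)} \<or> b = {(i+1, j), (i+1, j+1)}"
proof -
  consider "b = {(0, d), (1, d)}" | "b = {(d, 0), (d, 1)}"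
    | p q where "b = {p, q}" "{p, q} \<in> described" "p \<in> layer (d + 1)" "q \<in> layer (d + 2)"
    using assms unfolding base_lines_def by blast
  then show thesis
  proof cases
    case 3
    have "{p, q} \<notin> edges1 d" using 3 unfolding edges1_def layer_def by (auto simp: doubleton_eq_iff)
    moreover have "{p, q} \<notin> edges2 n d" using 3 unfolding edges2_def layer_def by (auto simp: doubleton_eq_iff)
    ultimately obtain i j where ij: "1 \<le> i" "1 \<le> j" "i + j = d" and sq: "{p, q} \<in> square_edges (V, E) i j"
      using 3(2) unfolding described_edges_def edges3_def layer_def by auto
    have ad: "{p, q} \<noteq> antidiagonal i j" "{p, q} \<noteq> diagonal i j"
      using 3(3,4) ij unfolding antidiagonal_def diagonal_def layer_def by (auto simp: doubleton_eq_iff)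
    show thesis
    proof (cases "{(i, j+1), (i+1, j)} \<in> E")
      case True
      then have "in_two_triangles (V, E) (antidiagonal i j)" "{p, q} \<in> corner_edges i j"
        using sq ad unfolding square_edges_def by (auto simp: antidiagonal_def split: if_splits)
      then show thesis using that(3)[of i j] ij True antidiagonal_two_triangles[OF ij(3,1,2) True] 3(1)
        unfolding corner_edges_def by auto
    next
      case False
      then have "{p, q} \<in> corner_edges i j" using sq ad unfolding square_edges_def by (auto simp: antidiagonal_def)
      then show thesis using that(3)[of i j] ij square_filled[OF ij(3,1,2) False] 3(1)
        unfolding corner_edges_def by auto
    qed
  qed (use that in blast)+
qed

section \<open>Zigzags contained in the graph and their growth\<close>

definition full_strip :: "int \<Rightarrow> int \<Rightarrow> int \<Rightarrow> bool" where
  "full_strip \<delta> s t \<longleftrightarrow> strip \<delta> s t \<subseteq> V \<and>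
    (\<forall>u\<in>strip \<delta> s t. \<forall>v\<in>strip \<delta> s t. {u, v} \<in> edges (strong_grid n) \<longrightarrow> {u, v} \<in> E)"

lemma full_strip_zigzag:
  assumes "strip \<delta> s (s + 1) \<in> bases" "s + 2 \<le> t" "full_strip \<delta> s t"
  shows "induced_subgraph (strong_grid n) (strip \<delta> s t) \<in> zigzags n (V, E) d"
proof -
  have "subgraph (induced_subgraph (strong_grid n) (strip \<delta> s t)) (V, E)"
    unfolding subgraph_def induced_subgraph_def
  proof (intro conjI)
    show "edges (strip \<delta> s t, {e \<in> edges (strong_grid n). e \<subseteq> strip \<delta> s t}) \<subseteq> edges (V, E)"
    proof
      fix e assume e: "e \<in> edges (strip \<delta> s t, {e \<in> edges (strong_grid n). e \<subseteq> strip \<delta> s t})"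
      then obtain u v where "e = {u, v}" unfolding strong_grid_def by auto
      then show "e \<in> edges (V, E)" using e assms(3) unfolding full_strip_def by auto
    qed
  qed (use assms(3) in \<open>auto simp: full_strip_def\<close>)
  moreover have "strip \<delta> s t \<subseteq> vertices (strong_grid n)" using assms(3) V_grid unfolding full_strip_def by blast
  ultimately show ?thesis
    unfolding zigzags_def zigzag_iff_strip mem_Collect_eq using assms(1,2) by blast
qed

lemma zigzag_full_strip:
  assumes "Z \<in> zigzags n (V, E) d"
  obtains \<delta> s t where "strip \<delta> s (s + 1) \<in> bases" "s + 2 \<le> t" "full_strip \<delta> s t"
    "Z = induced_subgraph (strong_grid n) (strip \<delta> s t)"
proof -
  obtain b where b: "subgraph Z (V, E)" "b \<in> bases" "vertical_zigzag n b Z \<or> horizontal_zigzag n b Z"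
    using assms unfolding zigzags_def by blast
  then obtain \<delta> s t where *: "b = strip \<delta> s (s + 1)" "s + 2 \<le> t"
    "Z = induced_subgraph (strong_grid n) (strip \<delta> s t)" unfolding zigzag_iff_strip by blast
  moreover have "full_strip \<delta> s t"
    using b(1) * unfolding full_strip_def subgraph_def induced_subgraph_def by auto
  ultimately show thesis using that b(2) by blast
qed

lemma full_strip_base:
  assumes "strip \<delta> s (s + 1) = {u, v}" "{u, v} \<in> E"
  shows "full_strip \<delta> s (s + 1)"
  unfolding full_strip_def assms(1)
proof (intro conjI ballI impI)
  show "{u, v} \<subseteq> V" using edge_vertices[OF assms(2)] by simp
  fix x y assume xy: "x \<in> {u, v}" "y \<in> {u, v}" and e: "{x, y} \<in> edges (strong_grid n)"
  have "x \<noteq> y" using e strong_grid_edge[of "fst x" "snd x" "fst y" "snd y" n] by auto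
  then have "{x, y} = {u, v}" using xy by auto
  then show "{x, y} \<in> E" using assms(2) by simp
qed

text \<open>A grid step changes the layer by at most two, so the new point can only be adjacent to
  the last two points of the strip.\<close>

lemma full_strip_extend:
  assumes full: "full_strip \<delta> s t" and w: "w \<in> V" "w \<in> strip \<delta> (t + 1) (t + 1)" "s + 1 \<le> t"
    and nb: "\<And>u. u \<in> strip \<delta> (t - 1) t \<Longrightarrow> {u, w} \<in> E"
  shows "full_strip \<delta> s (t + 1)"
proof -
  obtain w1 w2 where ww: "w = (w1, w2)" by (cases w)
  have st: "strip \<delta> s (t + 1) = insert w (strip \<delta> s t)"
  proof (rule set_eqI, clarify)
    fix x y show "(x, y) \<in> strip \<delta> s (t + 1) \<longleftrightarrow> (x, y) \<in> insert w (strip \<delta> s t)"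
      using w ww by (auto; presburger)
  qed
  have new: "{u, w} \<in> E" if u: "u \<in> strip \<delta> s t" and e: "{u, w} \<in> edges (strong_grid n)" for u
  proof (rule nb)
    obtain u1 u2 where uu: "u = (u1, u2)" by (cases u)
    have "\<bar>w1 - u1\<bar> \<le> 1" "\<bar>w2 - u2\<bar> \<le> 1" using e strong_grid_edge unfolding uu ww by blast+
    then show "u \<in> strip \<delta> (t - 1) t" using u w(2) unfolding uu ww by auto
  qed
  have loop: "{w, w} \<notin> edges (strong_grid n)" unfolding ww strong_grid_edge by simp
  show ?thesis unfolding full_strip_def st
  proof (intro conjI ballI impI)
    show "insert w (strip \<delta> s t) \<subseteq> V" using w full unfolding full_strip_def by auto
    fix u v assume uv: "u \<in> insert w (strip \<delta> s t)" "v \<in> insert w (strip \<delta> s t)" and e: "{u, v} \<in> edges (strong_grid n)"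
    then consider "u = w" "v = w" | "u = w" "v \<in> strip \<delta> s t" | "v = w" "u \<in> strip \<delta> s t"
      | "u \<in> strip \<delta> s t" "v \<in> strip \<delta> s t" by blast
    then show "{u, v} \<in> E"
    proof cases
      case 2
      then show ?thesis using new[of v] e by (simp add: insert_commute)
    qed (use loop e new full in \<open>auto simp: full_strip_def\<close>)
  qed
qed

text \<open>The last two points span a vertical edge for \<open>a = 0\<close> and a horizontal one
  for \<open>a = 1\<close>; the next point of the strip is \<open>(X+1, Y+1)\<close> in both
  cases.\<close>

lemma full_strip_extend_edge:
  assumes a: "a = 0 \<or> a = 1" and "full_strip (Y - X - a) s (X + Y+1)" "s \<le> X + Y"
    "{(X, Y), (X+1, Y+1)} \<in> E" "{(X+a, Y+1 - a), (X+1, Y+1)} \<in> E"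
  shows "full_strip (Y - X - a) s (X + Y+2)"
proof -
  have "full_strip (Y - X - a) s (X + Y+1 + 1)"
    by (rule full_strip_extend[OF assms(2), of "(X+1, Y+1)"])
      (use assms strip_pair[OF a, of Y X] edge_vertices[OF assms(4)] in auto)
  then show ?thesis by (simp add: add.assoc)
qed

definition in_zigzag :: "point set \<Rightarrow> bool" where
  "in_zigzag T \<longleftrightarrow> (\<exists>\<delta> s t. strip \<delta> s (s + 1) \<in> bases \<and> s + 2 \<le> t \<and> full_strip \<delta> s t \<and>
    T \<subseteq> strip \<delta> s t)"

lemma zigzag_start:
  assumes a: "a = 0 \<or> a = 1" and "{(X, Y), (X+a, Y+1 - a)} \<in> bases"
    "{(X, Y), (X+a, Y+1 - a)} \<in> E" "{(X, Y), (X+1, Y+1)} \<in> E" "{(X+a, Y+1 - a), (X+1, Y+1)} \<in> E"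
  shows "full_strip (Y - X - a) (X + Y) (X + Y+2)" "in_zigzag {(X, Y), (X+a, Y+1 - a), (X+1, Y+1)}"
proof -
  have s: "strip (Y - X - a) (X + Y) (X + Y+1) = {(X, Y), (X+a, Y+1 - a)}" by (rule strip_pair[OF a])
  then show *: "full_strip (Y - X - a) (X + Y) (X + Y+2)"
    using full_strip_extend_edge[OF a full_strip_base] assms by auto
  show "in_zigzag {(X, Y), (X+a, Y+1 - a), (X+1, Y+1)}"
    unfolding in_zigzag_def using * s assms(2) a
    by (intro exI[of _ "Y - X - a"] exI[of _ "X + Y"] exI[of _ "X + Y+2"]) auto
qed

text \<open>The outward position of a diagonal edge is its own upper end, which no third vertex can
  occupy.\<close>

lemma diagonal_one_triangle:
  assumes "{(X, Y), (X+1, Y+1)} \<in> E" "{(X, Y), z} \<in> E" "{(X+1, Y+1), z} \<in> E"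
    "{(X, Y), t} \<in> E" "{(X+1, Y+1), t} \<in> E" "(X, Y) \<notin> layer d" "(X+1, Y+1) \<notin> layer d"
  shows "z = t"
proof (rule ccontr)
  assume "z \<noteq> t"
  then have "z = (X+1, Y+1) \<or> t = (X+1, Y+1)"
    using one_triangle_outward[OF assms(1-5) _ assms(6,7)] by (simp add: outward_def)
  then show False using assms edge_vertices by blast
qed

definition good :: "point set \<Rightarrow> bool" where
  "good T \<longleftrightarrow> T \<inter> layer d \<noteq> {} \<or>
    (\<exists>i j. 1 \<le> i \<and> 1 \<le> j \<and> i + j = d \<and> T = {(i, j+1), (i+1, j), (i+1, j+1)}) \<or> in_zigzag T"

text \<open>The two triangles at an edge joining consecutive points of the strip use the preceding
  and the following point, the latter possibly extending the zigzag by one layer. Only at the base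
  line does the step lead back to the square where the zigzag began.\<close>

lemma good_step_strip:
  assumes a: "a = 0 \<or> a = 1" and e: "e = (X+a, Y+1 - a)" and \<delta>: "\<delta> = Y - X - a"
    and full: "full_strip \<delta> s t0" and base: "strip \<delta> s (s + 1) \<in> bases"
    and lim: "s + 2 \<le> t0" "s \<le> X + Y" "X + Y+1 \<le> t0"
    and tri: "{(X, Y), e} \<in> E" "{(X, Y), z} \<in> E" "{e, z} \<in> E" "{(X, Y), t} \<in> E" "{e, t} \<in> E" "z \<noteq> t"
    and z: "z \<in> strip \<delta> s t0" and far: "(X, Y) \<notin> layer d" "e \<notin> layer d" "t \<notin> layer d"
  shows "good {(X, Y), e, t}"
proof -
  let ?low = "(X+a-1, Y - a)" and ?top = "(X+1, Y+1)"
  have top: "outward (X, Y) e = ?top" using a unfolding e outward_def by auto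
  have out: "z = ?top \<or> t = ?top"
    using one_triangle_outward[OF tri far(1,2)] unfolding top .
  have inz: "good {(X, Y), e, t}" if "full_strip \<delta> s u" "t \<in> strip \<delta> s u" "t0 \<le> u" for u
  proof -
    have "{(X, Y), e, t} \<subseteq> strip \<delta> s u" using a lim that unfolding e \<delta> by auto
    then have "in_zigzag {(X, Y), e, t}" unfolding in_zigzag_def using that base lim
      by (intro exI[of _ \<delta>] exI[of _ s] exI[of _ u]) auto
    then show ?thesis unfolding good_def by blast
  qed
  obtain z1 z2 where zz: "z = (z1, z2)" by (cases z)
  have "z1 \<le> X+1" "X \<le> z1 + 1" "z2 \<le> Y+1" "Y \<le> z2 + 1" "\<not> (z1 = X \<and> z2 = Y)"
    using edge_step(1-3)[OF tri(2)[unfolded zz]] by auto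
  moreover have "z1 \<le> X+a + 1" "X+a \<le> z1 + 1" "z2 \<le> Y+2 - a" "Y - a \<le> z2" "\<not> (z1 = X+a \<and> z2 = Y+1 - a)"
    using edge_step(1-3)[OF tri(3)[unfolded zz e]] by auto
  moreover have "z2 - z1 = Y - X - a \<or> z2 - z1 = Y - X - a + 1" using z unfolding zz \<delta> by simp
  ultimately have "z = ?top \<or> z = ?low" using a unfolding zz prod.inject by presburger
  then show ?thesis
  proof
    assume "z = ?low"
    then have t: "t = ?top" using out a by auto
    show ?thesis
    proof (cases "X + Y+2 \<le> t0")
      case True
      then have "t \<in> strip \<delta> s t0" using lim a unfolding t \<delta> by auto
      then show ?thesis using inz[OF full] by simp
    next
      case False
      then have "t0 = X + Y+1" using lim by simp
      then have "full_strip \<delta> s (X + Y+2)"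
        using full_strip_extend_edge[OF a, of Y X s] full lim tri unfolding t e \<delta> by auto
      moreover have "t \<in> strip \<delta> s (X + Y+2)" using lim a unfolding t \<delta> by auto
      ultimately show ?thesis by (rule inz) (simp add: \<open>t0 = X + Y+1\<close>)
    qed
  next
    assume zu: "z = ?top"
    have third: "t = w" if "{(X, Y), w} \<in> E" "{e, w} \<in> E" "w \<noteq> ?top" for w
      using at_most_two_triangles[OF tri(1-5) that(1,2)] tri(6) zu that(3) by auto
    show ?thesis
    proof (cases "s < X + Y")
      case True
      then have st: "?low \<in> strip \<delta> s t0" "(X, Y) \<in> strip \<delta> s t0" "e \<in> strip \<delta> s t0"
        using lim a unfolding e \<delta> by auto
      then have "?low \<in> vertices (strong_grid n)" "(X, Y) \<in> vertices (strong_grid n)" "e \<in> vertices (strong_grid n)"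
        using full V_grid unfolding full_strip_def by blast+
      then have "{(X, Y), ?low} \<in> edges (strong_grid n)" "{e, ?low} \<in> edges (strong_grid n)"
        using a unfolding e strong_grid_edge by (auto simp: strong_grid_def)
      then have "{(X, Y), ?low} \<in> E" "{e, ?low} \<in> E"
        using full st unfolding full_strip_def by auto
      then have "t = ?low" using a by (intro third) auto
      then show ?thesis using inz[OF full] st by simp
    next
      case False
      \<comment> \<open>The edge is the base line itself. The two outer base lines have an end in
        layer \<open>d\<close>, so it is a side of a square.\<close>
      then have b: "{(X, Y), e} \<in> bases" using base lim strip_pair[OF a, of Y X] unfolding e \<delta> by simp
      have no: "w \<notin> layer d" if "w \<in> {(X, Y), e}" for w using far that by auto
      show ?thesis
      proof (rule base_line_cases[OF b])
        assume "{(X, Y), e} = {(0, d), (1, d)}"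
        then show ?thesis using no[of "(0, d)"] by (simp add: layer_def)
      next
        assume "{(X, Y), e} = {(d, 0), (d, 1)}"
        then show ?thesis using no[of "(d, 0)"] by (simp add: layer_def)
      next
        fix i j assume ij: "i + j = d" "1 \<le> i" "1 \<le> j" and r: "{(i, j+1), (i+1, j+1)} \<in> E" "{(i+1, j), (i+1, j+1)} \<in> E"
          and or: "{(i, j+1), (i+1, j)} \<in> E \<or> {(i, j), (i+1, j+1)} \<in> E"
          and "{(X, Y), e} = {(i, j+1), (i+1, j+1)} \<or> {(X, Y), e} = {(i+1, j), (i+1, j+1)}"
        then consider (h) "(X, Y) = (i, j+1)" "e = (i+1, j+1)" | (v) "(X, Y) = (i+1, j)" "e = (i+1, j+1)"
          using a e by (auto simp: doubleton_eq_iff)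
        note hv = this
        let ?r = "(i+1, j+1)" and ?p = "(i, j+1)" and ?q = "(i+1, j)"
        from or show ?thesis
        proof
          assume pq: "{?p, ?q} \<in> E"
          from hv have "{(X, Y), e, t} = {?p, ?q, ?r}"
          proof cases
            case h
            then have "t = ?q" using pq r sym by (intro third) auto
            then show ?thesis unfolding h by blast
          next
            case v
            then have "t = ?p" using sym[OF pq] r sym by (intro third) auto
            then show ?thesis unfolding v by blast
          qed
          then show ?thesis unfolding good_def using ij by blast
        next
          assume cr: "{(i, j), ?r} \<in> E"
          from hv have "t = (i, j)"
          proof cases
            case h
            then show ?thesis using sym[OF cr] sym[OF square_sides(1)[OF ij]] by (intro third) auto
          next
            case v
            then show ?thesis using sym[OF cr] sym[OF square_sides(2)[OF ij]] by (intro third) auto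
          qed
          then show ?thesis using far ij by (simp add: layer_def)
        qed
      qed
    qed
  qed
qed

end

section \<open>Propagation of the invariant to all triangles\<close>

context grid_triangulation
begin

text \<open>For a vertex \<open>(i, j)\<close> of the first layer, \<open>(i+a, j+1 - a)\<close> is its upper (\<open>a = 0\<close>) or
  right (\<open>a = 1\<close>) neighbour in the second layer.\<close>

lemma side_vertex:
  assumes "i + j = d" "(i+a, j+1 - a) \<in> V" "a = 0 \<or> a = 1"
  shows "a = 0 \<Longrightarrow> 1 \<le> i" "a = 1 \<Longrightarrow> 1 \<le> j"
  using region[OF assms(2)] assms by auto

text \<open>The possible link edges of a point in layer \<open>d\<close>. In case
  \<open>base\<close>, the point with \<open>2 * a\<close> is the neighbour in that layer:
  \<open>(i-1, j+1)\<close> for \<open>a = 0\<close>, \<open>(i+1, j-1)\<close> for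
  \<open>a = 1\<close>.\<close>

lemma first_layer_neighbour_cases:
  assumes c: "i + j = d" and x: "{(i, j), x} \<in> E" and y: "{(i, j), y} \<in> E" and xy: "{x, y} \<in> E"
  obtains (base) a where "a = 0 \<or> a = 1" "{x, y} = {(i+2 * a-1, j+1 - 2 * a), (i+a, j+1 - a)}"
    | (side) a where "a = 0 \<or> a = 1" "{x, y} = {(i+a, j+1 - a), (i+1, j+1)}"
    | (across) "{x, y} = {(i, j+1), (i+1, j)}"
proof -
  let ?r = "(i+1, j+1)" and ?p = "(i, j+1)" and ?q = "(i+1, j)"
  have nb: "x \<in> {(i-1, j+1), ?p, ?r, ?q, (i+1, j-1)}"
    "y \<in> {(i-1, j+1), ?p, ?r, ?q, (i+1, j-1)}"
    using layer_neighbours[OF c] x y by auto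
  have far: "{(p, q), (p', q')} \<notin> E" if "2 \<le> \<bar>p' - p\<bar> \<or> 2 \<le> \<bar>q' - q\<bar>" for p q p' q'
    using edge_step(1,2)[of p q p' q'] that by linarith
  have ne: "x \<noteq> y" using edge_vertices[OF xy] by auto
  consider "{x, y} = {(i-1, j+1), ?p}" | "{x, y} = {?p, ?r}"
    | "{x, y} = {?q, ?r}" | "{x, y} = {(i+1, j-1), ?q}"
    | "{x, y} = {?p, ?q}"
    | (apart) "{x, y} = {(i-1, j+1), ?r} \<or> {x, y} = {(i-1, j+1), ?q} \<or>
        {x, y} = {(i-1, j+1), (i+1, j-1)} \<or> {x, y} = {?p, (i+1, j-1)} \<or>
        {x, y} = {?r, (i+1, j-1)}"
    using nb ne by (elim insertE emptyE) (simp_all add: insert_commute)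
  then show thesis
  proof cases
    case apart
    then have False
      using xy far[of "i+1" "i-1" "j+1" "j+1"] far[of "i+1" "i-1" j "j+1"]
        far[of "i+1" "i-1" "j-1" "j+1"] far[of "i+1" i "j-1" "j+1"]
        far[of "i+1" "i+1" "j-1" "j+1"]
      by (elim disjE) simp_all
    then show thesis ..
  qed (use base[of 0] base[of 1] side[of 0] side[of 1] across in \<open>simp_all add: add.commute[of 1 i]\<close>)
qed

text \<open>The corner edge at the upper neighbour is horizontal and the one at the right neighbour
  vertical, so the base line has kind \<open>1 - a\<close>.\<close>

lemma corner_zigzag:
  assumes ij: "i + j = d" "1 \<le> i" "1 \<le> j" and a: "a = 0 \<or> a = 1"
    and or: "{(i, j), (i+1, j+1)} \<in> E \<or> {(i, j+1), (i+1, j)} \<in> E \<and> {(i, j+1), (i+1, j+1)} \<in> E \<and> {(i+1, j), (i+1, j+1)} \<in> E"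
    and e: "{(i+a, j+1 - a), (i+1, j+1)} \<in> E" "{(i+a, j+1 - a), (i+a+1, j+2 - a)} \<in> E"
      "{(i+1, j+1), (i+a+1, j+2 - a)} \<in> E"
  shows "in_zigzag {(i+a, j+1 - a), (i+1, j+1), (i+a+1, j+2 - a)}"
proof -
  have "{(i+a, j+1 - a), (i+1, j+1)} \<in> described"
    using a or e(1) corner_described(1,2)[OF ij] by auto
  then have "{(i+a, j+1 - a), (i+1, j+1)} \<in> bases"
    by (rule described_base_line) (use ij a in \<open>auto simp: layer_def\<close>)
  moreover have "1 - a = 0 \<or> 1 - a = 1" using a by auto
  ultimately show ?thesis
    using zigzag_start(2)[of "1 - a" "i+a" "j+1 - a"] e by (simp add: algebra_simps)
qed

text \<open>At an end of layer \<open>d\<close> there is no square, so the zigzag starts one layer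
  earlier, at the corner itself; the two claims concern its first and second triangle.\<close>

lemma end_zigzag:
  assumes ij: "i + j = d" and a: "a = 0 \<and> j = 0 \<or> a = 1 \<and> i = 0"
    and e: "{(i, j), (i+1, j+1)} \<in> E" "{(i+a, j+1 - a), (i+1, j+1)} \<in> E"
  shows "in_zigzag {(i, j), (i+a, j+1 - a), (i+1, j+1)}"
    and "{(i+a, j+1 - a), (i+a+1, j+2 - a)} \<in> E \<Longrightarrow> {(i+1, j+1), (i+a+1, j+2 - a)} \<in> E \<Longrightarrow>
      in_zigzag {(i+a, j+1 - a), (i+1, j+1), (i+a+1, j+2 - a)}"
proof -
  have a': "a = 0 \<or> a = 1" "1 - a = 0 \<or> 1 - a = 1" using a by auto
  have "{(0, d), (1, d)} \<in> bases" "{(d, 0), (d, 1)} \<in> bases" unfolding base_lines_def by simp_all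
  moreover have "{(0, d), (1, d)} \<in> E" "{(d, 0), (d, 1)} \<in> E"
    using base_triangle(2)[of 0 d] base_triangle(3)[of "d-1" 1] d_pos by simp_all
  ultimately have b: "{(i, j), (i+a, j+1 - a)} \<in> bases" "{(i, j), (i+a, j+1 - a)} \<in> E"
    using a ij by auto
  show "in_zigzag {(i, j), (i+a, j+1 - a), (i+1, j+1)}"
    by (rule zigzag_start(2)[OF a'(1) b e])
  assume e': "{(i+a, j+1 - a), (i+a+1, j+2 - a)} \<in> E" "{(i+1, j+1), (i+a+1, j+2 - a)} \<in> E"
  have "full_strip (j - i - a) (i + j) (i + j+2)"
    by (rule zigzag_start(1)[OF a'(1) b e])
  then have "full_strip (j - i - a) (i + j) (i + j + 3)"
    using full_strip_extend_edge[OF a'(2), of "j+1 - a" "i+a" "i + j"] e' by (simp add: algebra_simps)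
  moreover have "strip (j - i - a) (i + j) (i + j+1) \<in> bases"
    using strip_pair[OF a'(1)] b(1) by simp
  ultimately show "in_zigzag {(i+a, j+1 - a), (i+1, j+1), (i+a+1, j+2 - a)}"
    unfolding in_zigzag_def using a'
    by (intro exI[of _ "j - i - a"] exI[of _ "i + j"] exI[of _ "i + j + 3"]) auto
qed

lemma end_vertex:
  assumes "i + j = d" "(i, j) \<in> V" "(i+a, j+1 - a) \<in> V" "a = 0 \<or> a = 1" "\<not> (1 \<le> i \<and> 1 \<le> j)"
  shows "a = 0 \<and> j = 0 \<or> a = 1 \<and> i = 0"
  using side_vertex[OF assms(1,3,4)] assms(4,5) region[OF assms(2)] by auto

text \<open>\<open>(i, j)\<close> is not the outward position of the opposite edge, so
  \<open>t\<close> is. Depending on that edge a square is completed, or a zigzag starts or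
  continues.\<close>

lemma good_step_layer:
  assumes c: "i + j = d"
    and tri: "{x, y} \<in> E" "{x, (i, j)} \<in> E" "{y, (i, j)} \<in> E" "{x, t} \<in> E" "{y, t} \<in> E" "(i, j) \<noteq> t"
    and far: "x \<notin> layer d" "y \<notin> layer d" "t \<notin> layer d"
  shows "good {x, y, t}"
proof -
  have out: "(i, j) = outward x y \<or> t = outward x y"
    using one_triangle_outward[OF tri far(1,2)] .
  have e: "{a, t} \<in> E" if "a \<in> {x, y}" for a using tri that by auto
  have ce: "{(i, j), a} \<in> E" if "a \<in> {x, y}" for a using sym[OF tri(2)] sym[OF tri(3)] that by auto
  have ow: "outward x y = outward a b" if "{x, y} = {a, b}" for a b
    using that by (auto simp: doubleton_eq_iff outward_def min.commute)
  have tset: "{x, y, t} = insert a (insert b {t})" if "{x, y} = {a, b}" for a b using that by blast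
  from c sym[OF tri(2)] sym[OF tri(3)] tri(1) show ?thesis
  proof (cases rule: first_layer_neighbour_cases)
    case (base a)
    have "(i+2 * a-1, j+1 - 2 * a) \<in> {x, y}" "(i+2 * a-1, j+1 - 2 * a) \<in> layer d"
      using base(2) c by (auto simp: layer_def)
    then show ?thesis using far by auto
  next
    case across
    then have "t = (i+1, j+1)" using out ow[OF across] by (auto simp: outward_def)
    moreover have "(i, j+1) \<in> V" "(i+1, j) \<in> V" using across tri(1) edge_vertices by auto
    then have "1 \<le> i" "1 \<le> j" using side_vertex[OF c, of 0] side_vertex[OF c, of 1] by auto
    ultimately show ?thesis unfolding good_def tset[OF across] using c by blast
  next
    case (side a)
    let ?v = "(i+a, j+1 - a)" and ?r = "(i+1, j+1)"
    have t: "t = (i+a+1, j+2 - a)" using out ow[OF side(2)] side(1) by (auto simp: outward_def)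
    have m: "?v \<in> {x, y}" "?r \<in> {x, y}" using side(2) by auto
    have vr: "{?v, ?r} \<in> E" using tri(1) side(2) by simp
    have V: "(i, j) \<in> V" "?v \<in> V" using edge_vertices tri(2) vr by blast+
    have "in_zigzag {?v, ?r, t}"
    proof (cases "1 \<le> i \<and> 1 \<le> j")
      case True
      then show ?thesis using corner_zigzag[OF c _ _ side(1)] ce[OF m(2)] vr e[OF m(1)] e[OF m(2)] t by simp
    next
      case False
      show ?thesis
        using end_zigzag(2)[OF c end_vertex[OF c V side(1) False]] ce[OF m(2)] vr e[OF m(1)] e[OF m(2)] t by simp
    qed
    then show ?thesis unfolding good_def tset[OF side(2)] by blast
  qed
qed

text \<open>Crossing a corner edge starts a zigzag; crossing the antidiagonal would lead back to
  \<open>(i, j)\<close> in layer \<open>d\<close>.\<close>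

lemma good_step_square:
  assumes ij: "i + j = d" "1 \<le> i" "1 \<le> j" and T: "{x, y, z} = {(i, j+1), (i+1, j), (i+1, j+1)}"
    and tri: "{x, y} \<in> E" "{x, z} \<in> E" "{y, z} \<in> E" "{x, t} \<in> E" "{y, t} \<in> E" "z \<noteq> t"
    and far: "x \<notin> layer d" "y \<notin> layer d" "t \<notin> layer d"
  shows "good {x, y, t}"
proof -
  let ?p = "(i, j+1)" and ?q = "(i+1, j)" and ?r = "(i+1, j+1)"
  have ne: "x \<noteq> y" "x \<noteq> z" "y \<noteq> z" using tri edge_vertices by blast+
  have xy: "{x, y} = {?p, ?q, ?r} - {z}" "z \<in> {?p, ?q, ?r}" using T ne by blast+
  have all: "{u, v} \<in> E" if "u \<in> {x, y, z}" "v \<in> {x, y, z}" "u \<noteq> v" for u v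
    using tri that sym[OF tri(1)] sym[OF tri(2)] sym[OF tri(3)] by auto
  then have sq: "{?p, ?q} \<in> E" "{?p, ?r} \<in> E" "{?q, ?r} \<in> E" unfolding T by auto
  have et: "{a, t} \<in> E" if "a \<in> {x, y}" for a using tri that by auto
  consider (side) a where "a = 0 \<or> a = 1" "z = (i+1 - a, j+a)" "{x, y} = {(i+a, j+1 - a), ?r}"
    | (top) "z = ?r" "{x, y} = {?p, ?q}"
  proof -
    have "{x, y} = {?q, ?r}" if "z = ?p" unfolding xy that by auto
    moreover have "{x, y} = {?p, ?r}" if "z = ?q" unfolding xy that by auto
    moreover have "{x, y} = {?p, ?q}" if "z = ?r" unfolding xy that by auto
    ultimately show thesis using xy(2) that(1)[of 0] that(1)[of 1] that(2) by auto
  qed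
  then show ?thesis
  proof cases
    case (side a)
    have "outward x y = (i+a+1, j+2 - a)"
      using side(1,3) by (auto simp: doubleton_eq_iff outward_def)
    then have "t = (i+a+1, j+2 - a)"
      using one_triangle_outward[OF tri far(1,2)] side(1,2) by auto
    moreover have "{(i+a, j+1 - a), t} \<in> E" "{?r, t} \<in> E" "{(i+a, j+1 - a), ?r} \<in> E"
      using et tri(1) side(3) by auto
    ultimately have "in_zigzag {(i+a, j+1 - a), ?r, t}" using corner_zigzag[OF ij side(1)] sq by blast
    moreover have "{x, y, t} = {(i+a, j+1 - a), ?r, t}" using side(3) by blast
    ultimately show ?thesis unfolding good_def by simp
  next
    case top
    have "{?p, t} \<in> E" "{?q, t} \<in> E" using et top(2) by auto
    then have "t = (i, j) \<or> t = ?r" by (rule antidiagonal_third[OF ij(1)])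
    then show ?thesis using top tri(6) far ij by (auto simp: layer_def)
  qed
qed

text \<open>An edge in a strip either joins its two diagonals, which is the case of
  \<open>good_step_strip\<close>, or runs along one of them and has no second triangle.\<close>

lemma good_step_zigzag:
  assumes T: "in_zigzag {x, y, z}"
    and tri: "{x, y} \<in> E" "{x, z} \<in> E" "{y, z} \<in> E" "{x, t} \<in> E" "{y, t} \<in> E" "z \<noteq> t"
    and far: "x \<notin> layer d" "y \<notin> layer d" "t \<notin> layer d"
  shows "good {x, y, t}"
proof -
  obtain \<delta> s t0 where b: "strip \<delta> s (s + 1) \<in> bases" and lim: "s + 2 \<le> t0"
    and full: "full_strip \<delta> s t0" and sub: "{x, y, z} \<subseteq> strip \<delta> s t0" using T unfolding in_zigzag_def by blast
  obtain x1 x2 y1 y2 where c: "x = (x1, x2)" "y = (y1, y2)" by (metis surj_pair)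
  have xs: "x2 - x1 = \<delta> \<or> x2 - x1 = \<delta> + 1" "s \<le> x1 + x2" "x1 + x2 \<le> t0"
    and ys: "y2 - y1 = \<delta> \<or> y2 - y1 = \<delta> + 1" "s \<le> y1 + y2" "y1 + y2 \<le> t0" using sub c by auto
  have st: "\<bar>y1 - x1\<bar> \<le> 1" "\<bar>y2 - x2\<bar> \<le> 1" "(x1, x2) \<noteq> (y1, y2)" using edge_step[OF tri(1)[unfolded c]] by auto
  have lem: "good {(u1, u2), (v1, v2), t}"
    if uv: "u2 - u1 = \<delta>" "v2 - v1 = \<delta> + 1" and e: "{(u1, u2), (v1, v2)} = {x, y}" for u1 u2 v1 v2
  proof -
    have st': "\<bar>v1 - u1\<bar> \<le> 1" "\<bar>v2 - u2\<bar> \<le> 1" "s \<le> u1 + u2" "u1 + u2 \<le> t0" "s \<le> v1 + v2" "v1 + v2 \<le> t0"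
    proof -
      consider "u1 = x1" "u2 = x2" "v1 = y1" "v2 = y2" | "u1 = y1" "u2 = y2" "v1 = x1" "v2 = x2"
        using e unfolding c doubleton_eq_iff prod.inject by blast
      then show "\<bar>v1 - u1\<bar> \<le> 1" "\<bar>v2 - u2\<bar> \<le> 1" "s \<le> u1 + u2" "u1 + u2 \<le> t0" "s \<le> v1 + v2" "v1 + v2 \<le> t0"
        using st(1,2) xs(2,3) ys(2,3) by (cases; simp add: abs_minus_commute)+
    qed
    have m: "(u1, u2) \<in> {x, y}" "(v1, v2) \<in> {x, y}" using e by blast+
    have es: "{(u1, u2), (v1, v2)} \<in> E" "{(u1, u2), z} \<in> E" "{(v1, v2), z} \<in> E" "{(u1, u2), t} \<in> E" "{(v1, v2), t} \<in> E"
      using m tri e by auto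
    have fr: "(u1, u2) \<notin> layer d" "(v1, v2) \<notin> layer d" using m far by auto
    consider "v1 = u1" "v2 = u2 + 1" | "u1 = v1 + 1" "v2 = u2" using uv st' by linarith
    then show ?thesis
    proof cases
      case 1
      show ?thesis
        by (rule good_step_strip[where a = 0, OF _ _ _ full b lim st'(3) _ es tri(6) _ fr far(3)])
          (use 1 uv st'(6) sub in simp_all)
    next
      case 2
      have "good {(v1, v2), (u1, u2), t}"
        by (rule good_step_strip[where a = 1, OF _ _ _ full b lim st'(5) _ sym[OF es(1)] es(3,2,5,4) tri(6) _ fr(2,1) far(3)])
          (use 2 uv st'(4) sub in simp_all)
      then show ?thesis by (simp add: insert_commute)
    qed
  qed
  consider "x2 - x1 = \<delta>" "y2 - y1 = \<delta> + 1" | "x2 - x1 = \<delta> + 1" "y2 - y1 = \<delta>" | "y2 - x2 = y1 - x1"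
    using xs ys by linarith
  then show ?thesis
  proof cases
    case 1
    then show ?thesis using lem[OF 1] c by simp
  next
    case 2
    then show ?thesis using lem[OF 2(2,1)] c by (simp add: insert_commute)
  next
    case 3
    then consider "y = (x1 + 1, x2 + 1)" | "x = (y1 + 1, y2 + 1)" using st unfolding c prod.inject by linarith
    then show ?thesis
    proof cases
      case 1
      then show ?thesis using diagonal_one_triangle[of x1 x2 z t] tri far c by auto
    next
      case 2
      then show ?thesis using diagonal_one_triangle[of y1 y2 z t] tri far c sym[OF tri(1)] by auto
    qed
  qed
qed

lemma all_good:
  assumes "{u, v} \<in> E" "{u, w} \<in> E" "{v, w} \<in> E"
  shows "good {u, v, w}"
proof (rule dual_connected[OF _ _ _ _ _ assms])
  have b: "0 + d = d" "0 \<le> (0::int)" "1 \<le> d" using d_pos by auto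
  show "{(0, d), (0 + 1, d - 1)} \<in> E" "{(0, d), (0 + 1, d)} \<in> E" "{(0 + 1, d - 1), (0 + 1, d)} \<in> E"
    using base_triangle[OF b] by auto
  show "good {(0, d), (0 + 1, d - 1), (0 + 1, d)}" unfolding good_def by (auto simp: layer_def)
  fix x y z t assume tri: "{x, y} \<in> E" "{x, z} \<in> E" "{y, z} \<in> E" "{x, t} \<in> E" "{y, t} \<in> E" "z \<noteq> t"
    and g: "good {x, y, z}"
  show "good {x, y, t}"
  proof (cases "{x, y, t} \<inter> layer d = {}")
    case False
    then show ?thesis unfolding good_def by blast
  next
    case True
    then have far: "x \<notin> layer d" "y \<notin> layer d" "t \<notin> layer d" by auto
    consider "z \<in> layer d"
      | i j where "1 \<le> i" "1 \<le> j" "i + j = d" "{x, y, z} = {(i, j+1), (i+1, j), (i+1, j+1)}"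
      | "in_zigzag {x, y, z}" using g far unfolding good_def by blast
    then show ?thesis
    proof cases
      case 1
      obtain i j where "z = (i, j)" by (cases z)
      then show ?thesis using good_step_layer[of i j x y t] 1 tri far by (auto simp: layer_def)
    next
      case (2 i j)
      then show ?thesis using good_step_square[OF 2(3,1,2,4) tri far] by blast
    next
      case 3
      then show ?thesis using good_step_zigzag[OF 3 tri far] by blast
    qed
  qed
qed

section \<open>Every edge is described or lies in a zigzag\<close>

definition covered :: "point set \<Rightarrow> bool" where
  "covered e \<longleftrightarrow> e \<in> described \<or> (\<exists>Z\<in>zigzags n (V, E) d. e \<in> edges Z)"

lemma zigzag_covers:
  assumes "in_zigzag T" "e \<in> E" "e \<subseteq> T"
  shows "covered e"
proof -
  obtain \<delta> s t where b: "strip \<delta> s (s + 1) \<in> bases" "s + 2 \<le> t"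
    "full_strip \<delta> s t" "T \<subseteq> strip \<delta> s t" using assms(1) unfolding in_zigzag_def by blast
  have "e \<in> edges (induced_subgraph (strong_grid n) (strip \<delta> s t))"
    using assms(2,3) E_grid b(4) unfolding induced_subgraph_def by auto
  then show ?thesis unfolding covered_def using full_strip_zigzag[OF b(1-3)] by blast
qed

text \<open>The edges of these triangles are described, except possibly at the ends of the layer,
  where the first triangle of an outer zigzag supplies them.\<close>

lemma layer_triangle_covered:
  assumes c: "i + j = d" and x: "{(i, j), x} \<in> E" and y: "{(i, j), y} \<in> E" and xy: "{x, y} \<in> E"
  shows "covered {(i, j), x} \<and> covered {(i, j), y} \<and> covered {x, y}"
proof -
  have desc: "covered e" if "e \<in> described" for e using that unfolding covered_def by blast
  have ex: "{(i, j), a} \<in> E" if "a \<in> {x, y}" for a using x y that by auto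
  have cover: "covered {(i, j), x} \<and> covered {(i, j), y} \<and> covered {x, y}"
    if "{x, y} = {a, b}" "covered {(i, j), a}" "covered {(i, j), b}" "covered {a, b}" for a b
  proof -
    have "covered {(i, j), x}" "covered {(i, j), y}" using that(1-3) by (auto simp: doubleton_eq_iff)
    then show ?thesis using that(1,4) by simp
  qed
  have nn: "0 \<le> i" "0 \<le> j" using c edge_vertices[OF x] region[of i j] by auto
  have side_desc: "{(i, j), (i+a, j+1 - a)} \<in> described" if "a = 0 \<or> a = 1" "(i+a, j+1 - a) \<in> V" for a
    using base_triangle_described(3)[of "i-1" "j+1"] base_triangle_described(2)[of i j]
      side_vertex[OF c that(2,1)] that(1) c nn by auto
  from c x y xy show ?thesis
  proof (cases rule: first_layer_neighbour_cases)
    case (base a)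
    have V: "(i+a, j+1 - a) \<in> V" using base(2) xy edge_vertices by auto
    from base(1) show ?thesis
    proof
      assume a: "a = 0"
      have "i-1 + (j+1) = d" "0 \<le> i-1" "1 \<le> j+1" using c a nn side_vertex[OF c V base(1)] by auto
      from base_triangle_described[OF this] a show ?thesis
        by (intro cover[OF base(2)] desc) (simp_all add: insert_commute)
    next
      assume a: "a = 1"
      from base_triangle_described[OF c nn(1) side_vertex(2)[OF c V base(1) a]] a show ?thesis
        by (intro cover[OF base(2)] desc) (simp_all add: add.commute[of 1 i])
    qed
  next
    case across
    have V: "(i, j+1) \<in> V" "(i+1, j) \<in> V" using across xy edge_vertices by auto
    then have "1 \<le> i" "1 \<le> j" using side_vertex[OF c, of 0] side_vertex[OF c, of 1] by auto
    then show ?thesis using antidiagonal_described[OF c] xy across side_desc[of 0] side_desc[of 1] V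
      by (intro cover[OF across] desc) auto
  next
    case (side a)
    let ?v = "(i+a, j+1 - a)" and ?r = "(i+1, j+1)"
    have m: "{(i, j), ?v} \<in> E" "{(i, j), ?r} \<in> E" using ex side(2) by auto
    have e: "{?v, ?r} \<in> E" using xy side(2) by simp
    have V: "(i, j) \<in> V" "?v \<in> V" using edge_vertices x e by blast+
    show ?thesis
    proof (cases "1 \<le> i \<and> 1 \<le> j")
      case True
      then show ?thesis using corner_described[OF c] side_desc[OF side(1) V(2)] m e side(1)
        by (intro cover[OF side(2)] desc) auto
    next
      case False
      have "in_zigzag {(i, j), ?v, ?r}" by (rule end_zigzag(1)[OF c end_vertex[OF c V side(1) False] m(2) e])
      then show ?thesis using m e by (intro cover[OF side(2)]; elim zigzag_covers) auto
    qed
  qed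
qed

lemma edge_covered:
  assumes uv: "{u, v} \<in> E"
  shows "covered {u, v}"
proof -
  obtain w where w: "{u, w} \<in> E" "{v, w} \<in> E" using edge_in_triangle[OF uv] by blast
  consider "u \<in> layer d" | "v \<in> layer d" | "w \<in> layer d"
    | i j where "1 \<le> i" "1 \<le> j" "i + j = d" "{u, v, w} = {(i, j+1), (i+1, j), (i+1, j+1)}"
    | "in_zigzag {u, v, w}" using all_good[OF uv w] unfolding good_def by blast
  then show ?thesis
  proof cases
    case 1
    obtain i j where "u = (i, j)" by (cases u)
    then show ?thesis using layer_triangle_covered[of i j v w] 1 uv w by (auto simp: layer_def)
  next
    case 2
    obtain i j where "v = (i, j)" by (cases v)
    then show ?thesis using layer_triangle_covered[of i j u w] 2 sym[OF uv] uv w by (auto simp: layer_def insert_commute)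
  next
    case 3
    obtain i j where "w = (i, j)" by (cases w)
    then show ?thesis using layer_triangle_covered[of i j u v] 3 sym[OF w(1)] sym[OF w(2)] uv by (auto simp: layer_def)
  next
    case (4 i j)
    let ?p = "(i, j+1)" and ?q = "(i+1, j)" and ?r = "(i+1, j+1)"
    have all: "{a, b} \<in> E" if "a \<in> {u, v, w}" "b \<in> {u, v, w}" "a \<noteq> b" for a b
      using uv w that sym[OF uv] sym[OF w(1)] sym[OF w(2)] by auto
    then have sq: "{?p, ?q} \<in> E" "{?p, ?r} \<in> E" "{?q, ?r} \<in> E" unfolding 4(4) by auto
    have d: "{?p, ?q} \<in> described" "{?p, ?r} \<in> described"
      "{?q, ?r} \<in> described"
      using antidiagonal_described[OF 4(3,1,2)] corner_described(1,2)[OF 4(3,1,2)] sq by blast+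
    have "u \<in> {?p, ?q, ?r}" "v \<in> {?p, ?q, ?r}" "u \<noteq> v" using 4(4) edge_vertices[OF uv] by blast+
    then have "{u, v} = {?p, ?q} \<or> {u, v} = {?p, ?r} \<or> {u, v} = {?q, ?r}"
      by (elim insertE emptyE) (simp_all add: insert_commute)
    then show ?thesis unfolding covered_def using d by auto
  next
    case 5
    then show ?thesis using zigzag_covers uv by blast
  qed
qed

text \<open>Read contrapositively: all edges at an undescribed vertex are undescribed, so a zigzag
  covering one of them contains the vertex.\<close>

lemma described_edge_vertices:
  assumes "e \<in> described"
  shows "e \<subseteq> described_vertices n (V, E) d"
proof -
  have layer: "(x, y) \<in> vertices1 n d" if "x + y = d" "(x, y) \<in> V" for x y
    using that V_grid_region unfolding vertices1_def layer_def by auto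
  consider "e \<in> edges1 d" | "e \<in> edges2 n d" | "e \<in> edges3 (V, E) d" using assms unfolding described_edges_def by blast
  then show ?thesis
  proof cases
    case 1
    then obtain i j where e: "e = {(i, j), (i+1, j-1)}" "i + j = d" "0 \<le> i" "i < d" unfolding edges1_def by auto
    then have "{(i, j), (i+1, j-1)} \<in> E" using base_triangle(1)[of i j] by auto
    then show ?thesis using layer[of i j] layer[of "i+1" "j-1"] e edge_vertices unfolding described_vertices_def by auto
  next
    case 2
    then obtain i j where ij: "(i, j) \<in> layer (d + 1) \<inter> grid_region n d"
      "e = {(i, j), (i-1, j)} \<or> e = {(i, j), (i, j-1)}" unfolding edges2_def by auto
    then have "(i-1, j) \<in> V" "(i, j-1) \<in> V" "i + j = d + 1"
      using second_layer(2,3)[OF ij(1)] edge_vertices by (auto simp: layer_def)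
    then have "(i-1, j) \<in> vertices1 n d" "(i, j-1) \<in> vertices1 n d" using layer by auto
    then show ?thesis using ij unfolding described_vertices_def vertices2_def by auto
  next
    case 3
    then show ?thesis unfolding described_vertices_def vertices3_def by auto
  qed
qed

text \<open>A strip determines its base line: the outermost strips start in layer \<open>d\<close>,
  all others in layer \<open>d + 1\<close>. Hence zigzags in the same strip are nested.\<close>

lemma base_line_strip:
  assumes "strip \<delta> s (s + 1) \<in> bases"
  shows "- d \<le> \<delta>" "\<delta> \<le> d - 1" "s = (if \<delta> = - d \<or> \<delta> = d - 1 then d else d + 1)"
proof -
  have eq: "\<delta> = y - x - (if v then 0 else 1) \<and> s = x + y"
    if "strip \<delta> s (s + 1) = {(x, y), (if v then (x, y+1) else (x+1, y))}" for x y v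
  proof -
    have "(x, y) \<in> strip \<delta> s (s + 1)" "(if v then (x, y+1) else (x+1, y)) \<in> strip \<delta> s (s + 1)" using that by auto
    then show ?thesis by (cases v) auto
  qed
  note h = eq[where v = False, simplified] and v = eq[where v = True, simplified]
  have "- d \<le> \<delta> \<and> \<delta> \<le> d - 1 \<and> s = (if \<delta> = - d \<or> \<delta> = d - 1 then d else d + 1)"
  proof (rule base_line_cases[OF assms])
    assume "strip \<delta> s (s + 1) = {(0, d), (1, d)}"
    then show ?thesis using h[of 0 d] d_pos by auto
  next
    assume "strip \<delta> s (s + 1) = {(d, 0), (d, 1)}"
    then show ?thesis using v[of d 0] d_pos by auto
  next
    fix i j assume ij: "i + j = d" "1 \<le> i" "1 \<le> j"
      and "strip \<delta> s (s + 1) = {(i, j+1), (i+1, j+1)} \<or> strip \<delta> s (s + 1) = {(i+1, j), (i+1, j+1)}"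
    then consider "\<delta> = j - i" "s = d + 1" | "\<delta> = j - i-1" "s = d + 1"
      using h[of i "j+1"] v[of "i+1" j] by auto
    then show ?thesis using ij by cases auto
  qed
  then show "- d \<le> \<delta>" "\<delta> \<le> d - 1" "s = (if \<delta> = - d \<or> \<delta> = d - 1 then d else d + 1)" by auto
qed

text \<open>The edge lies on the common diagonal, and the strips supply a triangle on either side of
  it, against \<open>diagonal_one_triangle\<close>. If it starts in layer \<open>d\<close>, both
  strips are outermost, so \<open>d = 1\<close> and \<open>x = y\<close>, contradicting
  \<open>x + y = 1\<close>.\<close>

lemma neighbouring_strips_share_no_edge:
  assumes Z: "full_strip \<delta> s t" "strip \<delta> s (s + 1) \<in> bases" "s + 2 \<le> t"
    and Z': "full_strip (\<delta> - 1) s' t'" "strip (\<delta> - 1) s' (s' + 1) \<in> bases" "s' + 2 \<le> t'"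
    and e: "{(x, y), (x+1, y+1)} \<in> E" "{(x, y), (x+1, y+1)} \<subseteq> strip \<delta> s t \<inter> strip (\<delta> - 1) s' t'"
  shows False
proof -
  have d: "y - x = \<delta>" using e(2) by auto
  have grid: "u \<in> vertices (strong_grid n)" if "u \<in> strip \<delta> s t \<union> strip (\<delta> - 1) s' t'" for u
    using that Z(1) Z'(1) V_grid unfolding full_strip_def by blast
  have a: "(x, y+1) \<in> strip \<delta> s t" and b: "(x+1, y) \<in> strip (\<delta> - 1) s' t'" using e(2) d by auto
  have g: "(x, y) \<in> vertices (strong_grid n)" "(x+1, y+1) \<in> vertices (strong_grid n)"
    "(x, y+1) \<in> vertices (strong_grid n)" "(x+1, y) \<in> vertices (strong_grid n)"
    using grid e(2) a b by blast+
  have ge: "{(x, y), (x, y+1)} \<in> edges (strong_grid n)" "{(x+1, y+1), (x, y+1)} \<in> edges (strong_grid n)"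
    "{(x, y), (x+1, y)} \<in> edges (strong_grid n)" "{(x+1, y+1), (x+1, y)} \<in> edges (strong_grid n)"
    unfolding strong_grid_edge using g by (auto simp: strong_grid_def)
  have E4: "{(x, y), (x, y+1)} \<in> E" "{(x+1, y+1), (x, y+1)} \<in> E"
    "{(x, y), (x+1, y)} \<in> E" "{(x+1, y+1), (x+1, y)} \<in> E"
    using ge Z(1) Z'(1) a b e(2) unfolding full_strip_def by blast+
  show False
  proof (cases "(x, y) \<in> layer d \<or> (x+1, y+1) \<in> layer d")
    case True
    have "d \<le> x + y" using region[of x y] edge_vertices[OF e(1)] by blast
    then have xy: "x + y = d" using True by (auto simp: layer_def)
    then have "s \<le> d" "s' \<le> d" using e(2) by auto
    then have "\<delta> = d - 1 \<or> \<delta> = - d" "\<delta> - 1 = - d \<or> \<delta> - 1 = d - 1"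
      using base_line_strip(3)[OF Z(2)] base_line_strip(3)[OF Z'(2)] by (auto split: if_splits)
    then have "y - x = 0" "d = 1" using d d_pos by auto
    then show False using xy by presburger
  next
    case False
    then have "(x, y+1) = (x+1, y)"
      using diagonal_one_triangle[OF e(1) E4] by blast
    then show False by simp
  qed
qed

text \<open>In one strip zigzags are comparable, so maximal ones coincide. In different strips both
  ends of a common edge lie on a common diagonal, so the strips are neighbours.\<close>

lemma maximal_zigzags_edge_disjoint:
  assumes "Z \<in> maximal_zigzags n (V, E) d" "Z' \<in> maximal_zigzags n (V, E) d" "e \<in> edges Z" "e \<in> edges Z'"
  shows "Z = Z'"
proof -
  have ZZ: "Z \<in> zigzags n (V, E) d" "Z' \<in> zigzags n (V, E) d"
    and max: "\<And>Y. Y \<in> zigzags n (V, E) d \<Longrightarrow> subgraph Z Y \<Longrightarrow> Y = Z"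
      "\<And>Y. Y \<in> zigzags n (V, E) d \<Longrightarrow> subgraph Z' Y \<Longrightarrow> Y = Z'"
    using assms(1,2) unfolding maximal_zigzags_def by blast+
  obtain \<delta> s t where z: "strip \<delta> s (s + 1) \<in> bases" "s + 2 \<le> t" "full_strip \<delta> s t"
    "Z = induced_subgraph (strong_grid n) (strip \<delta> s t)" using zigzag_full_strip[OF ZZ(1)] by blast
  obtain \<delta>' s' t' where z': "strip \<delta>' s' (s' + 1) \<in> bases" "s' + 2 \<le> t'" "full_strip \<delta>' s' t'"
    "Z' = induced_subgraph (strong_grid n) (strip \<delta>' s' t')" using zigzag_full_strip[OF ZZ(2)] by blast
  have ind: "subgraph (induced_subgraph (strong_grid n) (strip \<delta> s a)) (induced_subgraph (strong_grid n) (strip \<delta> s b))"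
    if "a \<le> b" for a b
  proof -
    have "strip \<delta> s a \<subseteq> strip \<delta> s b" using that by (auto simp: strip_def)
    then show ?thesis unfolding subgraph_def induced_subgraph_def by auto
  qed
  show ?thesis
  proof (cases "\<delta> = \<delta>'")
    case True
    then have "s = s'" using base_line_strip(3)[OF z(1)] base_line_strip(3)[OF z'(1)] by simp
    then show ?thesis using max ZZ ind[of t t'] ind[of t' t] z(4) z'(4) True by (metis nle_le)
  next
    case False
    have eg: "e \<in> edges (strong_grid n)" "e \<subseteq> strip \<delta> s t" "e \<subseteq> strip \<delta>' s' t'"
      using assms(3,4) z(4) z'(4) unfolding induced_subgraph_def by auto
    obtain x y x' y' where xy: "e = {(x, y), (x', y')}" using eg(1) unfolding strong_grid_def by auto
    have eE: "e \<in> E" using eg z(3) xy unfolding full_strip_def by auto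
    have st: "\<bar>x' - x\<bar> \<le> 1" "\<bar>y' - y\<bar> \<le> 1" "(x, y) \<noteq> (x', y')" using eg(1) strong_grid_edge unfolding xy by blast+
    have diffs: "y - x \<in> {\<delta>, \<delta> + 1}" "y - x \<in> {\<delta>', \<delta>' + 1}" "y' - x' \<in> {\<delta>, \<delta> + 1}" "y' - x' \<in> {\<delta>', \<delta>' + 1}"
      using eg xy by auto
    then have same: "y - x = y' - x'" "\<delta>' = \<delta> - 1 \<or> \<delta> = \<delta>' - 1"
      using False unfolding insert_iff empty_iff by presburger+
    then have "(x' = x+1 \<and> y' = y+1) \<or> (x = x' + 1 \<and> y = y' + 1)" using st by auto
    then obtain a b where e: "e = {(a, b), (a+1, b + 1)}" using xy by (auto simp: insert_commute)
    from same(2) have False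
    proof
      assume *: "\<delta>' = \<delta> - 1"
      show False
        by (rule neighbouring_strips_share_no_edge[OF z(3,1,2) z'(3,1,2)[unfolded *], of a b])
          (use eE eg e * in auto)
    next
      assume *: "\<delta> = \<delta>' - 1"
      show False
        by (rule neighbouring_strips_share_no_edge[OF z'(3,1,2) z(3,1,2)[unfolded *], of a b])
          (use eE eg e * in auto)
    qed
    then show ?thesis ..
  qed
qed

lemma holds_condition4: "condition4 n (V, E) d"
  unfolding condition4_def
proof (intro conjI ballI impI)
  fix v assume v: "v \<in> vertices (V, E) - described_vertices n (V, E) d"
  then obtain w where w: "{v, w} \<in> E" using two_neighbours[of v] by (metis DiffD1 fst_conv)
  have "{v, w} \<notin> described" using described_edge_vertices v by blast
  then obtain Z where Z: "Z \<in> zigzags n (V, E) d" "{v, w} \<in> edges Z" using edge_covered[OF w] unfolding covered_def by blast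
  then have "v \<in> vertices Z" using zigzag_full_strip[OF Z(1)] unfolding induced_subgraph_def by (metis (no_types, lifting) fst_conv insert_subset mem_Collect_eq snd_conv)
  then show "\<exists>Z\<in>zigzags n (V, E) d. v \<in> vertices Z" using Z by blast
next
  fix e assume e: "e \<in> edges (V, E) - described"
  then obtain u v where "e = {u, v}" using E_grid unfolding strong_grid_def by auto
  then show "\<exists>Z\<in>zigzags n (V, E) d. e \<in> edges Z" using edge_covered[of u v] e unfolding covered_def by auto
next
  fix Z Z' assume "Z \<in> maximal_zigzags n (V, E) d" "Z' \<in> maximal_zigzags n (V, E) d" "Z \<noteq> Z'"
  then show "edges Z \<inter> edges Z' = {}" using maximal_zigzags_edge_disjoint by blast
qed

end

section \<open>From outerplanar graphs to orders, and transport along injections\<close>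

lemma outerplanar_imp_one_page:
  assumes G: "simple_graph G" and out: "outerplanar G"
  shows "one_page (vertices G) (edges G)"
proof -
  obtain p \<gamma> where "frontier_drawing G p \<gamma>"
    using out unfolding outerplanar_def frontier_drawing_def by blast
  then interpret frontier_drawing G p \<gamma> .
  have "theta_free (vertices G) (edges G)"
    unfolding theta_free_def using no_long_theta by (metis Un_subset_iff)
  moreover have "cross_free (vertices G) (edges G)"
    unfolding cross_free_def using no_crossing_chords by blast
  ultimately show ?thesis
    using theta_cross_free_imp_noncrossing G unfolding simple_graph_def one_page_def by blast
qed

text \<open>An order for the graph with an additional edge would give an outerplanar drawing of it,
  so maximality passes from drawings to orders.\<close>

lemma maximal_outerplanar_imp_maximal_one_page:
  assumes "maximal_outerplanar G" "3 \<le> card (vertices G)"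
  shows "maximal_one_page (vertices G) (edges G)"
proof
  have G: "simple_graph G" "outerplanar G" using assms(1) unfolding maximal_outerplanar_def by auto
  have E: "e \<in> {{u, v} | u v. u \<in> vertices G \<and> v \<in> vertices G \<and> u \<noteq> v}" if "e \<in> edges G" for e
    using G(1) that unfolding simple_graph_def by (meson subsetD)
  show "finite (vertices G)" using G unfolding simple_graph_def by blast
  show "3 \<le> card (vertices G)" by fact
  show "e \<subseteq> vertices G" if "e \<in> edges G" for e using E[OF that] by auto
  show "{u, u} \<notin> edges G" for u using E[of "{u, u}"] by auto
  show "one_page (vertices G) (edges G)" using outerplanar_imp_one_page G by blast
  fix u v assume uv: "u \<in> vertices G" "v \<in> vertices G" "u \<noteq> v" "{u, v} \<notin> edges G"
  let ?G' = "(vertices G, insert {u, v} (edges G))"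
  have "simple_graph ?G'" using G(1) uv unfolding simple_graph_def by auto
  moreover have "\<not> outerplanar ?G'" using assms(1) uv unfolding maximal_outerplanar_def by blast
  ultimately show "\<not> one_page (vertices G) (insert {u, v} (edges G))"
    using noncrossing_imp_outerplanar[of ?G'] unfolding one_page_def by auto
qed

lemma one_page_image:
  assumes f: "inj_on f V" and E: "\<And>e. e \<in> E \<Longrightarrow> e \<subseteq> V"
  shows "one_page (f ` V) ((`) f ` E) \<longleftrightarrow> one_page V E"
proof
  assume "one_page (f ` V) ((`) f ` E)"
  then obtain g where g: "inj_on g (f ` V)" "noncrossing g ((`) f ` E)" unfolding one_page_def by blast
  have "inj_on (g \<circ> f) V" using f g(1) by (rule comp_inj_on)
  moreover have "noncrossing (g \<circ> f) E"
    unfolding noncrossing_def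
  proof (intro allI impI notI)
    fix a b c d assume o: "(g \<circ> f) a < (g \<circ> f) b" "(g \<circ> f) b < (g \<circ> f) c" "(g \<circ> f) c < (g \<circ> f) d"
      and ed: "{a, c} \<in> E" "{b, d} \<in> E"
    have "f ` {a, c} \<in> (`) f ` E" "f ` {b, d} \<in> (`) f ` E" by (rule imageI[OF ed(1)] imageI[OF ed(2)])+
    then show False using g(2)[unfolded noncrossing_def, rule_format, of "f a" "f b" "f c" "f d"] o by simp
  qed
  ultimately show "one_page V E" unfolding one_page_def by blast
next
  assume "one_page V E"
  then obtain g where g: "inj_on g V" "noncrossing g E" unfolding one_page_def by blast
  let ?i = "inv_into V f"
  have "inj_on (g \<circ> ?i) (f ` V)"
    using g(1) f by (intro comp_inj_on inj_on_inv_into) (auto simp: inj_on_def)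
  moreover have "noncrossing (g \<circ> ?i) ((`) f ` E)"
    unfolding noncrossing_def
  proof (intro allI impI notI)
    have pre: "{?i a, ?i c} \<in> E" if ac: "{a, c} \<in> (`) f ` E" for a c
    proof -
      obtain e where e: "e \<in> E" "{a, c} = f ` e" using ac by auto
      have "?i ` {a, c} = e" unfolding e(2) using f E[OF e(1)] by (rule inv_into_image_cancel)
      then show ?thesis using e(1) by simp
    qed
    fix a b c d assume "(g \<circ> ?i) a < (g \<circ> ?i) b" "(g \<circ> ?i) b < (g \<circ> ?i) c" "(g \<circ> ?i) c < (g \<circ> ?i) d"
      and "{a, c} \<in> (`) f ` E" "{b, d} \<in> (`) f ` E"
    then show False using g(2)[unfolded noncrossing_def, rule_format, of "?i a" "?i b" "?i c" "?i d"] pre by simp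
  qed
  ultimately show "one_page (f ` V) ((`) f ` E)" unfolding one_page_def by blast
qed

lemma image_edge_iff:
  assumes f: "inj_on f V" and E: "\<And>e. e \<in> E \<Longrightarrow> e \<subseteq> V" and uv: "u \<in> V" "v \<in> V"
  shows "{f u, f v} \<in> (`) f ` E \<longleftrightarrow> {u, v} \<in> E"
proof
  assume "{f u, f v} \<in> (`) f ` E"
  then obtain e where e: "e \<in> E" "f ` {u, v} = f ` e" by auto
  then have "{u, v} = e" using inj_on_image_eq_iff[OF f, of "{u, v}" e] E[OF e(1)] uv by simp
  then show "{u, v} \<in> E" using e by simp
next
  assume "{u, v} \<in> E"
  then have "f ` {u, v} \<in> (`) f ` E" by (rule imageI)
  then show "{f u, f v} \<in> (`) f ` E" by simp
qed

lemma maximal_one_page_image: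
  assumes "maximal_one_page V E" and f: "inj_on f V"
  shows "maximal_one_page (f ` V) ((`) f ` E)"
proof -
  interpret maximal_one_page V E by fact
  show ?thesis
  proof
    show "finite (f ` V)" using fin by simp
    show "3 \<le> card (f ` V)" using card f by (simp add: card_image)
    show "e \<subseteq> f ` V" if "e \<in> (`) f ` E" for e using that edge_subset by auto
    show "{w, w} \<notin> (`) f ` E" for w
    proof
      assume w: "{w, w} \<in> (`) f ` E"
      then obtain e where "e \<in> E" "{w, w} = f ` e" by auto
      then have "w \<in> f ` V" using edge_subset by blast
      then obtain v where v: "v \<in> V" "w = f v" by auto
      then show False using w image_edge_iff[OF f edge_subset v(1) v(1)] no_loop by auto
    qed
    show "one_page (f ` V) ((`) f ` E)" using one_page_image[OF f edge_subset] one_page by blast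
    fix u' v' assume uv: "u' \<in> f ` V" "v' \<in> f ` V" "u' \<noteq> v'" "{u', v'} \<notin> (`) f ` E"
    then obtain u v where u: "u \<in> V" "v \<in> V" "u' = f u" "v' = f v" by auto
    then have "u \<noteq> v" "{u, v} \<notin> E" using uv image_edge_iff[OF f edge_subset u(1,2)] by auto
    then have no: "\<not> one_page V (insert {u, v} E)" using maximal u by blast
    have "insert {u', v'} ((`) f ` E) = (`) f ` insert {u, v} E" using u by simp
    moreover have "e \<subseteq> V" if "e \<in> insert {u, v} E" for e using that u edge_subset by auto
    ultimately show "\<not> one_page (f ` V) (insert {u', v'} ((`) f ` E))"
      using one_page_image[OF f, of "insert {u, v} E"] no by simp
  qed
qed

section \<open>Metric dimension\<close>

locale finite_connected_graph =
  fixes G :: "'a ugraph"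
  assumes simple: "simple_graph G" and connected: "connected_graph G"
begin

lemma edge_ends: "{u, v} \<in> edges G \<Longrightarrow> u \<in> vertices G \<and> v \<in> vertices G \<and> u \<noteq> v"
proof -
  assume "{u, v} \<in> edges G"
  then have "{u, v} \<in> {{u, v} | u v. u \<in> vertices G \<and> v \<in> vertices G \<and> u \<noteq> v}"
    using simple unfolding simple_graph_def by (meson subsetD)
  then show ?thesis by (auto simp: doubleton_eq_iff)
qed

lemma gdist_path:
  assumes "u \<in> vertices G" "v \<in> vertices G"
  obtains xs where "path_between G u v xs" "length xs = Suc (gdist G u v)"
proof -
  obtain ys where ys: "path_between G u v ys" using connected assms unfolding connected_graph_def by blast
  then have "length ys = Suc (length ys - 1)" unfolding path_between_def by (cases ys) auto
  then have "\<exists>k xs. path_between G u v xs \<and> length xs = Suc k" using ys by blast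
  from LeastI_ex[OF this] show thesis using that unfolding gdist_def by blast
qed

lemma gdist_le: "path_between G u v xs \<Longrightarrow> length xs = Suc k \<Longrightarrow> gdist G u v \<le> k"
  unfolding gdist_def by (rule Least_le) blast

lemma gdist_refl: "u \<in> vertices G \<Longrightarrow> gdist G u u = 0"
  using gdist_le[of u u "[u]" 0] by (simp add: path_between_def)

lemma gdist_eq_0:
  assumes "u \<in> vertices G" "v \<in> vertices G" "gdist G u v = 0"
  shows "u = v"
proof -
  obtain xs where xs: "path_between G u v xs" "length xs = Suc 0" using gdist_path[OF assms(1,2)] assms(3) by metis
  then obtain x where "xs = [x]" by (metis length_0_conv length_Suc_conv)
  then show ?thesis using xs unfolding path_between_def by auto
qed

lemma gdist_less_card:
  assumes "u \<in> vertices G" "v \<in> vertices G"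
  shows "gdist G u v < card (vertices G)"
proof -
  obtain xs where xs: "path_between G u v xs" "length xs = Suc (gdist G u v)" using gdist_path[OF assms] .
  then have "card (set xs) = Suc (gdist G u v)" "set xs \<subseteq> vertices G"
    unfolding path_between_def by (auto simp: distinct_card)
  then show ?thesis using card_mono[of "vertices G" "set xs"] simple unfolding simple_graph_def by simp
qed

text \<open>Paths are repetition-free, so if \<open>u\<close> already occurs on the path from
  \<open>w\<close>, the part from \<open>u\<close> on is used.\<close>

lemma gdist_edge:
  assumes e: "{u, w} \<in> edges G" and v: "v \<in> vertices G"
  shows "gdist G u v \<le> Suc (gdist G w v)"
proof -
  obtain xs where xs: "path_between G w v xs" "length xs = Suc (gdist G w v)"
    using gdist_path edge_ends[OF e] v by metis
  show ?thesis
  proof (cases "u \<in> set xs")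
    case True
    then obtain as bs where s: "xs = as @ u # bs" by (meson split_list)
    have "path_between G u v (u # bs)" using xs(1) unfolding path_between_def s
      by (auto simp: successively_append_iff)
    then show ?thesis using gdist_le[of u v "u # bs" "length bs"] xs(2) s by auto
  next
    case False
    have "path_between G u v (u # xs)" using xs(1) False e edge_ends[OF e] unfolding path_between_def
      by (auto simp: successively_Cons)
    then show ?thesis using gdist_le[of u v "u # xs" "Suc (gdist G w v)"] xs(2) by auto
  qed
qed

lemma gdist_descend:
  assumes u: "u \<in> vertices G" and v: "v \<in> vertices G" and k: "gdist G u v = Suc k"
  obtains w where "{u, w} \<in> edges G" "gdist G w v = k"
proof -
  obtain xs where xs: "path_between G u v xs" "length xs = Suc (Suc k)" using gdist_path[OF u v] k by metis
  then obtain a w ys where s: "xs = a # w # ys" by (metis length_Suc_conv)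
  then have e: "{u, w} \<in> edges G" and p: "path_between G w v (w # ys)"
    using xs(1) unfolding path_between_def by auto
  have "gdist G w v \<le> k" using gdist_le[OF p, of k] xs(2) s by simp
  moreover have "Suc k \<le> Suc (gdist G w v)" using gdist_edge[OF e v] k by simp
  ultimately show thesis using that e by simp
qed

lemma gdist_triangle:
  assumes "u \<in> vertices G" "v \<in> vertices G" "w \<in> vertices G"
  shows "gdist G u w \<le> gdist G u v + gdist G v w"
  using assms
proof (induction "gdist G u v" arbitrary: u)
  case 0
  then show ?case using gdist_eq_0[of u v] by simp
next
  case (Suc k)
  then obtain x where x: "{u, x} \<in> edges G" "gdist G x v = k" using gdist_descend[of u v k] by metis
  then have "gdist G x w \<le> k + gdist G v w" using Suc edge_ends[OF x(1)] by auto
  then show ?case using gdist_edge[OF x(1) Suc.prems(3)] Suc.hyps(2) by simp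
qed

lemma gdist_sym_le:
  assumes "u \<in> vertices G" "v \<in> vertices G"
  shows "gdist G v u \<le> gdist G u v"
proof -
  obtain xs where xs: "path_between G u v xs" "length xs = Suc (gdist G u v)" using gdist_path[OF assms] .
  have "path_between G v u (rev xs)"
    using xs(1) unfolding path_between_def by (auto simp: hd_rev last_rev insert_commute)
  then show ?thesis using gdist_le xs(2) by simp
qed

lemma gdist_sym: "u \<in> vertices G \<Longrightarrow> v \<in> vertices G \<Longrightarrow> gdist G u v = gdist G v u"
  using gdist_sym_le by (simp add: le_antisym)

text \<open>Descent yields a path of length at most \<open>\<phi> v\<close>, and a function that
  drops by at most one per edge never exceeds the distance to its zero. This lets distances be read
  off coordinates.\<close>

lemma gdist_eq_potential:
  fixes \<phi> :: "'a \<Rightarrow> nat"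
  assumes a: "a \<in> vertices G" "\<phi> a = 0" and zero: "\<And>v. v \<in> vertices G \<Longrightarrow> \<phi> v = 0 \<Longrightarrow> v = a"
    and step: "\<And>u v. {u, v} \<in> edges G \<Longrightarrow> \<phi> u \<le> Suc (\<phi> v)"
    and descend: "\<And>v k. v \<in> vertices G \<Longrightarrow> \<phi> v = Suc k \<Longrightarrow> \<exists>w. {v, w} \<in> edges G \<and> \<phi> w = k"
    and v: "v \<in> vertices G"
  shows "gdist G v a = \<phi> v"
proof (rule antisym)
  show "gdist G v a \<le> \<phi> v" using v
  proof (induction "\<phi> v" arbitrary: v)
    case 0
    then show ?case using zero[of v] gdist_refl by simp
  next
    case (Suc k)
    then obtain w where w: "{v, w} \<in> edges G" "\<phi> w = k" using descend[of v k] by metis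
    then have "gdist G w a \<le> k" using Suc.hyps(1)[of w] edge_ends[OF w(1)] by simp
    then show ?case using gdist_edge[OF w(1) a(1)] Suc.hyps(2) by simp
  qed
  show "\<phi> v \<le> gdist G v a" using v
  proof (induction "gdist G v a" arbitrary: v)
    case 0
    then show ?case using gdist_eq_0[of v a] a by simp
  next
    case (Suc k)
    then obtain w where w: "{v, w} \<in> edges G" "gdist G w a = k" using gdist_descend[of v a k] a by metis
    then have "\<phi> w \<le> k" using Suc.hyps(1)[of w] edge_ends[OF w(1)] by simp
    then show ?case using step[OF w(1)] Suc.hyps(2) by simp
  qed
qed

lemma resolving_pair_of_metric_dimension:
  assumes "metric_dimension G = 2"
  obtains a b where "a \<noteq> b" "resolving_set G {a, b}"
proof -
  have "resolving_set G (vertices G)"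
    unfolding resolving_set_def resolves_def using gdist_refl gdist_eq_0 by (metis order_refl)
  then have "\<exists>k S. resolving_set G S \<and> card S = k" by blast
  from LeastI_ex[OF this] obtain S where "resolving_set G S" "card S = 2"
    using assms unfolding metric_dimension_def by auto
  then show thesis using that by (metis card_2_iff)
qed

text \<open>A single vertex cannot resolve a triangle: three distinct distances would have to differ
  pairwise by at most one.\<close>

lemma metric_dimension_2I:
  assumes ab: "resolving_set G {a, b}" "a \<noteq> b"
    and tri: "{u, v} \<in> edges G" "{u, w} \<in> edges G" "{v, w} \<in> edges G"
  shows "metric_dimension G = 2"
  unfolding metric_dimension_def
proof (rule Least_equality)
  show "\<exists>S. resolving_set G S \<and> card S = 2" using ab by (intro exI[of _ "{a, b}"]) simp
  fix k assume "\<exists>S. resolving_set G S \<and> card S = k"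
  then obtain S where S: "resolving_set G S" "card S = k" by blast
  have V: "u \<in> vertices G" "v \<in> vertices G" "w \<in> vertices G" "u \<noteq> v" "u \<noteq> w" "v \<noteq> w"
    using tri edge_ends by blast+
  have fin: "finite S" using S(1) simple unfolding resolving_set_def simple_graph_def by (meson finite_subset)
  show "2 \<le> k"
  proof (rule ccontr)
    assume "\<not> 2 \<le> k"
    then have "card S = 0 \<or> card S = 1" using S(2) by auto
    moreover have "S \<noteq> {}" using S(1) V unfolding resolving_set_def by blast
    ultimately obtain x where x: "S = {x}" using fin by (metis card_0_eq card_1_singletonE)
    then have xV: "x \<in> vertices G" using S(1) unfolding resolving_set_def by blast
    have "gdist G u x \<noteq> gdist G v x" "gdist G u x \<noteq> gdist G w x" "gdist G v x \<noteq> gdist G w x"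
      using S(1) V x unfolding resolving_set_def resolves_def by blast+
    moreover have le: "gdist G p x \<le> Suc (gdist G q x) \<and> gdist G q x \<le> Suc (gdist G p x)" if "{p, q} \<in> edges G" for p q
      using gdist_edge[OF that xV] gdist_edge[of q p x] that xV by (simp add: insert_commute)
    ultimately show False using le[OF tri(1)] le[OF tri(2)] le[OF tri(3)] by linarith
  qed
qed

end

section \<open>The two directions of the equivalence\<close>

lemma representation_of_resolving_pair:
  assumes G: "maximal_outerplanar G" "card (vertices G) = n" "3 \<le> n"
    and ab: "a \<noteq> b" "resolving_set G {a, b}"
  shows "\<exists>H. subgraph H (strong_grid n) \<and> isomorphic G H \<and>
      (\<exists>d\<ge>1. condition1 n H d \<and> condition2 n H d \<and> condition3 H d \<and> condition4 n H d)"
proof -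
  interpret finite_connected_graph G
    using G(1) unfolding maximal_outerplanar_def by unfold_locales auto
  have mop: "maximal_one_page (vertices G) (edges G)"
    using maximal_outerplanar_imp_maximal_one_page G by blast
  then interpret M: maximal_one_page "vertices G" "edges G" .
  \<comment> \<open>Injective because \<open>{a, b}\<close> resolves \<open>G\<close>; its values
    fit into the grid because distances are smaller than the order of \<open>G\<close>.\<close>
  define f where "f v = (int (gdist G v a), int (gdist G v b))" for v
  define d where "d = int (gdist G a b)"
  let ?V = "f ` vertices G" and ?E = "(`) f ` edges G"
  have V: "a \<in> vertices G" "b \<in> vertices G" using ab unfolding resolving_set_def by auto
  have inj: "inj_on f (vertices G)"
    using ab unfolding resolving_set_def resolves_def inj_on_def f_def by auto
  have fE: "{f u, f v} \<in> ?E" if "{u, v} \<in> edges G" for u v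
    using image_edge_iff[OF inj M.edge_subset] that edge_ends[OF that] by blast
  have grid: "?V \<subseteq> vertices (strong_grid n)"
    using gdist_less_card V G(2) unfolding f_def strong_grid_def by fastforce
  have Egrid: "?E \<subseteq> edges (strong_grid n)"
  proof
    fix e' assume "e' \<in> ?E"
    then obtain e where e: "e \<in> edges G" "e' = f ` e" by auto
    then have "e \<in> {{u, v} | u v. u \<in> vertices G \<and> v \<in> vertices G \<and> u \<noteq> v}"
      using simple unfolding simple_graph_def by (meson subsetD)
    then obtain u v where uv: "e = {u, v}" unfolding mem_Collect_eq by metis
    then have uvV: "u \<in> vertices G" "v \<in> vertices G" "u \<noteq> v" using edge_ends e by blast+
    have st: "gdist G u x \<le> Suc (gdist G v x)" "gdist G v x \<le> Suc (gdist G u x)" if "x \<in> vertices G" for x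
      using gdist_edge[of u v x] gdist_edge[of v u x] e uv that by (auto simp: insert_commute)
    have "f u \<noteq> f v" using inj uvV by (auto simp: inj_on_def)
    moreover have "gdist G u a < n" "gdist G u b < n" "gdist G v a < n" "gdist G v b < n"
      using gdist_less_card uvV V G(2) by blast+
    ultimately have "{f u, f v} \<in> edges (strong_grid n)"
      unfolding f_def strong_grid_edge using st[OF V(1)] st[OF V(2)] by auto
    then show "e' \<in> edges (strong_grid n)" using e uv by simp
  qed
  have "maximal_one_page ?V ?E" by (rule maximal_one_page_image[OF mop inj])
  moreover have "grid_triangulation_axioms ?V ?E d n"
  proof
    show "1 \<le> d" unfolding d_def using gdist_eq_0[OF V] ab(1) by (cases "gdist G a b") auto
    show "?V \<subseteq> vertices (strong_grid n)" "?E \<subseteq> edges (strong_grid n)" by fact+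
    have "f a = (0, d)" "f b = (d, 0)"
      unfolding f_def d_def using gdist_refl V gdist_sym[OF V] by auto
    then show "(0, d) \<in> ?V" "(d, 0) \<in> ?V" using V by (metis imageI)+
    show "d \<le> x + y \<and> \<bar>y - x\<bar> \<le> d" if xyV: "(x, y) \<in> ?V" for x y
    proof -
      obtain v where v: "v \<in> vertices G" "x = int (gdist G v a)" "y = int (gdist G v b)"
        using xyV unfolding f_def by auto
      \<comment> \<open>The inequalities defining the region are the triangle inequalities among
        \<open>a\<close>, \<open>b\<close> and \<open>v\<close>.\<close>
      have "gdist G a b \<le> gdist G a v + gdist G v b" "gdist G v b \<le> gdist G v a + gdist G a b"
        "gdist G v a \<le> gdist G v b + gdist G b a" using gdist_triangle v(1) V by blast+
      then show ?thesis using v gdist_sym[OF V] gdist_sym[OF V(1) v(1)] unfolding d_def by auto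
    qed
    have closer: "\<exists>w. {f v, f w} \<in> ?E \<and> int (gdist G w c) = int (gdist G v c) - 1"
      if vc: "v \<in> vertices G" "c \<in> vertices G" "0 < int (gdist G v c)" for v c
    proof -
      have "gdist G v c = Suc (gdist G v c - 1)" using vc(3) by simp
      then obtain w where "{v, w} \<in> edges G" "gdist G w c = gdist G v c - 1" using gdist_descend[OF vc(1,2)] by metis
      then show ?thesis using fE vc(3) by (intro exI[of _ w]) auto
    qed
    show "\<exists>y'. {(x, y), (x-1, y')} \<in> ?E" if xy: "(x, y) \<in> ?V" "0 < x" for x y
    proof -
      obtain v where v: "v \<in> vertices G" "f v = (x, y)" using xy(1) by auto
      then have "x = int (gdist G v a)" unfolding f_def by simp
      then obtain w where w: "{f v, f w} \<in> ?E" "int (gdist G w a) = x-1"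
        using closer[OF v(1) V(1)] xy(2) by auto
      then have "f w = (x-1, snd (f w))" unfolding f_def by simp
      then show ?thesis using w(1) v(2) by metis
    qed
    show "\<exists>x'. {(x, y), (x', y-1)} \<in> ?E" if xy: "(x, y) \<in> ?V" "0 < y" for x y
    proof -
      obtain v where v: "v \<in> vertices G" "f v = (x, y)" using xy(1) by auto
      then have "y = int (gdist G v b)" unfolding f_def by simp
      then obtain w where w: "{f v, f w} \<in> ?E" "int (gdist G w b) = y-1"
        using closer[OF v(1) V(2)] xy(2) by auto
      then have "f w = (fst (f w), y-1)" unfolding f_def by simp
      then show ?thesis using w(1) v(2) by metis
    qed
  qed
  ultimately interpret T: grid_triangulation ?V ?E d n by (rule grid_triangulation.intro)
  have "subgraph (?V, ?E) (strong_grid n)"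
    unfolding subgraph_def using grid Egrid T.edge_subset by simp
  moreover have "isomorphic G (?V, ?E)"
    unfolding isomorphic_def
  proof (intro exI[of _ f] conjI ballI)
    show "bij_betw f (vertices G) (vertices (?V, ?E))" using inj by (simp add: bij_betw_def)
    fix u v assume "u \<in> vertices G" "v \<in> vertices G"
    then show "{u, v} \<in> edges G \<longleftrightarrow> {f u, f v} \<in> edges (?V, ?E)"
      using image_edge_iff[OF inj M.edge_subset] by simp
  qed
  ultimately show ?thesis
    using T.d_pos T.holds_condition1 T.holds_condition2 T.holds_condition3 T.holds_condition4 by blast
qed

text \<open>Described vertices descend along described edges, in each coordinate separately. A
  zigzag point beyond the base line is adjacent to \<open>(x-1, y-1)\<close> in the same zigzag,
  which lowers both coordinates at once.\<close>

lemma representation_descends: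
  assumes sub: "subgraph H (strong_grid n)" and d: "1 \<le> d"
    and c: "condition1 n H d" "condition2 n H d" "condition3 H d" "condition4 n H d"
    and v: "(x, y) \<in> vertices H"
  shows "(0 < x \<longrightarrow> (\<exists>y'. {(x, y), (x-1, y')} \<in> edges H)) \<and> (0 < y \<longrightarrow> (\<exists>x'. {(x, y), (x', y-1)} \<in> edges H))"
proof -
  define D where "D w \<longleftrightarrow> (0 < fst w \<longrightarrow> (\<exists>y'. {w, (fst w - 1, y')} \<in> edges H)) \<and>
    (0 < snd w \<longrightarrow> (\<exists>x'. {w, (x', snd w - 1)} \<in> edges H))" for w
  have e1: "{(i, j), (i+1, j-1)} \<in> edges H" if "i + j = d" "0 \<le> i" "i < d" for i j
    using c(1) that unfolding condition1_def edges1_def by blast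
  have "{(0, d), (0 + 1, d - 1)} \<in> edges (strong_grid n)"
    using e1[of 0 d] d sub unfolding subgraph_def by auto
  \<comment> \<open>Points of layer \<open>d + 1\<close> with positive coordinates have coordinates
    up to \<open>d\<close>, so this bound places them in the grid.\<close>
  then have dn: "d \<le> int n - 1" unfolding strong_grid_edge by auto
  have L1: "D (i, j)" if ij: "i + j = d" "0 \<le> i" "0 \<le> j" for i j
  proof -
    have "{(i, j), (i-1, j+1)} \<in> edges H" if "0 < i"
      using e1[of "i-1" "j+1"] ij that by (simp add: insert_commute)
    moreover have "{(i, j), (i+1, j-1)} \<in> edges H" if "0 < j" using e1[of i j] ij that by simp
    ultimately show ?thesis unfolding D_def by auto
  qed
  have L2: "D (i, j)" if ij: "i + j = d + 1" "1 \<le> i" "1 \<le> j" for i j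
  proof -
    have "(i, j) \<in> layer (d + 1) \<inter> grid_region n d"
      using ij dn unfolding layer_def grid_region_def strong_grid_def by auto
    then have "{{(i, j), (i-1, j)}, {(i, j), (i, j-1)}} \<subseteq> edges H"
      using c(2) unfolding condition2_def edges2_def by blast
    then show ?thesis unfolding D_def by auto
  qed
  have desc: "D w" if e: "e \<in> described_edges n H d" "w \<in> e" for e w
  proof -
    consider "e \<in> edges1 d" | "e \<in> edges2 n d" | "e \<in> edges3 H d" using e(1) unfolding described_edges_def by blast
    then show ?thesis
    proof cases
      case 1
      then obtain i j where *: "e = {(i, j), (i+1, j-1)}" "i + j = d" "0 \<le> i" "i < d" unfolding edges1_def by blast
      then show ?thesis using L1[of i j] L1[of "i+1" "j-1"] e(2) by auto
    next
      case 2
      then obtain i j where *: "(i, j) \<in> layer (d + 1) \<inter> grid_region n d"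
        "e = {(i, j), (i-1, j)} \<or> e = {(i, j), (i, j-1)}" unfolding edges2_def by blast
      then have "i + j = d + 1" "1 \<le> i" "1 \<le> j" unfolding layer_def grid_region_def by auto
      then show ?thesis using L2[of i j] L1[of "i-1" j] L1[of i "j-1"] *(2) e(2) by auto
    next
      case 3
      then obtain i j where ij: "1 \<le> i" "1 \<le> j" "{(i, j+1), (i+1, j)} \<subseteq> layer (d + 1)"
        and sq: "e \<in> square_edges H i j" unfolding edges3_def by blast
      have s: "i + j = d" using ij by (auto simp: layer_def)
      note c3 = c(3)[unfolded condition3_def, rule_format, of i j]
      have corner: "D (i+1, j+1)" if "corner_edges i j \<subseteq> edges H"
      proof -
        have "{(i+1, j+1), (i, j+1)} \<in> edges H" "{(i+1, j+1), (i+1, j)} \<in> edges H"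
          using that unfolding corner_edges_def by (auto simp: insert_commute)
        then show ?thesis unfolding D_def by auto
      qed
      have three: "D (i, j)" "D (i, j+1)" "D (i+1, j)" using L1[of i j] L2[of i "j+1"] L2[of "i+1" j] ij s by auto
      show ?thesis
      proof (cases "e = antidiagonal i j")
        case True
        then show ?thesis using e(2) three unfolding antidiagonal_def by auto
      next
        case False
        then have "corner_edges i j \<subseteq> edges H" "e \<in> insert (diagonal i j) (corner_edges i j)"
          using sq c3 ij unfolding square_edges_def by (auto split: if_splits)
        then show ?thesis using corner three e(2) unfolding diagonal_def corner_edges_def by auto
      qed
    qed
  qed
  have "D (x, y)"
  proof (cases "(x, y) \<in> described_vertices n H d")
    case True
    then consider "(x, y) \<in> vertices1 n d" | "(x, y) \<in> vertices2 n d" | "(x, y) \<in> vertices3 H d"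
      unfolding described_vertices_def by blast
    then show ?thesis
    proof cases
      case 1
      then show ?thesis using L1 unfolding vertices1_def layer_def grid_region_def strong_grid_def by auto
    next
      case 2
      then have "x + y = d + 1" "1 \<le> x" "1 \<le> y" unfolding vertices2_def layer_def grid_region_def by auto
      then show ?thesis using L2 by blast
    next
      case 3
      then show ?thesis using desc unfolding vertices3_def described_edges_def by blast
    qed
  next
    case False
    then obtain Z where Z: "Z \<in> zigzags n H d" "(x, y) \<in> vertices Z"
      using conjunct1[OF c(4)[unfolded condition4_def]] v by (metis DiffI)
    then obtain b where b: "subgraph Z H" "b \<in> base_lines n H d" "vertical_zigzag n b Z \<or> horizontal_zigzag n b Z"
      unfolding zigzags_def by blast
    then obtain \<delta> s t where st: "b = strip \<delta> s (s + 1)" "s + 2 \<le> t" "strip \<delta> s t \<subseteq> vertices (strong_grid n)"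
      "Z = induced_subgraph (strong_grid n) (strip \<delta> s t)" unfolding zigzag_iff_strip by blast
    have xy: "(x, y) \<in> strip \<delta> s t" using Z(2) st(4) unfolding induced_subgraph_def by simp
    \<comment> \<open>The diagonal predecessor is two layers lower, hence in the strip from layer
      \<open>s + 2\<close> on; the two points before that form the base line.\<close>
    show ?thesis
    proof (cases "s + 2 \<le> x + y")
      case True
      then have xy': "(x-1, y-1) \<in> strip \<delta> s t" using xy by auto
      then have "(x, y) \<in> vertices (strong_grid n)" "(x-1, y-1) \<in> vertices (strong_grid n)"
        using st(3) xy by blast+
      then have "{(x, y), (x-1, y-1)} \<in> edges (strong_grid n)"
        unfolding strong_grid_edge by (auto simp: strong_grid_def)
      then have "{(x, y), (x-1, y-1)} \<in> edges Z" using xy xy' st(4) unfolding induced_subgraph_def by simp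
      then have "{(x, y), (x-1, y-1)} \<in> edges H" using b(1) unfolding subgraph_def by blast
      then show ?thesis unfolding D_def by auto
    next
      case False
      then have m: "(x, y) \<in> b" using xy st(1) by auto
      consider "b = {(0, d), (1, d)}" | "b = {(d, 0), (d, 1)}" | "b \<in> described_edges n H d"
        using b(2) unfolding base_lines_def by blast
      then show ?thesis
      proof cases
        case 1
        then show ?thesis using m L1[of 0 d] L2[of 1 d] d by auto
      next
        case 2
        then show ?thesis using m L1[of d 0] L2[of d 1] d by auto
      next
        case 3
        then show ?thesis using desc m by blast
      qed
    qed
  qed
  then show ?thesis unfolding D_def by simp
qed

lemma metric_dimension_of_representation:
  assumes G: "maximal_outerplanar G" and sub: "subgraph H (strong_grid n)" and iso: "isomorphic G H" and d: "1 \<le> d"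
    and c: "condition1 n H d" "condition2 n H d" "condition3 H d" "condition4 n H d"
  shows "metric_dimension G = 2"
proof -
  interpret finite_connected_graph G
    using G(1) unfolding maximal_outerplanar_def by unfold_locales auto
  obtain f where f: "bij_betw f (vertices G) (vertices H)"
    "\<And>u v. u \<in> vertices G \<Longrightarrow> v \<in> vertices G \<Longrightarrow> {u, v} \<in> edges G \<longleftrightarrow> {f u, f v} \<in> edges H"
    using iso unfolding isomorphic_def by blast
  have inj: "inj_on f (vertices G)" and img: "f ` vertices G = vertices H"
    using f(1) by (auto simp: bij_betw_def)
  have region: "0 \<le> fst w \<and> 0 \<le> snd w \<and> d \<le> fst w + snd w \<and> \<bar>snd w - fst w\<bar> \<le> d" if "w \<in> vertices H" for w
    using c(1) that unfolding condition1_def grid_region_def strong_grid_def by auto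
  have fV: "f v \<in> vertices H" if "v \<in> vertices G" for v using img that by blast
  have HV: "w \<in> vertices H" if "{w, w'} \<in> edges H" for w w' using sub that unfolding subgraph_def by blast
  have e1: "{(0, d), (1, d - 1)} \<in> edges H"
  proof -
    have "{(0, d), (0 + 1, d - 1)} \<in> edges1 d" unfolding edges1_def mem_Collect_eq
      by (rule exI[of _ 0], rule exI[of _ d]) (use d in auto)
    then show ?thesis using c(1) unfolding condition1_def by auto
  qed
  then have V0: "(0, d) \<in> vertices H" "(1, d - 1) \<in> vertices H" using HV[of "(0, d)"] HV[of "(1, d - 1)"] by (auto simp: insert_commute)
  have "{(0, d), (1, d - 1)} \<in> edges (strong_grid n)" using e1 sub unfolding subgraph_def by blast
  then have dn: "d \<le> int n - 1" unfolding strong_grid_edge by auto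
  have "(d, 0) \<in> vertices1 n d"
    unfolding vertices1_def layer_def grid_region_def strong_grid_def using d dn by auto
  then have V1: "(d, 0) \<in> vertices H" using c(1) unfolding condition1_def by blast
  have "(1, d) \<in> layer (d + 1) \<inter> grid_region n d"
    unfolding layer_def grid_region_def strong_grid_def using d dn by auto
  then have "{{(1, d), (1 - 1, d)}, {(1, d), (1, d - 1)}} \<subseteq> edges H" using c(2) unfolding condition2_def edges2_def by blast
  then have e2: "{(0, d), (1, d)} \<in> edges H" "{(1, d - 1), (1, d)} \<in> edges H" by (auto simp: insert_commute)
  have V2: "(1, d) \<in> vertices H" using HV[of "(1, d)"] e2 by (auto simp: insert_commute)
  have pre: "\<exists>v\<in>vertices G. f v = w" if "w \<in> vertices H" for w using that unfolding img[symmetric] by auto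
  obtain a where a: "a \<in> vertices G" "f a = (0, d)" using pre[OF V0(1)] by blast
  obtain b where b: "b \<in> vertices G" "f b = (d, 0)" using pre[OF V1] by blast
  obtain u where u: "u \<in> vertices G" "f u = (1, d - 1)" using pre[OF V0(2)] by blast
  obtain w where w: "w \<in> vertices G" "f w = (1, d)" using pre[OF V2] by blast
  have step: "\<bar>fst (f p) - fst (f q)\<bar> \<le> 1 \<and> \<bar>snd (f p) - snd (f q)\<bar> \<le> 1" if "{p, q} \<in> edges G" for p q
  proof -
    have "{f p, f q} \<in> edges (strong_grid n)"
      using f(2) edge_ends[OF that] that sub unfolding subgraph_def by blast
    then show ?thesis
      using strong_grid_edge[of "fst (f p)" "snd (f p)" "fst (f q)" "snd (f q)" n] by auto
  qed
  have down: "(0 < fst (f v) \<longrightarrow> (\<exists>w. {v, w} \<in> edges G \<and> fst (f w) = fst (f v) - 1)) \<and>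
      (0 < snd (f v) \<longrightarrow> (\<exists>w. {v, w} \<in> edges G \<and> snd (f w) = snd (f v) - 1))" if v: "v \<in> vertices G" for v
  proof -
    have pull: "\<exists>w. {v, w} \<in> edges G \<and> f w = z" if "{f v, z} \<in> edges H" for z
    proof -
      have "z \<in> vertices H" using HV[of z "f v"] that by (simp add: insert_commute)
      then obtain w where "w \<in> vertices G" "f w = z" using pre by blast
      then show ?thesis using f(2)[OF v] that by auto
    qed
    have "(fst (f v), snd (f v)) \<in> vertices H" using fV[OF v] by simp
    from representation_descends[OF sub d c this] show ?thesis
      using pull by (metis fst_conv prod.collapse snd_conv)
  qed
  \<comment> \<open>One statement for both projections. In the region a coordinate vanishes only at
    one corner, so \<open>gdist_eq_potential\<close> applies.\<close>
  have dist: "gdist G v c = nat (\<pi> (f v))"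
    if v: "v \<in> vertices G" and c: "c \<in> vertices G" "\<pi> (f c) = 0" and proj: "\<pi> = fst \<or> \<pi> = snd" for \<pi> v c
  proof (rule gdist_eq_potential[of c "\<lambda>v. nat (\<pi> (f v))", OF c(1) _ _ _ _ v])
    show "nat (\<pi> (f c)) = 0" using c by simp
    show "v = c" if "v \<in> vertices G" "nat (\<pi> (f v)) = 0" for v
    proof -
      have "f v = f c" using region[OF fV[OF that(1)]] region[OF fV[OF c(1)]] that(2) c(2) proj
        by (auto simp: prod_eq_iff)
      then show ?thesis using inj that(1) c(1) by (auto simp: inj_on_def)
    qed
    show "nat (\<pi> (f p)) \<le> Suc (nat (\<pi> (f q)))" if "{p, q} \<in> edges G" for p q using step[OF that] proj by auto
    show "\<exists>w. {v, w} \<in> edges G \<and> nat (\<pi> (f w)) = k" if vk: "v \<in> vertices G" "nat (\<pi> (f v)) = Suc k" for v k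
    proof -
      have "0 < \<pi> (f v)" using vk(2) by simp
      then obtain w where "{v, w} \<in> edges G" "\<pi> (f w) = \<pi> (f v) - 1" using down[OF vk(1)] proj by auto
      then show ?thesis using vk(2) by (intro exI[of _ w]) auto
    qed
  qed
  have da: "gdist G v a = nat (fst (f v))" and db: "gdist G v b = nat (snd (f v))" if "v \<in> vertices G" for v
    using dist[OF that a(1), of fst] dist[OF that b(1), of snd] a b by auto
  have "resolving_set G {a, b}"
    unfolding resolving_set_def
  proof (intro conjI ballI impI)
    show "{a, b} \<subseteq> vertices G" using a b by simp
    fix p q assume pq: "p \<in> vertices G" "q \<in> vertices G" "p \<noteq> q"
    have "\<not> (gdist G p a = gdist G q a \<and> gdist G p b = gdist G q b)"
    proof
      assume "gdist G p a = gdist G q a \<and> gdist G p b = gdist G q b"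
      then have "f p = f q"
        using da[OF pq(1)] da[OF pq(2)] db[OF pq(1)] db[OF pq(2)] region[OF fV[OF pq(1)]] region[OF fV[OF pq(2)]]
        by (simp add: prod_eq_iff eq_nat_nat_iff)
      then show False using inj pq by (auto simp: inj_on_def)
    qed
    then show "\<exists>x\<in>{a, b}. resolves G x p q" unfolding resolves_def by auto
  qed
  moreover have "a \<noteq> b" using a b d by auto
  moreover have "{a, u} \<in> edges G" "{a, w} \<in> edges G" "{u, w} \<in> edges G"
    using f(2)[OF a(1) u(1)] f(2)[OF a(1) w(1)] f(2)[OF u(1) w(1)] a u w e1 e2 by auto
  ultimately show ?thesis by (rule metric_dimension_2I)
qed

theorem theorem3:
  fixes G :: "'a ugraph" and n :: nat
  assumes "maximal_outerplanar G" and "card (vertices G) = n" and "n \<ge> 3"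
  shows "metric_dimension G = 2 \<longleftrightarrow>
    (\<exists>H. subgraph H (strong_grid n) \<and> isomorphic G H \<and>
      (\<exists>d\<ge>1. condition1 n H d \<and> condition2 n H d \<and> condition3 H d \<and> condition4 n H d))"
proof
  assume dim: "metric_dimension G = 2"
  interpret finite_connected_graph G
    using assms(1) unfolding maximal_outerplanar_def by unfold_locales auto
  obtain a b where "a \<noteq> b" "resolving_set G {a, b}" using resolving_pair_of_metric_dimension[OF dim] .
  then show "\<exists>H. subgraph H (strong_grid n) \<and> isomorphic G H \<and>
      (\<exists>d\<ge>1. condition1 n H d \<and> condition2 n H d \<and> condition3 H d \<and> condition4 n H d)"
    using representation_of_resolving_pair[OF assms] by blast
next
  assume "\<exists>H. subgraph H (strong_grid n) \<and> isomorphic G H \<and>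
      (\<exists>d\<ge>1. condition1 n H d \<and> condition2 n H d \<and> condition3 H d \<and> condition4 n H d)"
  then show "metric_dimension G = 2" using metric_dimension_of_representation[OF assms(1)] by blast
qed

end
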